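(* Let $\rho>0$. Suppose $V:\mathbb R^d\to[0,\infty]$ is continuous at $0$ with $V(0)=0$, and that for every integer $j\ge1$, $$\frac1{L^d}\sum_{x\in\mathbb Z^d}e^{-jV(x/L)}\to\int_{\mathbb R^d}e^{-jV(x)}\,dx\qquad\text{as }L\to\infty.$$ Then $$\nu_\infty=\mu_\infty=\max\Bigl(0,\,1-\frac{\rho_{\rm c}}{\rho}\Bigr),$$ where $$\nu_\infty=\lim_{K\to\infty}\ \lim_{n\to\infty,\ \rho L^d=n}\mathbb E_{L,n}\Bigl(\frac1n\sum_{j>K}jR_j\Bigr),\qquad\mu_\infty=\lim_{K\to\infty}\ \lim_{n\to\infty,\ \rho L^d=n}\mathbb E_{L,n}\Bigl(\frac1n\sum_{x:\,\eta_x>K}\eta_x\Bigr).$$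
   Context: Let $d\ge1$ and let $(\theta_j)_{j\ge1}$ be non-negative weights. A spatial partition of $n$ is a family $\boldsymbol\lambda=(\lambda_x)_{x\in\mathbb Z^d}$ of integer partitions (possibly empty) whose parts sum in total to $n$; $\Lambda_n$ is the set of these. $r_{xj}(\boldsymbol\lambda)$ is the number of parts of $\lambda_x$ equal to $j$; $\eta_x=\sum_jj\,r_{xj}$; $R_j=\sum_xr_{xj}$. With $L$ determined by $\rho L^d=n$, $$\mathbb P_{L,n}(\boldsymbol\lambda)=\frac1{Z_{L,n}}\prod_{x\in\mathbb Z^d}\prod_{j\ge1}\frac1{r_{xj}(\boldsymbol\lambda)!}\Bigl(\frac{\theta_j}{j}e^{-jV(x/L)}\Bigr)^{r_{xj}(\boldsymbol\lambda)}$$ is a probability measure on $\Lambda_n$ with normalization $Z_{L,n}$, assumed to satisfy $0<Z_{L,n}<\infty$; $\mathbb E_{L,n}$ is its expectation; $e^{-\infty}=0$, $0^0=1$. Define $$\rho(z)=\sum_{j\ge1}\theta_jz^j\int_{\mathbb R^d}e^{-jV(x)}\,dx,$$ let $z_{\rm c}\in(0,\infty]$ be the radius of convergence of this power series (assumed positive), and let $\rho_{\rm c}=\rho(z_{\rm c})\in[0,\infty]$ be the transition density. *)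

theory Defs
  imports "HOL-Probability.Probability"
begin

type_synonym 'd spatial_partition = "int ^ 'd \<Rightarrow> nat multiset"

definition part_count :: "'d::finite spatial_partition \<Rightarrow> int ^ 'd \<Rightarrow> nat \<Rightarrow> nat" where
  "part_count lam x j = count (lam x) j"

definition site_mass :: "'d::finite spatial_partition \<Rightarrow> int ^ 'd \<Rightarrow> nat" where
  "site_mass lam x = (\<Sum>j\<in>set_mset (lam x). j * part_count lam x j)"

text \<open>Sums and products over \<open>\<int>\<^sup>d\<close> or over all part sizes are restricted to the indices at which
  the term is nontrivial, because \<^const>\<open>sum\<close> and \<^const>\<open>prod\<close> are trivial on infinite sets. For
  members of \<open>spatial_partitions n\<close> these index sets are finite.\<close>

definition total_count :: "'d::finite spatial_partition \<Rightarrow> nat \<Rightarrow> nat" where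
  "total_count lam j = (\<Sum>x | part_count lam x j \<noteq> 0. part_count lam x j)"

definition spatial_partitions :: "nat \<Rightarrow> 'd::finite spatial_partition set" where
  "spatial_partitions n = {lam. (\<forall>x. 0 \<notin># lam x) \<and> finite {x. lam x \<noteq> {#}} \<and>
     (\<Sum>x | lam x \<noteq> {#}. site_mass lam x) = n}"

definition exp_neg :: "ennreal \<Rightarrow> real" where
  "exp_neg v = (if v = \<infinity> then 0 else exp (- enn2real v))"

definition scaled_site :: "real \<Rightarrow> int ^ 'd \<Rightarrow> real ^ 'd::finite" where
  "scaled_site L x = (\<chi> i. real_of_int (x $ i) / L)"

definition partition_weight ::
  "(nat \<Rightarrow> real) \<Rightarrow> (real ^ 'd \<Rightarrow> ennreal) \<Rightarrow> real \<Rightarrow> 'd::finite spatial_partition \<Rightarrow> real" where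
  "partition_weight \<theta> V L lam =
     (\<Prod>(x, j) \<in> {(x, j). part_count lam x j \<noteq> 0}.
        (\<theta> j / real j * exp_neg (of_nat j * V (scaled_site L x))) ^ part_count lam x j
          / fact (part_count lam x j))"

definition partition_function ::
  "(nat \<Rightarrow> real) \<Rightarrow> (real ^ 'd::finite \<Rightarrow> ennreal) \<Rightarrow> real \<Rightarrow> nat \<Rightarrow> ennreal" where
  "partition_function \<theta> V L n =
     (\<Sum>\<^sub>\<infinity>lam\<in>spatial_partitions n. ennreal (partition_weight \<theta> V L lam))"

definition gibbs_measure ::
  "(nat \<Rightarrow> real) \<Rightarrow> (real ^ 'd \<Rightarrow> ennreal) \<Rightarrow> real \<Rightarrow> nat \<Rightarrow> 'd::finite spatial_partition measure" where
  "gibbs_measure \<theta> V L n = density (count_space (spatial_partitions n))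
     (\<lambda>lam. ennreal (partition_weight \<theta> V L lam) / partition_function \<theta> V L n)"

definition boltzmann_integral :: "(real ^ 'd::finite \<Rightarrow> ennreal) \<Rightarrow> nat \<Rightarrow> real" where
  "boltzmann_integral V j = (\<integral>x. exp_neg (of_nat j * V x) \<partial>lebesgue)"

text \<open>The series \<open>\<rho>(z)\<close> starts at \<open>j = 1\<close>. Taking \<open>z\<close> in \<open>[0, \<infinity>]\<close> gives \<open>\<rho>(z\<^sub>c)\<close> a literal meaning
  also when \<open>z\<^sub>c = \<infinity>\<close> or when the series diverges at \<open>z\<^sub>c\<close>.\<close>

definition density_series ::
  "(nat \<Rightarrow> real) \<Rightarrow> (real ^ 'd::finite \<Rightarrow> ennreal) \<Rightarrow> ennreal \<Rightarrow> ennreal" where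
  "density_series \<theta> V z =
     (\<Sum>j. ennreal (\<theta> (Suc j)) * z ^ Suc j * ennreal (boltzmann_integral V (Suc j)))"

definition critical_fugacity :: "(nat \<Rightarrow> real) \<Rightarrow> (real ^ 'd::finite \<Rightarrow> ennreal) \<Rightarrow> ereal" where
  "critical_fugacity \<theta> V =
     conv_radius (\<lambda>j. if j = 0 then 0 else \<theta> j * boltzmann_integral V j)"

definition transition_density :: "(nat \<Rightarrow> real) \<Rightarrow> (real ^ 'd::finite \<Rightarrow> ennreal) \<Rightarrow> ennreal" where
  "transition_density \<theta> V = density_series \<theta> V (e2ennreal (critical_fugacity \<theta> V))"

definition long_part_mass :: "nat \<Rightarrow> 'd::finite spatial_partition \<Rightarrow> nat" where
  "long_part_mass K lam = (\<Sum>j | j > K \<and> total_count lam j \<noteq> 0. j * total_count lam j)"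

definition heavy_site_mass :: "nat \<Rightarrow> 'd::finite spatial_partition \<Rightarrow> nat" where
  "heavy_site_mass K lam = (\<Sum>x | site_mass lam x > K. site_mass lam x)"

text \<open>\<open>lim\<^sub>K lim\<^sub>n f K n\<close> exists, including every inner limit, and equals \<open>l\<close>.\<close>

definition has_iterated_limit :: "(nat \<Rightarrow> nat \<Rightarrow> real) \<Rightarrow> ereal \<Rightarrow> bool" where
  "has_iterated_limit f l \<longleftrightarrow>
     (\<exists>g. (\<forall>K. f K \<longlonglongrightarrow> g K) \<and> (\<lambda>K. ereal (g K)) \<longlonglongrightarrow> l)"

end

theory Submission
  imports Defs
begin

text \<open>
  Write \<open>A\<^sub>j = \<Sum>x. exp (- j V(x/L))\<close> and \<open>a\<^sub>j = \<theta>\<^sub>j A\<^sub>j\<close>. Deleting one part \<open>j\<close> at the site \<open>x\<close>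
  turns the Gibbs weight of mass \<open>n\<close> into the one of mass \<open>n - j\<close> (\<open>wsum_remove_part\<close>). Since the
  mass is the sum of all parts, this gives \<open>n Z\<^sub>n = \<Sum>j\<le>n. a\<^sub>j Z\<^bsub>n-j\<^esub>\<close> and
  \<open>E (j R\<^sub>j) = a\<^sub>j Z\<^bsub>n-j\<^esub> / Z\<^sub>n\<close>. As \<open>a\<^sub>j / L\<^sup>d\<close> tends to \<open>\<alpha>\<^sub>j = \<theta>\<^sub>j \<integral> exp (- j V)\<close>, the mass fraction in
  short parts is known once \<open>Z\<^bsub>n-j\<^esub> / Z\<^sub>n \<longlonglongrightarrow> z\<^sup>j\<close>, where \<open>z\<close> is the largest number with
  \<open>\<rho>(z) \<le> \<rho>\<close>. Then it tends to \<open>\<rho>(z) / \<rho>\<close>, and \<open>\<rho>(z) = min \<rho> \<rho>\<^sub>c\<close>.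

  The convergence of the ratios \<open>Q\<^sub>m = Z\<^bsub>m-1\<^esub> / Z\<^sub>m\<close> is deterministic analysis of the recursion; the
  weights \<open>\<theta>\<^sub>j\<close> may be as irregular as they like. Non-negativity of the variance of the number of
  parts of size one gives \<open>Q\<^bsub>m+1\<^esub> \<le> Q\<^sub>m + 1 / a\<^sub>1\<close> (\<open>coeff_ratio_step\<close>), where \<open>a\<^sub>1\<close> is of the order
  of the volume. Therefore a large \<open>Q\<^sub>m\<close> forces \<open>Z\<^bsub>m-j\<^esub> / Z\<^sub>m\<close> to be large for all bounded \<open>j\<close>, and
  the recursion then needs more mass than \<open>m\<close> (\<open>density_le_of_ratio_ge\<close>); so \<open>Q\<^sub>n\<close> is
  asymptotically at most \<open>z\<close>. For the lower bound, the maximum of \<open>m \<mapsto> Z\<^sub>m y\<^sup>m\<close> for \<open>y\<close> inside the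
  disc of convergence lies at some \<open>m\<^sub>0 \<le> \<Sum>j. a\<^sub>j y\<^sup>j\<close> (\<open>exp_coeff_maximizer\<close>), and the ratio
  following the maximum is at least \<open>y\<close>. If \<open>z < z\<^sub>c\<close>, take \<open>y\<close> slightly above \<open>z\<close>: the maximum
  lies just beyond \<open>n\<close>, and \<open>Q\<^sub>n\<close> cannot be much smaller than the ratio there. If \<open>z = z\<^sub>c\<close>, take \<open>y\<close>
  slightly below \<open>z\<^sub>c\<close>: the mass missing between \<open>m\<^sub>0\<close> and \<open>n\<close> can be supplied at small exponential
  cost by parts of one large size, so \<open>Z\<^sub>n y\<^sup>n\<close> is not much below the maximum; a small \<open>Q\<^sub>n\<close> would
  then push \<open>Z\<^sub>m y\<^sup>m\<close> above the maximum shortly after \<open>n\<close>.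

  For heavy sites, the parts of size at most \<open>M\<close> at a fixed site are independent of the rest up to
  the constraint on the total mass, so the law of their mass at \<open>x\<close> is explicit in terms of the
  \<open>Z\<^sub>m\<close> (\<open>empty_wsum_eq\<close>), and the ratio limit applies to the expected number of sites with given
  short mass. Forgetting the parts longer than \<open>M\<close> changes at most \<open>n / (M + 1)\<close> sites, which yields
  the inner limits for every \<open>K\<close>. Long parts sit on heavy sites; conversely, the mass of short parts
  on heavy sites is negligible (\<open>heavy_limit_le\<close>), because heavy sites are few and large amounts of
  short mass at one site are rare. Hence both iterated limits agree.
\<close>

section \<open>Coefficients of exponentials of power series\<close>

text \<open>The coefficients of \<open>exp (\<Sum>j. a\<^sub>j z\<^sup>j / j)\<close>. They are introduced by the recursion that comparing
  coefficients in \<open>z F' = (\<Sum>j. a\<^sub>j z\<^sup>j) F\<close> gives: it needs no convergence, and it is the form in which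
  partition functions present themselves, by counting mass.\<close>

fun exp_coeff :: "(nat \<Rightarrow> real) \<Rightarrow> nat \<Rightarrow> real" where
  "exp_coeff a 0 = 1"
| "exp_coeff a (Suc n) = (\<Sum>j\<le>n. a (Suc j) * exp_coeff a (n - j)) / real (Suc n)"

lemma sum_shift_Suc:
  fixes f :: "nat \<Rightarrow> real"
  shows "(\<Sum>j=1..Suc n. f j) = (\<Sum>j\<le>n. f (Suc j))"
  using sum.shift_bounds_cl_Suc_ivl[of f 0 n] by (simp add: atLeast0AtMost)

lemma sum_from_1:
  fixes f :: "nat \<Rightarrow> real"
  shows "(\<Sum>j=1..K. f j) = (\<Sum>j<K. f (Suc j))"
  using sum.shift_bounds_Suc_ivl[of f 0 K]
  by (simp add: atLeastLessThanSuc_atLeastAtMost atLeast0LessThan)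

lemma exp_coeff_rec:
  "real m * exp_coeff a m = (\<Sum>j=1..m. a j * exp_coeff a (m - j))"
proof (cases m)
  case (Suc n)
  then show ?thesis by (simp only: sum_shift_Suc) (simp add: field_simps)
qed simp

text \<open>All identifications of a concrete sequence with an exponential coefficient go through this
  uniqueness of solutions of the recursion.\<close>

lemma exp_coeff_unique:
  assumes "\<And>m. m \<ge> 1 \<Longrightarrow> real m * f m = (\<Sum>j=1..m. a j * f (m - j))"
  shows "f m = f 0 * exp_coeff a m"
proof (induction m rule: less_induct)
  case (less m)
  show ?case
  proof (cases "m = 0")
    case False
    then have "real m * f m = (\<Sum>j=1..m. a j * f (m - j))"
      using assms by simp
    also have "\<dots> = (\<Sum>j=1..m. a j * (f 0 * exp_coeff a (m - j)))"
    proof (rule sum.cong)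
      fix j assume "j \<in> {1..m}"
      then show "a j * f (m - j) = a j * (f 0 * exp_coeff a (m - j))"
        using less[of "m - j"] by simp
    qed simp
    also have "\<dots> = f 0 * (real m * exp_coeff a m)"
      by (simp add: exp_coeff_rec sum_distrib_left mult_ac)
    finally show ?thesis using False by simp
  qed simp
qed

lemma exp_coeff_cong:
  assumes "\<And>j. j \<ge> 1 \<Longrightarrow> a j = b j"
  shows "exp_coeff a m = exp_coeff b m"
proof -
  have "exp_coeff a m = exp_coeff a 0 * exp_coeff b m"
    by (rule exp_coeff_unique) (auto simp: exp_coeff_rec assms)
  then show ?thesis by simp
qed

lemma exp_coeff_nonneg:
  assumes "\<And>j. j \<ge> 1 \<Longrightarrow> 0 \<le> a j"
  shows "0 \<le> exp_coeff a m"
proof (induction m rule: less_induct)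
  case (less m)
  then show ?case using assms
    by (cases m) (auto intro!: divide_nonneg_nonneg sum_nonneg mult_nonneg_nonneg)
qed

lemma exp_coeff_step_le:
  assumes "\<And>j. j \<ge> 1 \<Longrightarrow> 0 \<le> a j" "1 \<le> j" "j \<le> m"
  shows "a j * exp_coeff a (m - j) \<le> real m * exp_coeff a m"
  unfolding exp_coeff_rec
  using assms by (intro member_le_sum) (auto intro!: mult_nonneg_nonneg exp_coeff_nonneg)

lemma exp_coeff_pos:
  assumes "\<And>j. j \<ge> 1 \<Longrightarrow> 0 \<le> a j" "0 < a 1"
  shows "0 < exp_coeff a m"
proof (induction m)
  case (Suc m)
  have "0 < a 1 * exp_coeff a m" using Suc assms by simp
  also have "\<dots> \<le> real (Suc m) * exp_coeff a (Suc m)"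
    using exp_coeff_step_le[of a 1 "Suc m"] assms by simp
  finally show ?case using zero_less_mult_pos by fastforce
qed simp

text \<open>The substitution of \<open>u z\<close> for \<open>z\<close> in the generating function.\<close>

lemma exp_coeff_scale: "exp_coeff (\<lambda>j. a j * u ^ j) m = exp_coeff a m * u ^ m"
proof -
  have "exp_coeff a m * u ^ m = (exp_coeff a 0 * u ^ 0) * exp_coeff (\<lambda>j. a j * u ^ j) m"
  proof (rule exp_coeff_unique[where f = "\<lambda>m. exp_coeff a m * u ^ m"])
    fix m :: nat
    have "real m * (exp_coeff a m * u ^ m) = (\<Sum>j=1..m. a j * exp_coeff a (m - j)) * u ^ m"
      by (simp only: exp_coeff_rec[symmetric] mult.assoc)
    also have "\<dots> = (\<Sum>j=1..m. a j * u ^ j * (exp_coeff a (m - j) * u ^ (m - j)))"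
      unfolding sum_distrib_right
      by (intro sum.cong refl) (auto simp: mult_ac simp flip: power_add)
    finally show "real m * (exp_coeff a m * u ^ m) = \<dots>" .
  qed
  then show ?thesis by simp
qed

lemma exp_coeff_abs_le:
  assumes "\<And>j. j \<ge> 1 \<Longrightarrow> \<bar>b j\<bar> \<le> a j"
  shows "\<bar>exp_coeff b m\<bar> \<le> exp_coeff a m"
proof (induction m rule: less_induct)
  case (less m)
  show ?case
  proof (cases m)
    case (Suc n)
    have "0 \<le> a j" if "j \<ge> 1" for j using assms[OF that] by linarith
    then have "\<bar>\<Sum>j\<le>n. b (Suc j) * exp_coeff b (n - j)\<bar> \<le> (\<Sum>j\<le>n. a (Suc j) * exp_coeff a (n - j))"
      using less Suc assms
      by (intro order_trans[OF sum_abs] sum_mono)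
        (auto simp: abs_mult intro!: mult_mono)
    then show ?thesis using Suc by (simp add: divide_right_mono)
  qed simp
qed

lemma exp_coeff_fps_deriv:
  "fps_deriv (Abs_fps (exp_coeff a)) = Abs_fps (\<lambda>n. a (Suc n)) * Abs_fps (exp_coeff a)"
  by (rule fps_ext) (simp add: fps_mult_nth atLeast0AtMost)

text \<open>This is \<open>exp (A + B) = exp A * exp B\<close>; the product solves the differential equation of the left
  side.\<close>

lemma exp_coeff_add:
  "exp_coeff (\<lambda>j. a j + b j) m = (\<Sum>i\<le>m. exp_coeff a i * exp_coeff b (m - i))"
proof -
  define F where "F = Abs_fps (exp_coeff a) * Abs_fps (exp_coeff b)"
  have D: "fps_deriv F = Abs_fps (\<lambda>n. a (Suc n) + b (Suc n)) * F"
  proof -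
    have "Abs_fps (\<lambda>n. a (Suc n) + b (Suc n)) = Abs_fps (\<lambda>n. a (Suc n)) + Abs_fps (\<lambda>n. b (Suc n))"
      by (rule fps_ext) simp
    then show ?thesis
      by (simp add: F_def exp_coeff_fps_deriv algebra_simps)
  qed
  have "fps_nth F m = fps_nth F 0 * exp_coeff (\<lambda>j. a j + b j) m"
  proof (rule exp_coeff_unique)
    fix m :: nat assume "m \<ge> 1"
    then obtain n where m: "m = Suc n" by (cases m) auto
    have "real m * fps_nth F m = fps_nth (fps_deriv F) n" by (simp add: m)
    also have "\<dots> = (\<Sum>i\<le>n. (a (Suc i) + b (Suc i)) * fps_nth F (n - i))"
      by (simp add: D fps_mult_nth atLeast0AtMost)
    also have "\<dots> = (\<Sum>j=1..m. (a j + b j) * fps_nth F (m - j))"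
      unfolding m sum_shift_Suc by simp
    finally show "real m * fps_nth F m = \<dots>" .
  qed
  then show ?thesis by (simp add: F_def fps_mult_nth atLeast0AtMost)
qed

lemma exp_coeff_zero: "exp_coeff (\<lambda>j. 0) m = (if m = 0 then 1 else 0)"
  by (cases m) auto

lemma exp_coeff_inverse:
  "(\<Sum>i\<le>m. exp_coeff (\<lambda>j. - a j) i * exp_coeff a (m - i)) = (if m = 0 then 1 else 0)"
  using exp_coeff_add[of "\<lambda>j. - a j" a m] by (simp add: exp_coeff_zero)

text \<open>Division of a power series by \<open>exp A\<close> is multiplication by \<open>exp (- A)\<close>.\<close>

lemma exp_coeff_deconvolution:
  assumes "\<And>m. z m = (\<Sum>k\<le>m. exp_coeff a k * f (m - k))"
  shows "f m = (\<Sum>i\<le>m. exp_coeff (\<lambda>j. - a j) i * z (m - i))"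
proof -
  let ?H = "Abs_fps (exp_coeff a)" and ?C = "Abs_fps (exp_coeff (\<lambda>j. - a j))"
  have CH: "?C * ?H = 1"
    by (rule fps_ext) (simp add: fps_mult_nth atLeast0AtMost exp_coeff_inverse)
  have "Abs_fps z = ?H * Abs_fps f"
    by (rule fps_ext) (simp add: fps_mult_nth atLeast0AtMost assms)
  then have "?C * Abs_fps z = Abs_fps f"
    by (simp add: CH flip: mult.assoc)
  then have "fps_nth (?C * Abs_fps z) m = f m" by simp
  then show ?thesis by (simp add: fps_mult_nth atLeast0AtMost)
qed

lemma power_over_fact_Suc:
  fixes c :: real
  shows "real (Suc r) * (c ^ Suc r / fact (Suc r)) = c * (c ^ r / fact r)"
proof -
  have "real (Suc r) \<noteq> 0" by linarith
  then show ?thesis unfolding fact_Suc power_Suc by (simp del: of_nat_Suc)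
qed

lemma exp_coeff_single:
  "exp_coeff (\<lambda>j. if j = 1 then c else 0) m = c ^ m / fact m"
proof -
  have "c ^ m / fact m = (c ^ 0 / fact 0) * exp_coeff (\<lambda>j. if j = 1 then c else 0) m"
  proof (rule exp_coeff_unique[where f = "\<lambda>m. c ^ m / fact m"])
    fix m :: nat assume "1 \<le> m"
    then obtain n where m: "m = Suc n" by (cases m) auto
    have "(\<Sum>j=1..m. (if j = 1 then c else 0) * (c ^ (m - j) / fact (m - j)))
        = (\<Sum>j=1..m. if j = 1 then c * (c ^ (m - 1) / fact (m - 1)) else 0)"
      by (intro sum.cong) auto
    also have "\<dots> = c * (c ^ n / fact n)" using m by simp
    also have "\<dots> = real m * (c ^ m / fact m)"
      unfolding m by (rule power_over_fact_Suc[symmetric])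
    finally show "real m * (c ^ m / fact m) = (\<Sum>j=1..m. (if j = 1 then c else 0) * (c ^ (m - j) / fact (m - j)))" ..
  qed
  then show ?thesis by simp
qed

text \<open>A discrete fugacity: for coefficients behaving like \<open>z\<^sup>-\<^sup>m\<close> it equals \<open>z\<close>.\<close>

definition coeff_ratio :: "(nat \<Rightarrow> real) \<Rightarrow> nat \<Rightarrow> real" where
  "coeff_ratio a m = exp_coeff a (m - 1) / exp_coeff a m"

text \<open>Expanding the factor \<open>exp (a\<^sub>1 z)\<close> separately writes \<open>Z\<^sub>M\<close> as \<open>\<Sum>r. p\<^sub>r\<close>, where \<open>p\<^sub>r\<close> is the
  contribution of \<open>r\<close> parts of size one. Shifting indices gives \<open>a\<^sub>1 Z\<^bsub>M-1\<^esub> = \<Sum>r. r p\<^sub>r\<close> and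
  \<open>a\<^sub>1\<^sup>2 Z\<^bsub>M-2\<^esub> = \<Sum>r. r (r - 1) p\<^sub>r\<close>. The claim is the Cauchy-Schwarz inequality for these moments.\<close>

lemma exp_coeff_turan:
  assumes nn: "\<And>j. j \<ge> 1 \<Longrightarrow> 0 \<le> a j" and a1: "0 < a 1"
  shows "(exp_coeff a (Suc m))\<^sup>2
     \<le> exp_coeff a m * exp_coeff a (Suc (Suc m)) + exp_coeff a (Suc m) * exp_coeff a (Suc (Suc m)) / a 1"
proof -
  let ?Z = "exp_coeff a" and ?M = "Suc (Suc m)"
  define y where "y = exp_coeff (\<lambda>j. if j = 1 then 0 else a j)"
  define p where "p r = a 1 ^ r / fact r * y (?M - r)" for r
  have y: "0 \<le> y i" for i unfolding y_def using nn by (intro exp_coeff_nonneg) auto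
  have p: "0 \<le> p r" for r using y a1 by (simp add: p_def)
  have Z: "?Z k = (\<Sum>r\<le>k. a 1 ^ r / fact r * y (k - r))" for k
  proof -
    have "?Z k = exp_coeff (\<lambda>j. (if j = 1 then a 1 else 0) + (if j = 1 then 0 else a j)) k"
      by (rule exp_coeff_cong) auto
    also have "\<dots> = (\<Sum>r\<le>k. a 1 ^ r / fact r * y (k - r))"
      unfolding exp_coeff_add exp_coeff_single y_def ..
    finally show ?thesis .
  qed
  have Z0: "?Z ?M = (\<Sum>r\<le>?M. p r)" by (simp only: Z p_def)
  have Z1: "a 1 * ?Z (Suc m) = (\<Sum>r\<le>?M. real r * p r)"
  proof -
    have "(\<Sum>r\<le>?M. real r * p r) = (\<Sum>r\<le>Suc m. real (Suc r) * p (Suc r))"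
      by (subst sum.atMost_Suc_shift) simp
    also have "\<dots> = (\<Sum>r\<le>Suc m. a 1 * (a 1 ^ r / fact r * y (Suc m - r)))"
    proof (rule sum.cong)
      fix r
      have "real (Suc r) * (a 1 ^ Suc r / fact (Suc r)) = a 1 * (a 1 ^ r / fact r)"
        by (rule power_over_fact_Suc)
      then show "real (Suc r) * p (Suc r) = a 1 * (a 1 ^ r / fact r * y (Suc m - r))"
        unfolding p_def by (metis diff_Suc_Suc mult.assoc)
    qed simp
    finally show ?thesis by (simp only: Z sum_distrib_left)
  qed
  have Z2: "(a 1)\<^sup>2 * ?Z m = (\<Sum>r\<le>?M. real r * (real r - 1) * p r)"
  proof -
    have "(\<Sum>r\<le>?M. real r * (real r - 1) * p r)
        = (\<Sum>r\<le>m. real (Suc (Suc r)) * real (Suc r) * p (Suc (Suc r)))"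
      by (subst sum.atMost_Suc_shift, subst sum.atMost_Suc_shift) (simp add: algebra_simps)
    also have "\<dots> = (\<Sum>r\<le>m. (a 1)\<^sup>2 * (a 1 ^ r / fact r * y (m - r)))"
    proof (rule sum.cong)
      fix r
      have "real (Suc (Suc r)) * real (Suc r) * (a 1 ^ Suc (Suc r) / fact (Suc (Suc r))) = (a 1)\<^sup>2 * (a 1 ^ r / fact r)"
        using power_over_fact_Suc[of "Suc r" "a 1"] power_over_fact_Suc[of r "a 1"]
        by (metis (no_types, lifting) mult.assoc mult.commute power2_eq_square)
      then show "real (Suc (Suc r)) * real (Suc r) * p (Suc (Suc r)) = (a 1)\<^sup>2 * (a 1 ^ r / fact r * y (m - r))"
        unfolding p_def by (metis diff_Suc_Suc mult.assoc)
    qed simp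
    finally show ?thesis by (simp only: Z sum_distrib_left)
  qed
  have "(\<Sum>r\<le>?M. sqrt (p r) * (real r * sqrt (p r)))\<^sup>2
      \<le> (\<Sum>r\<le>?M. (sqrt (p r))\<^sup>2) * (\<Sum>r\<le>?M. (real r * sqrt (p r))\<^sup>2)"
    by (rule Cauchy_Schwarz_ineq_sum)
  also have "(\<Sum>r\<le>?M. sqrt (p r) * (real r * sqrt (p r))) = (\<Sum>r\<le>?M. real r * p r)"
    using p by (intro sum.cong refl) (simp add: mult.left_commute)
  also have "(\<Sum>r\<le>?M. (sqrt (p r))\<^sup>2) = (\<Sum>r\<le>?M. p r)"
    using p by simp
  also have "(\<Sum>r\<le>?M. (real r * sqrt (p r))\<^sup>2)
      = (\<Sum>r\<le>?M. real r * (real r - 1) * p r) + (\<Sum>r\<le>?M. real r * p r)"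
    using p by (simp add: power_mult_distrib power2_eq_square algebra_simps flip: sum.distrib)
  finally have "(a 1 * ?Z (Suc m))\<^sup>2 \<le> ?Z ?M * ((a 1)\<^sup>2 * ?Z m + a 1 * ?Z (Suc m))"
    by (simp only: Z0 Z1 Z2)
  moreover have "?Z ?M * ((a 1)\<^sup>2 * ?Z m + a 1 * ?Z (Suc m))
      = (a 1)\<^sup>2 * (?Z m * ?Z ?M + ?Z (Suc m) * ?Z ?M / a 1)"
    using a1 by (simp add: power2_eq_square field_simps del: exp_coeff.simps)
  ultimately have "(a 1)\<^sup>2 * (?Z (Suc m))\<^sup>2
      \<le> (a 1)\<^sup>2 * (?Z m * ?Z ?M + ?Z (Suc m) * ?Z ?M / a 1)"
    by (simp only: power_mult_distrib)
  then show ?thesis using a1 by (simp del: exp_coeff.simps)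
qed

text \<open>The only regularity that the ratios have for arbitrary weights: they may drop abruptly, but they
  rise by at most \<open>1 / a\<^sub>1\<close> per step.\<close>

lemma coeff_ratio_step:
  assumes nn: "\<And>j. j \<ge> 1 \<Longrightarrow> 0 \<le> a j" and a1: "0 < a 1" and m: "1 \<le> m"
  shows "coeff_ratio a (Suc m) \<le> coeff_ratio a m + 1 / a 1"
proof -
  obtain k where k: "m = Suc k" using m by (cases m) auto
  have pos: "0 < exp_coeff a i" for i using nn a1 by (rule exp_coeff_pos)
  have "(exp_coeff a m)\<^sup>2 \<le> exp_coeff a k * exp_coeff a (Suc m)
      + exp_coeff a m * exp_coeff a (Suc m) / a 1"
    unfolding k using nn a1 by (rule exp_coeff_turan)
  then have "(exp_coeff a m)\<^sup>2 / (exp_coeff a m * exp_coeff a (Suc m))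
      \<le> (exp_coeff a k * exp_coeff a (Suc m)
      + exp_coeff a m * exp_coeff a (Suc m) / a 1) / (exp_coeff a m * exp_coeff a (Suc m))"
    using pos by (intro divide_right_mono) (auto intro: less_imp_le simp del: exp_coeff.simps)
  also have "\<dots> = exp_coeff a k / exp_coeff a m + 1 / a 1"
    using pos[of m] pos[of "Suc m"] a1 by (simp add: field_simps del: exp_coeff.simps)
  also have "(exp_coeff a m)\<^sup>2 / (exp_coeff a m * exp_coeff a (Suc m)) = exp_coeff a m / exp_coeff a (Suc m)"
    using pos[of m] by (simp add: power2_eq_square del: exp_coeff.simps)
  finally show ?thesis by (simp add: coeff_ratio_def k del: exp_coeff.simps)
qed

lemma coeff_ratio_steps:
  assumes "\<And>j. j \<ge> 1 \<Longrightarrow> 0 \<le> a j" "0 < a 1" "1 \<le> m"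
  shows "coeff_ratio a (m + k) \<le> coeff_ratio a m + real k / a 1"
proof (induction k)
  case (Suc k)
  have "coeff_ratio a (Suc (m + k)) \<le> coeff_ratio a (m + k) + 1 / a 1"
    using assms by (intro coeff_ratio_step) auto
  then show ?case using Suc by (simp add: add_divide_distrib)
qed simp

lemma exp_coeff_shift_ge:
  assumes nn: "\<And>j. j \<ge> 1 \<Longrightarrow> 0 \<le> a j" and a1: "0 < a 1" and "0 \<le> s" "j \<le> K" "K \<le> m"
    and s: "s + real K / a 1 \<le> coeff_ratio a m"
  shows "s ^ j * exp_coeff a m \<le> exp_coeff a (m - j)"
  using \<open>j \<le> K\<close>
proof (induction j)
  case (Suc j)
  have pos: "0 < exp_coeff a i" for i using nn a1 by (rule exp_coeff_pos)
  have "coeff_ratio a (m - j + j) \<le> coeff_ratio a (m - j) + real j / a 1"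
    using Suc \<open>K \<le> m\<close> by (intro coeff_ratio_steps nn a1) auto
  moreover have "real j / a 1 \<le> real K / a 1"
    using Suc a1 by (intro divide_right_mono) auto
  ultimately have "s \<le> coeff_ratio a (m - j)" using s Suc \<open>K \<le> m\<close> by simp
  then have "s * exp_coeff a (m - j) \<le> exp_coeff a (m - Suc j)"
    using pos[of "m - j"] by (simp add: coeff_ratio_def field_simps)
  moreover have "s * (s ^ j * exp_coeff a m) \<le> s * exp_coeff a (m - j)"
    using Suc \<open>0 \<le> s\<close> by (intro mult_left_mono) auto
  ultimately show ?case by simp
qed simp

text \<open>Each \<open>Z\<^bsub>m-j\<^esub> / Z\<^sub>m\<close> with \<open>j \<le> K\<close> is a product of \<open>j\<close> ratios, and going back from \<open>m\<close> lowers a ratio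
  by at most \<open>K / a\<^sub>1\<close>. Inserting this into the recursion bounds \<open>m\<close> from below.\<close>

lemma density_le_of_ratio_ge:
  assumes nn: "\<And>j. j \<ge> 1 \<Longrightarrow> 0 \<le> a j" and a1: "0 < a 1" and "0 \<le> s" "K \<le> m"
    and s: "s + real K / a 1 \<le> coeff_ratio a m"
  shows "(\<Sum>j=1..K. a j * s ^ j) \<le> real m"
proof -
  have pos: "0 < exp_coeff a i" for i using nn a1 by (rule exp_coeff_pos)
  have "(\<Sum>j=1..K. a j * s ^ j) * exp_coeff a m = (\<Sum>j=1..K. a j * (s ^ j * exp_coeff a m))"
    by (simp add: sum_distrib_right mult.assoc)
  also have "\<dots> \<le> (\<Sum>j=1..K. a j * exp_coeff a (m - j))"
    using assms by (intro sum_mono mult_left_mono exp_coeff_shift_ge[where K = K]) auto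
  also have "\<dots> \<le> (\<Sum>j=1..m. a j * exp_coeff a (m - j))"
    using \<open>K \<le> m\<close> nn pos by (intro sum_mono2) (auto intro!: mult_nonneg_nonneg less_imp_le[OF pos])
  also have "\<dots> = real m * exp_coeff a m" by (simp add: exp_coeff_rec)
  finally show ?thesis using pos[of m] by simp
qed

text \<open>With \<open>x\<^sub>m = Z\<^sub>m z\<^sup>m\<close>, the recursion bounds \<open>m x\<^sub>m\<close> by \<open>B\<close> times the largest earlier \<open>x\<^sub>k\<close>. So
  an index beyond \<open>B\<close> never exceeds all earlier values, and the maximum over all indices is attained
  at one that is at most \<open>B\<close>.\<close>

lemma exp_coeff_maximizer:
  assumes nn: "\<And>j. j \<ge> 1 \<Longrightarrow> 0 \<le> a j" and z: "0 \<le> z"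
    and B: "\<And>m. (\<Sum>j=1..m. a j * z ^ j) \<le> B"
  obtains m\<^sub>0 where "real m\<^sub>0 \<le> B" "\<And>m. exp_coeff a m * z ^ m \<le> exp_coeff a m\<^sub>0 * z ^ m\<^sub>0"
proof -
  define x where "x m = exp_coeff a m * z ^ m" for m
  define N where "N = nat \<lfloor>B\<rfloor>"
  have B0: "0 \<le> B" using B[of 0] by simp
  have x0: "0 \<le> x m" for m using nn z by (simp add: x_def exp_coeff_nonneg)
  have xrec: "real m * x m = (\<Sum>j=1..m. a j * z ^ j * x (m - j))" for m
    using exp_coeff_rec[of m "\<lambda>j. a j * z ^ j"] by (simp add: exp_coeff_scale x_def)
  have "Max (x ` {..N}) \<in> x ` {..N}" by (intro Max_in) auto
  then obtain m0 where m0: "m0 \<le> N" "x m0 = Max (x ` {..N})" by (metis atMost_iff imageE)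
  have "x m \<le> x m0" for m
  proof (induction m rule: less_induct)
    case (less m)
    show ?case
    proof (cases "m \<le> N")
      case False
      then have mB: "B < real m" unfolding N_def using B0 by linarith
      have "real m * x m \<le> (\<Sum>j=1..m. a j * z ^ j * x m0)"
        unfolding xrec using less False nn z by (intro sum_mono mult_left_mono) auto
      also have "\<dots> = (\<Sum>j=1..m. a j * z ^ j) * x m0" by (simp add: sum_distrib_right)
      also have "\<dots> \<le> real m * x m0" using B[of m] mB x0 by (intro mult_right_mono) auto
      finally show ?thesis using mB B0 by simp
    next
      case True
      then show ?thesis unfolding m0(2) by (intro Max_ge) auto
    qed
  qed
  moreover have "real m0 \<le> B" using m0 B0 unfolding N_def by linarith
  ultimately show thesis using that[of m0] by (simp add: x_def)
qed

text \<open>A small ratio stays small for a while, because ratios rise slowly; the coefficients then grow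
  geometrically on that stretch.\<close>

lemma exp_coeff_growth:
  assumes nn: "\<And>j. j \<ge> 1 \<Longrightarrow> 0 \<le> a j" and a1: "0 < a 1" and m: "1 \<le> m"
    and p: "coeff_ratio a m + real k / a 1 \<le> p"
  shows "exp_coeff a m \<le> exp_coeff a (m + k) * p ^ k"
  using p
proof (induction k)
  case (Suc k)
  have pos: "0 < exp_coeff a i" for i using nn a1 by (rule exp_coeff_pos)
  have Q0: "0 \<le> coeff_ratio a m" using pos by (simp add: coeff_ratio_def less_imp_le)
  then have p0: "0 \<le> p" using Suc.prems a1
    by (meson add_nonneg_nonneg divide_nonneg_pos of_nat_0_le_iff order_trans)
  have "real k / a 1 \<le> real (Suc k) / a 1" using a1 by (intro divide_right_mono) auto
  then have "exp_coeff a m \<le> exp_coeff a (m + k) * p ^ k" using Suc by simp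
  also have "exp_coeff a (m + k) \<le> p * exp_coeff a (m + Suc k)"
  proof -
    have "coeff_ratio a (m + Suc k) \<le> coeff_ratio a m + real (Suc k) / a 1"
      using nn a1 m by (rule coeff_ratio_steps)
    with Suc.prems have "coeff_ratio a (m + Suc k) \<le> p" by linarith
    then show ?thesis using pos[of "m + Suc k"]
      by (simp add: coeff_ratio_def pos_divide_le_eq del: exp_coeff.simps)
  qed
  then have "exp_coeff a (m + k) * p ^ k \<le> p * exp_coeff a (m + Suc k) * p ^ k"
    using p0 by (intro mult_right_mono) auto
  finally show ?case by (simp add: mult_ac del: exp_coeff.simps)
qed simp

text \<open>Mass can be added cheaply. Inserting a part of size \<open>j\<close> does not decrease \<open>Z\<^sub>i w\<^sup>i\<close> as long as
  \<open>i \<le> M\<close>, and the remaining fewer than \<open>j\<close> units are supplied by parts of size one, each of which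
  costs at most a factor \<open>\<kappa>\<close>.\<close>

lemma exp_coeff_fill:
  assumes nn: "\<And>j. j \<ge> 1 \<Longrightarrow> 0 \<le> a j" and w: "0 < w" and j: "1 \<le> j" "real M \<le> a j * w ^ j"
    and \<kappa>: "0 < \<kappa>" "\<kappa> \<le> 1" "\<kappa> * real M \<le> a 1 * w" and m: "m \<le> M"
  shows "\<kappa> ^ j * (exp_coeff a m * w ^ m) \<le> exp_coeff a M * w ^ M"
proof -
  define x where "x i = exp_coeff a i * w ^ i" for i
  have x0: "0 \<le> x i" for i using nn w by (simp add: x_def exp_coeff_nonneg)
  have step: "(a i * w ^ i) * x (k - i) \<le> real k * x k" if "1 \<le> i" "i \<le> k" for i k
    using exp_coeff_step_le[of "\<lambda>j. a j * w ^ j" i k] nn w that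
    by (simp add: exp_coeff_scale x_def)
  have jump: "x (k - j) \<le> x k" if "j \<le> k" "k \<le> M" for k
  proof -
    have "real k * x (k - j) \<le> (a j * w ^ j) * x (k - j)"
      using that j x0 by (intro mult_right_mono) auto
    also have "\<dots> \<le> real k * x k" using step that j by simp
    finally show ?thesis using that j by simp
  qed
  have unit: "\<kappa> * x k \<le> x (Suc k)" if "Suc k \<le> M" for k
  proof -
    have "real (Suc k) * (\<kappa> * x k) = (\<kappa> * real (Suc k)) * x k" by simp
    also have "\<dots> \<le> (\<kappa> * real M) * x k"
      using that \<kappa> x0 by (intro mult_right_mono mult_left_mono) auto
    also have "\<dots> \<le> (a 1 * w ^ 1) * x (Suc k - 1)"
      using \<kappa> x0 by (simp add: mult_right_mono)
    also have "\<dots> \<le> real (Suc k) * x (Suc k)" using step[of 1 "Suc k"] by simp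
    finally show ?thesis by (simp del: of_nat_Suc)
  qed
  have "m + t \<le> M \<Longrightarrow> \<kappa> ^ (t mod j) * x m \<le> x (m + t)" for t
  proof (induction t rule: less_induct)
    case (less t)
    consider "t = 0" | k where "t = Suc k" "t < j" | "j \<le> t" by (cases t; fastforce)
    then show ?case
    proof cases
      case 2
      then have "\<kappa> ^ k * x m \<le> x (m + k)" using less.IH[of k] less.prems by simp
      then have "\<kappa> * (\<kappa> ^ k * x m) \<le> \<kappa> * x (m + k)" using \<kappa> by (intro mult_left_mono) auto
      also have "\<dots> \<le> x (Suc (m + k))" using unit less.prems 2 by simp
      finally show ?thesis using 2 by (simp add: mult_ac)
    next
      case 3
      then have "\<kappa> ^ ((t - j) mod j) * x m \<le> x (m + (t - j))"
        using less.IH[of "t - j"] less.prems j by simp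
      also have "\<dots> \<le> x (m + t)" using jump[of "m + t"] 3 less.prems by simp
      finally show ?thesis using 3 by (simp add: le_mod_geq)
    qed simp
  qed
  from this[of "M - m"] m have "\<kappa> ^ ((M - m) mod j) * x m \<le> x M" by simp
  moreover have "\<kappa> ^ j * x m \<le> \<kappa> ^ ((M - m) mod j) * x m"
    using \<kappa> j x0 by (intro mult_right_mono power_decreasing) (auto simp: less_imp_le)
  ultimately show ?thesis unfolding x_def by linarith
qed

section \<open>Ratios of coefficients in the thermodynamic limit\<close>

text \<open>Here \<open>N\<close> is the volume. The two series have a common threshold \<open>zc\<close>: below it the dominating
  series converges, above it even the terms of the limiting series are unbounded.\<close>

locale thermodynamic_limit =
  fixes a :: "nat \<Rightarrow> nat \<Rightarrow> real" and N :: "nat \<Rightarrow> real"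
    and \<alpha> \<beta> :: "nat \<Rightarrow> real" and zc :: ereal
  assumes a_nonneg: "\<And>n j. j \<ge> 1 \<Longrightarrow> 0 \<le> a n j"
    and volume_infinite: "filterlim N at_top sequentially"
    and a_lim: "\<And>j. j \<ge> 1 \<Longrightarrow> (\<lambda>n. a n j / N n) \<longlonglongrightarrow> \<alpha> j"
    and a_dominated: "\<forall>\<^sub>F n in sequentially. \<forall>j\<ge>1. a n j \<le> N n * \<beta> j"
    and alpha_1_pos: "0 < \<alpha> 1"
    and beta_summable: "\<And>z. 0 \<le> z \<Longrightarrow> ereal z < zc \<Longrightarrow> summable (\<lambda>j. \<beta> (Suc j) * z ^ Suc j)"
    and alpha_unbounded: "\<And>z C. zc < ereal z \<Longrightarrow> \<exists>j\<ge>1. C < \<alpha> j * z ^ j"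
    and zc_pos: "0 < zc"
begin

abbreviation Q :: "nat \<Rightarrow> nat \<Rightarrow> real" where "Q n \<equiv> coeff_ratio (a n)"
abbreviation Z :: "nat \<Rightarrow> nat \<Rightarrow> real" where "Z n \<equiv> exp_coeff (a n)"

text \<open>The solution of \<open>dens z = \<rho>\<close> if there is one, and \<open>zc\<close> if \<open>\<rho>\<close> exceeds all densities. Referring to
  partial sums makes the set closed and postpones the question of convergence.\<close>

definition fugacity :: "real \<Rightarrow> real" where
  "fugacity \<rho> = Sup {z. 0 \<le> z \<and> (\<forall>K. (\<Sum>j=1..K. \<alpha> j * z ^ j) \<le> \<rho>)}"

definition dens :: "real \<Rightarrow> real" where
  "dens z = (\<Sum>j. \<alpha> (Suc j) * z ^ Suc j)"

lemma volume_pos: "\<forall>\<^sub>F n in sequentially. 0 < N n"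
  using volume_infinite by (simp add: filterlim_at_top_dense)

lemma alpha_nonneg: "j \<ge> 1 \<Longrightarrow> 0 \<le> \<alpha> j"
proof (rule tendsto_lowerbound[OF a_lim])
  assume "j \<ge> 1"
  show "\<forall>\<^sub>F n in sequentially. 0 \<le> a n j / N n"
    using volume_pos by eventually_elim (use \<open>j \<ge> 1\<close> a_nonneg in auto)
qed auto

lemma alpha_le_beta: "j \<ge> 1 \<Longrightarrow> \<alpha> j \<le> \<beta> j"
proof (rule tendsto_upperbound[OF a_lim])
  assume "j \<ge> 1"
  show "\<forall>\<^sub>F n in sequentially. a n j / N n \<le> \<beta> j"
    using a_dominated volume_pos
    by eventually_elim (use \<open>j \<ge> 1\<close> in \<open>auto simp: field_simps\<close>)
qed auto

lemma a_1_over_volume: "\<forall>\<^sub>F n in sequentially. \<alpha> 1 / 2 * N n < a n 1"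
proof -
  have "\<forall>\<^sub>F n in sequentially. \<alpha> 1 / 2 < a n 1 / N n"
    using a_lim[of 1] alpha_1_pos by (intro order_tendstoD) auto
  then show ?thesis using volume_pos by eventually_elim (simp add: field_simps)
qed

lemma a_1_pos: "\<forall>\<^sub>F n in sequentially. 0 < a n 1"
  using a_1_over_volume volume_pos
proof eventually_elim
  case (elim n)
  have "0 < \<alpha> 1 / 2 * N n" using elim alpha_1_pos by simp
  then show ?case using elim by linarith
qed

lemma a_1_infinite: "filterlim (\<lambda>n. a n 1) at_top sequentially"
proof (rule filterlim_at_top_mono)
  show "filterlim (\<lambda>n. \<alpha> 1 / 2 * N n) at_top sequentially"
    using alpha_1_pos
    by (intro filterlim_tendsto_pos_mult_at_top[OF tendsto_const _ volume_infinite]) auto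
  show "\<forall>\<^sub>F n in sequentially. \<alpha> 1 / 2 * N n \<le> a n 1"
    using a_1_over_volume by eventually_elim simp
qed

lemma over_a_1: "(\<lambda>n. c / a n 1) \<longlonglongrightarrow> 0"
  by (rule real_tendsto_divide_at_top[OF tendsto_const a_1_infinite])

lemma alpha_summable:
  assumes "0 \<le> z" "ereal z < zc"
  shows "summable (\<lambda>j. \<alpha> (Suc j) * z ^ Suc j)"
proof (rule summable_comparison_test'[OF beta_summable[OF assms]])
  fix j
  have "0 \<le> \<alpha> (Suc j)" "\<alpha> (Suc j) \<le> \<beta> (Suc j)" using alpha_nonneg alpha_le_beta by auto
  then have "\<alpha> (Suc j) * z ^ Suc j \<le> \<beta> (Suc j) * z ^ Suc j"
    using assms by (intro mult_right_mono) auto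
  then show "norm (\<alpha> (Suc j) * z ^ Suc j) \<le> \<beta> (Suc j) * z ^ Suc j"
    using assms \<open>0 \<le> \<alpha> (Suc j)\<close> by (simp add: abs_mult)
qed

text \<open>Below \<open>zc\<close> the density is a power series; removing a factor \<open>z\<close> brings it into standard form.\<close>

lemma dens_right_lim:
  assumes "0 \<le> z" "ereal z < zc"
  shows "(dens \<longlongrightarrow> dens z) (at_right z)"
proof -
  let ?g = "\<lambda>x. x * (\<Sum>j. \<alpha> (Suc j) * x ^ j)"
  obtain R where R: "z < R" "ereal R < zc"
    using ereal_dense2[OF assms(2)] unfolding less_ereal.simps by blast
  have sum': "summable (\<lambda>j. \<alpha> (Suc j) * x ^ j)" if "0 < x" "x \<le> R" for x
  proof -
    have "ereal x < zc" using that R by (intro le_less_trans[OF _ R(2)]) simp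
    then have "summable (\<lambda>j. \<alpha> (Suc j) * x ^ Suc j)" using that by (intro alpha_summable) auto
    then have "summable (\<lambda>j. x * (\<alpha> (Suc j) * x ^ j))" by (simp add: mult_ac)
    then show ?thesis by (rule summable_mult_D) (use that in simp)
  qed
  have g: "?g x = dens x" if "0 \<le> x" "x \<le> R" for x
  proof (cases "x = 0")
    case False
    have "dens x = (\<Sum>j. x * (\<alpha> (Suc j) * x ^ j))" by (simp add: dens_def mult_ac)
    also have "\<dots> = ?g x" by (rule suminf_mult[OF sum']) (use False that in auto)
    finally show ?thesis ..
  qed (simp add: dens_def)
  have "isCont (\<lambda>x. \<Sum>j. \<alpha> (Suc j) * x ^ j) z"
    by (rule isCont_powser[OF sum'[of R]]) (use assms R in auto)
  then have "isCont ?g z" by (intro isCont_mult continuous_ident)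
  then have "(?g \<longlongrightarrow> ?g z) (at_right z)"
    unfolding isCont_def by (rule tendsto_mono[rotated]) (rule at_le, simp)
  moreover have "\<forall>\<^sub>F x in at_right z. ?g x = dens x"
    using eventually_at_right_real[OF R(1)] by eventually_elim (rule g, use assms in auto)
  ultimately have "(dens \<longlongrightarrow> ?g z) (at_right z)" by (rule Lim_transform_eventually)
  moreover have "?g z = dens z" using assms R by (intro g) auto
  ultimately show ?thesis by (simp only:)
qed

lemma partial_density_le_dens:
  assumes "0 \<le> z" "summable (\<lambda>j. \<alpha> (Suc j) * z ^ Suc j)"
  shows "(\<Sum>j=1..K. \<alpha> j * z ^ j) \<le> dens z"
proof -
  have "(\<Sum>j=1..K. \<alpha> j * z ^ j) = (\<Sum>j<K. \<alpha> (Suc j) * z ^ Suc j)"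
    by (rule sum_from_1)
  also have "\<dots> \<le> dens z" unfolding dens_def
    using assms alpha_nonneg by (intro sum_le_suminf) auto
  finally show ?thesis .
qed

lemma partial_density_lim:
  assumes "summable (\<lambda>j. \<alpha> (Suc j) * z ^ Suc j)"
  shows "(\<lambda>K. \<Sum>j=1..K. \<alpha> j * z ^ j) \<longlonglongrightarrow> dens z"
  unfolding sum_from_1 dens_def by (rule summable_LIMSEQ[OF assms])

context
  fixes \<rho> :: real
  assumes rho_pos: "0 < \<rho>"
begin

lemma fugacity_set_bounded:
  assumes "0 \<le> z" "\<And>K. (\<Sum>j=1..K. \<alpha> j * z ^ j) \<le> \<rho>"
  shows "z \<le> \<rho> / \<alpha> 1"
  using assms(2)[of 1] alpha_1_pos by (simp add: field_simps)

lemma fugacity_upper: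
  assumes "0 \<le> z" "\<And>K. (\<Sum>j=1..K. \<alpha> j * z ^ j) \<le> \<rho>"
  shows "z \<le> fugacity \<rho>"
  unfolding fugacity_def
proof (rule cSup_upper)
  show "bdd_above {z. 0 \<le> z \<and> (\<forall>K. (\<Sum>j=1..K. \<alpha> j * z ^ j) \<le> \<rho>)}"
    using fugacity_set_bounded by (intro bdd_aboveI[of _ "\<rho> / \<alpha> 1"]) blast
qed (use assms in blast)

lemma fugacity_nonneg: "0 \<le> fugacity \<rho>"
proof (rule fugacity_upper)
  show "(\<Sum>j=1..K. \<alpha> j * 0 ^ j) \<le> \<rho>" for K
    using rho_pos by (simp add: power_0_left)
qed simp

lemma partial_density_fugacity: "(\<Sum>j=1..K. \<alpha> j * fugacity \<rho> ^ j) \<le> \<rho>"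
proof -
  let ?S = "{z. 0 \<le> z \<and> (\<forall>K. (\<Sum>j=1..K. \<alpha> j * z ^ j) \<le> \<rho>)}"
  have "closed ?S"
    by (intro closed_Collect_conj closed_Collect_all closed_Collect_le continuous_intros)
  moreover have "0 \<in> ?S" using rho_pos by (simp add: power_0_left)
  then have "?S \<noteq> {}" by blast
  moreover have "bdd_above ?S"
    using fugacity_set_bounded by (intro bdd_aboveI[of _ "\<rho> / \<alpha> 1"]) blast
  ultimately have "Sup ?S \<in> ?S" by (intro closed_contains_Sup)
  then show ?thesis by (simp add: fugacity_def)
qed

lemma partial_density_above_fugacity:
  assumes "fugacity \<rho> < z"
  obtains K where "\<rho> < (\<Sum>j=1..K. \<alpha> j * z ^ j)"
proof -
  have "\<not> z \<le> fugacity \<rho>" "0 \<le> z" using assms fugacity_nonneg by auto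
  then have "\<not> (\<forall>K. (\<Sum>j=1..K. \<alpha> j * z ^ j) \<le> \<rho>)" using fugacity_upper by blast
  then show thesis using that by (auto simp: not_le)
qed

lemma fugacity_summable: "summable (\<lambda>j. \<alpha> (Suc j) * fugacity \<rho> ^ Suc j)"
proof (rule bounded_imp_summable)
  show "0 \<le> \<alpha> (Suc j) * fugacity \<rho> ^ Suc j" for j
    using alpha_nonneg fugacity_nonneg by simp
  show "(\<Sum>j\<le>n. \<alpha> (Suc j) * fugacity \<rho> ^ Suc j) \<le> \<rho>" for n
    using partial_density_fugacity[of "Suc n"] unfolding sum_shift_Suc .
qed

lemma dens_fugacity_le: "dens (fugacity \<rho>) \<le> \<rho>"
  using partial_density_fugacity
  by (intro LIMSEQ_le_const2[OF partial_density_lim[OF fugacity_summable]]) auto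

text \<open>Above \<open>zc\<close> some single term already exceeds \<open>\<rho>\<close>.\<close>

lemma fugacity_le_zc: "ereal (fugacity \<rho>) \<le> zc"
proof (rule ccontr)
  assume "\<not> ereal (fugacity \<rho>) \<le> zc"
  then obtain j where j: "j \<ge> 1" "\<rho> < \<alpha> j * fugacity \<rho> ^ j"
    using alpha_unbounded[of "fugacity \<rho>" \<rho>] by (auto simp: not_le)
  have "\<alpha> j * fugacity \<rho> ^ j \<le> (\<Sum>j=1..j. \<alpha> j * fugacity \<rho> ^ j)"
    using alpha_nonneg fugacity_nonneg j by (intro member_le_sum) auto
  then show False using j partial_density_fugacity[of j] by simp
qed

text \<open>The linear term alone separates the two densities, since \<open>\<alpha> 1 > 0\<close>.\<close>

lemma dens_strict:
  assumes "0 \<le> z" "z < fugacity \<rho>"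
  shows "dens z < \<rho>"
proof -
  have zc: "ereal z < zc" using assms by (intro less_le_trans[OF _ fugacity_le_zc]) simp
  have "dens z \<le> dens (fugacity \<rho>) - \<alpha> 1 * (fugacity \<rho> - z)"
  proof (rule LIMSEQ_le[OF partial_density_lim[OF alpha_summable[OF assms(1) zc]]])
    show "(\<lambda>K. (\<Sum>j=1..K. \<alpha> j * fugacity \<rho> ^ j) - \<alpha> 1 * (fugacity \<rho> - z))
        \<longlonglongrightarrow> dens (fugacity \<rho>) - \<alpha> 1 * (fugacity \<rho> - z)"
      by (intro tendsto_intros partial_density_lim fugacity_summable)
    have "\<alpha> 1 * (fugacity \<rho> - z) \<le> (\<Sum>j=1..K. \<alpha> j * fugacity \<rho> ^ j) - (\<Sum>j=1..K. \<alpha> j * z ^ j)"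
      if "1 \<le> K" for K
    proof -
      have "\<alpha> 1 * (fugacity \<rho> ^ 1 - z ^ 1) \<le> (\<Sum>j=1..K. \<alpha> j * (fugacity \<rho> ^ j - z ^ j))"
        using assms that alpha_nonneg
        by (intro member_le_sum[of 1 _ "\<lambda>j. \<alpha> j * (fugacity \<rho> ^ j - z ^ j)"])
          (auto intro!: mult_nonneg_nonneg power_mono)
      then show ?thesis by (simp add: algebra_simps sum_subtractf)
    qed
    then show "\<exists>k. \<forall>K\<ge>k. (\<Sum>j=1..K. \<alpha> j * z ^ j)
        \<le> (\<Sum>j=1..K. \<alpha> j * fugacity \<rho> ^ j) - \<alpha> 1 * (fugacity \<rho> - z)"
      by (intro exI[of _ 1]) (auto simp: algebra_simps)
  qed
  moreover have "0 < \<alpha> 1 * (fugacity \<rho> - z)" using assms alpha_1_pos by simp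
  ultimately show ?thesis using dens_fugacity_le by linarith
qed

end

text \<open>Dominated convergence for series, with the domination uniform in the volume.\<close>

lemma total_weight_lim:
  assumes z: "0 \<le> z" "ereal z < zc"
  defines "B \<equiv> \<lambda>n. \<Sum>j. a n (Suc j) * z ^ Suc j"
  shows "(\<lambda>n. B n / N n) \<longlonglongrightarrow> dens z"
    and "\<forall>\<^sub>F n in sequentially. \<forall>m. (\<Sum>j=1..m. a n j * z ^ j) \<le> B n"
proof -
  let ?f = "\<lambda>k n. a n (Suc k) * z ^ Suc k / N n"
  have "\<forall>\<^sub>F n in sequentially. \<forall>k. norm (?f k n) \<le> \<beta> (Suc k) * z ^ Suc k"
    using a_dominated volume_pos
  proof eventually_elim
    case (elim n)
    show ?case
    proof
      fix k
      have "a n (Suc k) \<le> N n * \<beta> (Suc k)" "0 \<le> a n (Suc k)" using elim a_nonneg by auto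
      then have "a n (Suc k) / N n * z ^ Suc k \<le> \<beta> (Suc k) * z ^ Suc k"
        using elim z by (intro mult_right_mono) (auto simp: field_simps)
      then show "norm (?f k n) \<le> \<beta> (Suc k) * z ^ Suc k"
        using elim z \<open>0 \<le> a n (Suc k)\<close> by (simp add: abs_mult)
    qed
  qed
  then have bound: "\<forall>\<^sub>F (k, n) in at_top \<times>\<^sub>F sequentially. norm (?f k n) \<le> \<beta> (Suc k) * z ^ Suc k"
    unfolding eventually_prod_filter
    by (intro exI[of _ "\<lambda>_. True"] exI[of _ "\<lambda>n. \<forall>k. norm (?f k n) \<le> \<beta> (Suc k) * z ^ Suc k"]) auto
  have T: "\<forall>\<^sub>F n in sequentially. summable (\<lambda>k. norm (?f k n))"
    "(\<lambda>n. \<Sum>k. ?f k n) \<longlonglongrightarrow> (\<Sum>k. \<alpha> (Suc k) * z ^ Suc k)"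
  proof -
    have "(\<lambda>n. ?f k n) \<longlonglongrightarrow> \<alpha> (Suc k) * z ^ Suc k" for k
      using tendsto_mult_right[OF a_lim[of "Suc k"], of "z ^ Suc k"] by simp
    from tannerys_theorem[OF this bound beta_summable[OF z]]
    show "\<forall>\<^sub>F n in sequentially. summable (\<lambda>k. norm (?f k n))"
      "(\<lambda>n. \<Sum>k. ?f k n) \<longlonglongrightarrow> (\<Sum>k. \<alpha> (Suc k) * z ^ Suc k)" by auto
  qed
  have S: "\<forall>\<^sub>F n in sequentially. summable (\<lambda>k. a n (Suc k) * z ^ Suc k)"
    using T(1) volume_pos
  proof eventually_elim
    case (elim n)
    then have "summable (\<lambda>k. N n * ?f k n)" by (intro summable_mult) (rule summable_norm_cancel)
    then show ?case using elim by simp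
  qed
  show "(\<lambda>n. B n / N n) \<longlonglongrightarrow> dens z"
  proof (rule Lim_transform_eventually)
    show "(\<lambda>n. \<Sum>k. ?f k n) \<longlonglongrightarrow> dens z" using T(2) by (simp add: dens_def)
    show "\<forall>\<^sub>F n in sequentially. (\<Sum>k. ?f k n) = B n / N n"
      using S by eventually_elim (simp only: B_def suminf_divide)
  qed
  show "\<forall>\<^sub>F n in sequentially. \<forall>m. (\<Sum>j=1..m. a n j * z ^ j) \<le> B n"
    using S
  proof eventually_elim
    case (elim n)
    show ?case
    proof
      fix m
      have "(\<Sum>j=1..m. a n j * z ^ j) = (\<Sum>j<m. a n (Suc j) * z ^ Suc j)"
        by (rule sum_from_1)
      also have "\<dots> \<le> B n" unfolding B_def
        using a_nonneg z by (intro sum_le_suminf elim) auto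
      finally show "(\<Sum>j=1..m. a n j * z ^ j) \<le> B n" .
    qed
  qed
qed

text \<open>Combines the bound on the position of the maximum with the limit of the total weight.\<close>

lemma maximizer:
  assumes z: "0 \<le> z" "ereal z < zc"
  obtains B m\<^sub>0 where "(\<lambda>n. B n / N n) \<longlonglongrightarrow> dens z"
    "\<forall>\<^sub>F n in sequentially. real (m\<^sub>0 n) \<le> B n"
    "\<forall>\<^sub>F n in sequentially. \<forall>m. Z n m * z ^ m \<le> Z n (m\<^sub>0 n) * z ^ m\<^sub>0 n"
proof -
  define B where "B n = (\<Sum>j. a n (Suc j) * z ^ Suc j)" for n
  have "\<forall>\<^sub>F n in sequentially. \<exists>k. real k \<le> B n \<and> (\<forall>m. Z n m * z ^ m \<le> Z n k * z ^ k)"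
    using total_weight_lim(2)[OF z, folded B_def]
  proof eventually_elim
    case (elim n)
    obtain k where "real k \<le> B n" "\<And>m. Z n m * z ^ m \<le> Z n k * z ^ k"
      by (rule exp_coeff_maximizer[of "a n" z "B n"]) (use elim a_nonneg z in auto)
    then show ?case by blast
  qed
  then obtain m0 where
    m0: "\<forall>\<^sub>F n in sequentially. real (m0 n) \<le> B n \<and> (\<forall>m. Z n m * z ^ m \<le> Z n (m0 n) * z ^ m0 n)"
    unfolding eventually_ex ..
  show thesis
  proof (rule that[of B m0])
    show "(\<lambda>n. B n / N n) \<longlonglongrightarrow> dens z" unfolding B_def by (rule total_weight_lim(1)[OF z])
    show "\<forall>\<^sub>F n in sequentially. real (m0 n) \<le> B n"
      using m0 by (rule eventually_mono) blast
    show "\<forall>\<^sub>F n in sequentially. \<forall>m. Z n m * z ^ m \<le> Z n (m0 n) * z ^ m0 n"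
      using m0 by (rule eventually_mono) blast
  qed
qed

context
  fixes \<rho> :: real and M :: "nat \<Rightarrow> nat"
  assumes rho_pos: "0 < \<rho>"
    and M_lim: "(\<lambda>n. real (M n) / N n) \<longlonglongrightarrow> \<rho>"
begin

lemma M_infinite: "filterlim (\<lambda>n. real (M n)) at_top sequentially"
proof -
  have "filterlim (\<lambda>n. real (M n) / N n * N n) at_top sequentially"
    by (rule filterlim_tendsto_pos_mult_at_top[OF M_lim rho_pos volume_infinite])
  moreover have "\<forall>\<^sub>F n in sequentially. real (M n) / N n * N n = real (M n)"
    using volume_pos by eventually_elim simp
  ultimately show ?thesis by (subst (asm) filterlim_cong[OF refl refl])
qed

lemma M_ge: "\<forall>\<^sub>F n in sequentially. K \<le> M n"
proof -
  have "\<forall>\<^sub>F n in sequentially. real K \<le> real (M n)"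
    using M_infinite unfolding filterlim_at_top by blast
  then show ?thesis by simp
qed

text \<open>The extra \<open>1\<close> absorbs the shift between the position of a maximum and that of the ratio
  following it.\<close>

lemma partial_weight_exceeds:
  assumes "\<rho> < (\<Sum>j=1..K. \<alpha> j * s ^ j)"
  shows "\<forall>\<^sub>F n in sequentially. real (M n) + 1 < (\<Sum>j=1..K. a n j * s ^ j)"
proof -
  have "(\<lambda>n. \<Sum>j=1..K. a n j / N n * s ^ j) \<longlonglongrightarrow> (\<Sum>j=1..K. \<alpha> j * s ^ j)"
    by (intro tendsto_intros a_lim) auto
  moreover have "(\<lambda>n. real (M n) / N n + 1 / N n) \<longlonglongrightarrow> \<rho> + 0"
    by (rule tendsto_add[OF M_lim real_tendsto_divide_at_top[OF tendsto_const volume_infinite]])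
  ultimately have "(\<lambda>n. (\<Sum>j=1..K. a n j / N n * s ^ j) - (real (M n) / N n + 1 / N n))
      \<longlonglongrightarrow> (\<Sum>j=1..K. \<alpha> j * s ^ j) - (\<rho> + 0)"
    by (rule tendsto_diff)
  then have "\<forall>\<^sub>F n in sequentially. 0 < (\<Sum>j=1..K. a n j / N n * s ^ j) - (real (M n) / N n + 1 / N n)"
    using assms by (intro order_tendstoD) auto
  then show ?thesis using volume_pos
  proof eventually_elim
    case (elim n)
    have "(\<Sum>j=1..K. a n j / N n * s ^ j) = (\<Sum>j=1..K. a n j * s ^ j) / N n"
      by (simp add: sum_divide_distrib)
    then show ?case using elim by (simp add: field_simps)
  qed
qed

text \<open>A ratio above the fugacity would force more mass than \<open>M n\<close>.\<close>

lemma ratio_upper: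
  assumes "fugacity \<rho> < \<zeta>"
  shows "\<forall>\<^sub>F n in sequentially. Q n (M n) < \<zeta>"
proof -
  define s where "s = (fugacity \<rho> + \<zeta>) / 2"
  have s: "fugacity \<rho> < s" "s < \<zeta>" "0 \<le> s"
    using assms fugacity_nonneg[OF rho_pos] by (auto simp: s_def)
  obtain K where K: "\<rho> < (\<Sum>j=1..K. \<alpha> j * s ^ j)"
    using partial_density_above_fugacity[OF rho_pos s(1)] .
  have "(\<lambda>n. s + real K / a n 1) \<longlonglongrightarrow> s + 0" by (intro tendsto_intros over_a_1)
  then have "\<forall>\<^sub>F n in sequentially. s + real K / a n 1 < \<zeta>"
    using s by (intro order_tendstoD) auto
  then show ?thesis
    using partial_weight_exceeds[OF K] M_ge[of K] a_1_pos
  proof eventually_elim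
    case (elim n)
    show ?case
    proof (rule ccontr)
      assume "\<not> Q n (M n) < \<zeta>"
      then have "(\<Sum>j=1..K. a n j * s ^ j) \<le> real (M n)"
        using elim s by (intro density_le_of_ratio_ge a_nonneg) auto
      then show False using elim by simp
    qed
  qed
qed

text \<open>For \<open>z\<close> slightly above the fugacity the maximum of \<open>Z\<^sub>m z\<^sup>m\<close> lies at some \<open>m\<^sub>0\<close> with
  \<open>M \<le> m\<^sub>0 + 1\<close>: the ratio following it is at least \<open>z\<close>, which takes a mass exceeding \<open>M\<close>. As
  \<open>m\<^sub>0\<close> is at most \<open>dens z * N\<close>, going back from \<open>m\<^sub>0 + 1\<close> to \<open>M\<close> lowers the ratio
  by at most about \<open>(dens z - \<rho>) / \<alpha> 1\<close>, and this becomes non-positive as \<open>z\<close> decreases to the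
  fugacity.\<close>

lemma ratio_lower_subcritical:
  assumes "ereal (fugacity \<rho>) < zc" "\<zeta> < fugacity \<rho>"
  shows "\<forall>\<^sub>F n in sequentially. \<zeta> < Q n (M n)"
proof -
  have "\<exists>z>fugacity \<rho>. ereal z < zc \<and> \<zeta> < z - (dens z - \<rho>) / \<alpha> 1"
  proof -
    let ?c = "fugacity \<rho>"
    have c0: "0 \<le> ?c" by (rule fugacity_nonneg[OF rho_pos])
    obtain R where R: "?c < R" "ereal R < zc"
      using ereal_dense2[OF assms(1)] unfolding less_ereal.simps by blast
    have "((\<lambda>z. z - (dens z - \<rho>) / \<alpha> 1) \<longlongrightarrow> ?c - (dens ?c - \<rho>) / \<alpha> 1) (at_right ?c)"
      using alpha_1_pos by (intro tendsto_intros dens_right_lim c0 assms(1)) auto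
    moreover have "\<zeta> < ?c - (dens ?c - \<rho>) / \<alpha> 1"
    proof -
      have "dens ?c - \<rho> \<le> 0" using dens_fugacity_le[OF rho_pos] by linarith
      then have "(dens ?c - \<rho>) / \<alpha> 1 \<le> 0"
        using alpha_1_pos by (rule divide_nonpos_pos)
      then show ?thesis using assms(2) by linarith
    qed
    ultimately have "\<forall>\<^sub>F z in at_right ?c. \<zeta> < z - (dens z - \<rho>) / \<alpha> 1"
      by (rule order_tendstoD)
    moreover have "\<forall>\<^sub>F z in at_right ?c. ?c < z \<and> z < R"
      using eventually_at_right_real[OF R(1)] by simp
    ultimately have "\<forall>\<^sub>F z in at_right ?c. ?c < z \<and> z < R \<and> \<zeta> < z - (dens z - \<rho>) / \<alpha> 1"
      by (rule eventually_elim2) blast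
    then obtain z where z: "?c < z" "z < R" "\<zeta> < z - (dens z - \<rho>) / \<alpha> 1"
      using eventually_happens'[OF trivial_limit_at_right_real] by blast
    moreover have "ereal z < zc" using z R by (intro less_trans[OF _ R(2)]) simp
    ultimately show ?thesis by blast
  qed
  then obtain z where z: "fugacity \<rho> < z" "ereal z < zc" "\<zeta> < z - (dens z - \<rho>) / \<alpha> 1" by blast
  have z0: "0 < z" using z fugacity_nonneg[OF rho_pos] by simp
  obtain B m0 where B: "(\<lambda>n. B n / N n) \<longlonglongrightarrow> dens z"
    and m0: "\<forall>\<^sub>F n in sequentially. real (m0 n) \<le> B n"
    and mx: "\<forall>\<^sub>F n in sequentially. \<forall>m. Z n m * z ^ m \<le> Z n (m0 n) * z ^ m0 n"
    by (rule maximizer[OF less_imp_le[OF z0] z(2)])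
  define s where "s = (fugacity \<rho> + z) / 2"
  have s: "fugacity \<rho> < s" "s < z" "0 < s"
    using z fugacity_nonneg[OF rho_pos] by (auto simp: s_def)
  obtain K where K: "\<rho> < (\<Sum>j=1..K. \<alpha> j * s ^ j)"
    using partial_density_above_fugacity[OF rho_pos s(1)] .
  have small: "\<forall>\<^sub>F n in sequentially. s + real (Suc K) / a n 1 < z"
  proof -
    have "(\<lambda>n. s + real (Suc K) / a n 1) \<longlonglongrightarrow> s + 0" by (intro tendsto_intros over_a_1)
    then show ?thesis using s by (intro order_tendstoD) auto
  qed
  have "\<forall>\<^sub>F n in sequentially. real K < a n 1 * s"
  proof -
    have "filterlim (\<lambda>n. a n 1 * s) at_top sequentially"
      by (rule filterlim_at_top_mult_tendsto_pos[OF tendsto_const s(3) a_1_infinite])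
    then show ?thesis by (simp add: filterlim_at_top_dense)
  qed
  moreover have "\<forall>\<^sub>F n in sequentially. \<zeta> < z - (B n + 1 - real (M n)) / a n 1"
  proof -
    have "(\<lambda>n. z - (B n / N n + 1 / N n - real (M n) / N n) / (a n 1 / N n))
        \<longlonglongrightarrow> z - (dens z + 0 - \<rho>) / \<alpha> 1"
      using alpha_1_pos
      by (intro tendsto_intros B M_lim a_lim real_tendsto_divide_at_top[OF tendsto_const volume_infinite]) auto
    then have "\<forall>\<^sub>F n in sequentially. \<zeta> < z - (B n / N n + 1 / N n - real (M n) / N n) / (a n 1 / N n)"
      using z by (intro order_tendstoD) auto
    then show ?thesis using volume_pos
    proof eventually_elim
      case (elim n)
      have "(B n / N n + 1 / N n - real (M n) / N n) / (a n 1 / N n) = (B n + 1 - real (M n)) / a n 1"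
        using elim by (simp add: add_divide_distrib[symmetric] diff_divide_distrib[symmetric])
      then show ?case using elim by (simp only:)
    qed
  qed
  ultimately show ?thesis
    using m0 mx small partial_weight_exceeds[OF K] a_1_pos M_ge[of 1]
  proof eventually_elim
    case (elim n)
    let ?m = "Suc (m0 n)"
    have pos: "0 < Z n i" for i using a_nonneg elim by (intro exp_coeff_pos) auto
    have "Z n ?m * z ^ ?m \<le> Z n (m0 n) * z ^ m0 n" using elim by blast
    then have "Z n ?m * z \<le> Z n (m0 n)" using z0 by (simp del: exp_coeff.simps)
    then have Qz: "z \<le> Q n ?m"
      using pos[of ?m] by (simp add: coeff_ratio_def field_simps del: exp_coeff.simps)
    \<comment> \<open>The maximum cannot be attained at a bounded index, by the case \<open>K = 1\<close> of the same estimate.\<close>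
    have "K \<le> ?m"
    proof -
      have "1 / a n 1 \<le> real (Suc K) / a n 1" using elim by (intro divide_right_mono) auto
      then have "(\<Sum>j=1..1. a n j * s ^ j) \<le> real ?m"
        using s elim Qz by (intro density_le_of_ratio_ge a_nonneg) auto
      then show ?thesis using elim by simp
    qed
    moreover have "real K / a n 1 \<le> real (Suc K) / a n 1" using elim by (intro divide_right_mono) auto
    ultimately have "(\<Sum>j=1..K. a n j * s ^ j) \<le> real ?m"
      using s elim Qz by (intro density_le_of_ratio_ge a_nonneg) auto
    then have le: "M n \<le> ?m" using elim by simp
    have "Q n (M n + (?m - M n)) \<le> Q n (M n) + real (?m - M n) / a n 1"
      using elim a_nonneg by (intro coeff_ratio_steps) auto
    moreover have "real (?m - M n) / a n 1 \<le> (B n + 1 - real (M n)) / a n 1"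
      using elim le by (intro divide_right_mono) (auto simp: of_nat_diff)
    ultimately show ?case using elim Qz le by simp
  qed
qed

text \<open>The condensed phase. Let \<open>c = zc\<close> and \<open>z < c < w\<close>. Up to constant factors, \<open>Z\<^sub>M z\<^sup>M\<close> is at least
  \<open>(z / w)\<^sup>M\<close> times the maximum \<open>X\<close> of \<open>Z\<^sub>m z\<^sup>m\<close>, by filling with parts of a size \<open>j\<close> for which
  \<open>\<alpha>\<^sub>j w\<^sup>j > \<rho>\<close>. If the ratio at \<open>M\<close> were at most \<open>c - 3 \<eta>\<close>, the coefficients would grow on the
  following \<open>\<delta> N\<close> steps, so that \<open>Z\<^sub>M z\<^sup>M \<le> r\<^sup>k X\<close> with \<open>r < 1\<close> and \<open>k = \<delta> N\<close>. Neither \<open>r\<close> nor \<open>\<delta>\<close> depends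
  on \<open>z\<close> and \<open>w\<close>, so choosing these close to \<open>c\<close> gives a contradiction.\<close>

lemma ratio_lower_critical:
  assumes zc: "zc = ereal (fugacity \<rho>)" and \<zeta>: "\<zeta> < fugacity \<rho>"
  shows "\<forall>\<^sub>F n in sequentially. \<zeta> < Q n (M n)"
proof -
  define c where "c = fugacity \<rho>"
  have c: "0 < c" "\<zeta> < c" using zc zc_pos \<zeta> by (auto simp: c_def)
  \<comment> \<open>The margin \<open>\<eta>\<close> satisfies \<open>\<zeta> \<le> c - 3 \<eta>\<close> and leaves \<open>p = c - 2 \<eta>\<close> positive. The length \<open>\<delta> N\<close> is
    such that the ratios rise by at most \<open>\<eta>\<close> along it.\<close>
  define \<eta> where "\<eta> = min (c / 4) ((c - \<zeta>) / 4)"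
  have \<eta>: "0 < \<eta>" "4 * \<eta> \<le> c" "\<zeta> \<le> c - 3 * \<eta>" using c by (auto simp: \<eta>_def min_def field_simps)
  define p where "p = c - 2 * \<eta>"
  define r where "r = p / (c - \<eta>)"
  define \<delta> where "\<delta> = \<eta> * \<alpha> 1 / 2"
  have p: "0 < p" using \<eta> by (simp add: p_def)
  have r: "0 < r" "r < 1" using \<eta> p by (auto simp: r_def p_def)
  have \<delta>: "0 < \<delta>" using \<eta> alpha_1_pos by (simp add: \<delta>_def)
  \<comment> \<open>As \<open>\<xi>\<close> tends to \<open>0\<close>, the right side tends to \<open>0\<close>, while the left side is negative and fixed.\<close>
  have "\<exists>\<xi>>0. \<xi> < \<eta> \<and> \<delta> * ln r < \<rho> * ln ((c - \<xi>) / (c + \<xi>))"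
  proof -
    have "((\<lambda>\<xi>. \<rho> * ln ((c - \<xi>) / (c + \<xi>))) \<longlongrightarrow> \<rho> * ln ((c - 0) / (c + 0))) (at_right 0)"
      using c by (intro tendsto_intros) auto
    moreover have "\<delta> * ln r < \<rho> * ln ((c - 0) / (c + 0))"
      using \<delta> r c by (simp add: mult_pos_neg)
    ultimately have "\<forall>\<^sub>F \<xi> in at_right 0. \<delta> * ln r < \<rho> * ln ((c - \<xi>) / (c + \<xi>))"
      by (rule order_tendstoD)
    moreover have "\<forall>\<^sub>F \<xi> in at_right 0. 0 < \<xi> \<and> \<xi> < \<eta>"
      using eventually_at_right_real[OF \<eta>(1)] by simp
    ultimately have "\<forall>\<^sub>F \<xi> in at_right 0. 0 < \<xi> \<and> \<xi> < \<eta> \<and> \<delta> * ln r < \<rho> * ln ((c - \<xi>) / (c + \<xi>))"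
      by (rule eventually_elim2) blast
    then show ?thesis using eventually_happens'[OF trivial_limit_at_right_real] by blast
  qed
  then obtain \<xi> where \<xi>: "0 < \<xi>" "\<xi> < \<eta>" "\<delta> * ln r < \<rho> * ln ((c - \<xi>) / (c + \<xi>))" by blast
  define z w where "z = c - \<xi>" and "w = c + \<xi>"
  have z: "0 < z" "c - \<eta> < z" "z < c" "z < w" "ereal z < zc"
    using \<xi> \<eta> c zc by (auto simp: z_def w_def c_def[symmetric])
  have w: "0 < w" "zc < ereal w" using \<xi> c zc by (auto simp: w_def c_def)
  obtain j where j: "1 \<le> j" "\<rho> < \<alpha> j * w ^ j" using alpha_unbounded[OF w(2)] by blast
  \<comment> \<open>Eventually \<open>a\<^sub>1 \<ge> \<alpha>\<^sub>1 N / 2\<close> and \<open>M \<le> 2 \<rho> N\<close>.\<close>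
  define \<kappa> where "\<kappa> = min 1 (\<alpha> 1 * w / (4 * \<rho>))"
  have \<kappa>: "0 < \<kappa>" "\<kappa> \<le> 1" using alpha_1_pos w rho_pos by (auto simp: \<kappa>_def)
  obtain B m0 where B: "(\<lambda>n. B n / N n) \<longlonglongrightarrow> dens z"
    and m0: "\<forall>\<^sub>F n in sequentially. real (m0 n) \<le> B n"
    and mx: "\<forall>\<^sub>F n in sequentially. \<forall>m. Z n m * z ^ m \<le> Z n (m0 n) * z ^ m0 n"
    by (rule maximizer[OF less_imp_le[OF z(1)] z(5)])
  have e0: "\<forall>\<^sub>F n in sequentially. B n < real (M n)"
  proof -
    have "(\<lambda>n. B n / N n - real (M n) / N n) \<longlonglongrightarrow> dens z - \<rho>" by (intro tendsto_intros B M_lim)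
    moreover have "dens z < \<rho>" using z by (intro dens_strict[OF rho_pos]) (auto simp: c_def)
    ultimately have "\<forall>\<^sub>F n in sequentially. B n / N n - real (M n) / N n < 0"
      by (intro order_tendstoD) auto
    then show ?thesis using volume_pos
      by eventually_elim (simp add: diff_divide_distrib[symmetric] divide_less_0_iff)
  qed
  have e1: "\<forall>\<^sub>F n in sequentially. real (M n) < a n j * w ^ j"
  proof -
    have "(\<lambda>n. real (M n) / N n - a n j / N n * w ^ j) \<longlonglongrightarrow> \<rho> - \<alpha> j * w ^ j"
      using j by (intro tendsto_intros M_lim a_lim)
    then have "\<forall>\<^sub>F n in sequentially. real (M n) / N n - a n j / N n * w ^ j < 0"
      using j by (intro order_tendstoD) auto
    then show ?thesis using volume_pos
      by eventually_elim (simp add: diff_divide_distrib[symmetric] divide_less_0_iff)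
  qed
  have e2: "\<forall>\<^sub>F n in sequentially. \<kappa> * real (M n) \<le> a n 1 * w"
  proof -
    have "\<forall>\<^sub>F n in sequentially. real (M n) / N n < 2 * \<rho>"
      using rho_pos by (intro order_tendstoD[OF M_lim]) auto
    then show ?thesis using volume_pos a_1_over_volume
    proof eventually_elim
      case (elim n)
      have "\<kappa> * real (M n) \<le> \<alpha> 1 * w / (4 * \<rho>) * (2 * \<rho> * N n)"
        using elim \<kappa> w rho_pos alpha_1_pos
        by (intro mult_mono) (auto simp: \<kappa>_def field_simps)
      also have "\<dots> = (\<alpha> 1 / 2 * N n) * w" using rho_pos by simp
      also have "\<dots> \<le> a n 1 * w" using elim w by (intro mult_right_mono) auto
      finally show ?case .
    qed
  qed
  define k where "k n = nat \<lfloor>\<delta> * N n\<rfloor>" for n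
  have e3: "\<forall>\<^sub>F n in sequentially. real (k n) / a n 1 \<le> \<eta>"
    using volume_pos a_1_over_volume a_1_pos
  proof eventually_elim
    case (elim n)
    have "0 \<le> \<delta> * N n" using elim \<delta> by simp
    then have "real (k n) \<le> \<delta> * N n" unfolding k_def by linarith
    also have "\<dots> = \<eta> * (\<alpha> 1 / 2 * N n)" by (simp add: \<delta>_def)
    also have "\<dots> \<le> \<eta> * a n 1" using elim \<eta> by (intro mult_left_mono) auto
    finally show ?case using elim by (simp add: pos_divide_le_eq)
  qed
  have e4: "\<forall>\<^sub>F n in sequentially. r ^ k n < \<kappa> ^ j * (z / w) ^ M n"
  proof -
    have "(\<lambda>n. (\<delta> - 1 / N n) * ln r - (real j * ln \<kappa> / N n + real (M n) / N n * ln (z / w)))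
        \<longlonglongrightarrow> (\<delta> - 0) * ln r - (0 + \<rho> * ln (z / w))"
      by (intro tendsto_intros M_lim real_tendsto_divide_at_top[OF tendsto_const volume_infinite])
    then have "\<forall>\<^sub>F n in sequentially.
        (\<delta> - 1 / N n) * ln r - (real j * ln \<kappa> / N n + real (M n) / N n * ln (z / w)) < 0"
      using \<xi> by (intro order_tendstoD) (auto simp: z_def w_def)
    then show ?thesis using volume_pos
    proof eventually_elim
      case (elim n)
      have "\<delta> * N n - 1 \<le> real (k n)" unfolding k_def by linarith
      then have "real (k n) * ln r \<le> (\<delta> * N n - 1) * ln r"
        using r by (intro mult_right_mono_neg) auto
      also have "\<dots> = N n * ((\<delta> - 1 / N n) * ln r)" using elim by (simp add: field_simps)
      also have "\<dots> < N n * (real j * ln \<kappa> / N n + real (M n) / N n * ln (z / w))"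
        using elim by (intro mult_strict_left_mono) auto
      also have "\<dots> = real j * ln \<kappa> + real (M n) * ln (z / w)" using elim by (simp add: field_simps)
      finally have "ln (r ^ k n) < ln (\<kappa> ^ j * (z / w) ^ M n)"
        using r \<kappa> z w by (simp add: ln_realpow ln_mult)
      then show ?case using r \<kappa> z w by (subst (asm) ln_less_cancel_iff) auto
    qed
  qed
  show ?thesis
    using m0 mx e0 e1 e2 e3 e4 a_1_pos M_ge[of 1]
  proof eventually_elim
    case (elim n)
    show ?case
    proof (rule ccontr)
      assume "\<not> \<zeta> < Q n (M n)"
      then have Q: "Q n (M n) + real (k n) / a n 1 \<le> p" using elim \<eta> by (simp add: p_def)
      have pos: "0 < Z n i" for i using a_nonneg elim by (intro exp_coeff_pos) auto
      define X where "X = Z n (m0 n) * z ^ m0 n"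
      have X: "0 < X" using pos z by (simp add: X_def)
      have "m0 n \<le> M n" using elim by linarith
      then have fill: "\<kappa> ^ j * (Z n (m0 n) * w ^ m0 n) \<le> Z n (M n) * w ^ M n"
        using elim a_nonneg w j \<kappa> by (intro exp_coeff_fill) auto
      have "\<kappa> ^ j * X \<le> \<kappa> ^ j * (Z n (m0 n) * w ^ m0 n)"
        unfolding X_def using \<kappa> pos z by (intro mult_left_mono power_mono) (auto simp: less_imp_le)
      also note fill
      finally have "\<kappa> ^ j * X * (z / w) ^ M n \<le> Z n (M n) * w ^ M n * (z / w) ^ M n"
        using z w by (intro mult_right_mono) auto
      also have "\<dots> = Z n (M n) * z ^ M n" using w by (simp add: power_divide)
      also have "\<dots> \<le> (Z n (M n + k n) * p ^ k n) * z ^ M n"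
        using elim Q a_nonneg z by (intro mult_right_mono exp_coeff_growth) auto
      also have "\<dots> = (Z n (M n + k n) * z ^ (M n + k n)) * (p / z) ^ k n"
        using z by (simp add: power_add power_divide)
      also have "\<dots> \<le> X * r ^ k n"
      proof (rule mult_mono)
        show "Z n (M n + k n) * z ^ (M n + k n) \<le> X" unfolding X_def using elim by blast
        show "(p / z) ^ k n \<le> r ^ k n"
          unfolding r_def using p z \<eta> by (intro power_mono divide_left_mono) auto
      qed (use X p z in auto)
      finally have "X * (\<kappa> ^ j * (z / w) ^ M n) \<le> X * r ^ k n" by (simp add: mult_ac)
      then show False using X elim by simp
    qed
  qed
qed

theorem ratio_lim: "(\<lambda>n. Q n (M n)) \<longlonglongrightarrow> fugacity \<rho>"
proof (rule order_tendstoI)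
  fix \<zeta> assume "\<zeta> < fugacity \<rho>"
  then show "\<forall>\<^sub>F n in sequentially. \<zeta> < Q n (M n)"
    using ratio_lower_subcritical ratio_lower_critical fugacity_le_zc[OF rho_pos]
    by (cases "zc = ereal (fugacity \<rho>)") (auto simp: less_le)
qed (rule ratio_upper)

end

text \<open>Otherwise the density could be increased a little without exceeding \<open>\<rho>\<close>.\<close>

lemma dens_fugacity_eq:
  assumes "0 < \<rho>" "ereal (fugacity \<rho>) < zc"
  shows "dens (fugacity \<rho>) = \<rho>"
proof (rule ccontr)
  let ?c = "fugacity \<rho>"
  have c0: "0 \<le> ?c" by (rule fugacity_nonneg[OF assms(1)])
  assume "dens ?c \<noteq> \<rho>"
  then have "dens ?c < \<rho>" using dens_fugacity_le[OF assms(1)] by simp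
  then have "\<forall>\<^sub>F z in at_right ?c. dens z < \<rho>"
    by (rule order_tendstoD(2)[OF dens_right_lim[OF c0 assms(2)]])
  moreover obtain R where R: "?c < R" "ereal R < zc"
    using ereal_dense2[OF assms(2)] unfolding less_ereal.simps by blast
  have "\<forall>\<^sub>F z in at_right ?c. ?c < z \<and> z < R"
    using eventually_at_right_real[OF R(1)] by simp
  ultimately have "\<forall>\<^sub>F z in at_right ?c. ?c < z \<and> z < R \<and> dens z < \<rho>"
    by (rule eventually_elim2) blast
  then obtain z where z: "?c < z" "z < R" "dens z < \<rho>"
    using eventually_happens'[OF trivial_limit_at_right_real] by blast
  have "ereal z < zc" using z R by (intro less_trans[OF _ R(2)]) simp
  then have "(\<Sum>j=1..K. \<alpha> j * z ^ j) \<le> \<rho>" for K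
    using partial_density_le_dens[OF _ alpha_summable, of z K] z c0 by simp
  then have "z \<le> ?c" using z c0 by (intro fugacity_upper[OF assms(1)]) auto
  then show False using z by simp
qed

text \<open>A product of \<open>k\<close> ratios, each of which falls under the ratio limit, as \<open>M n - k\<close> has the same
  asymptotic density as \<open>M n\<close>.\<close>

theorem shifted_ratio_lim:
  assumes "0 < \<rho>" "(\<lambda>n. real (M n) / N n) \<longlonglongrightarrow> \<rho>"
  shows "(\<lambda>n. Z n (M n - k) / Z n (M n)) \<longlonglongrightarrow> fugacity \<rho> ^ k"
proof (induction k)
  case 0
  have "\<forall>\<^sub>F n in sequentially. 1 = Z n (M n - 0) / Z n (M n)"
    using a_1_pos
  proof eventually_elim
    case (elim n)
    have "0 < Z n (M n)" using a_nonneg elim by (intro exp_coeff_pos) auto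
    then show ?case by simp
  qed
  then show ?case unfolding power_0 by (intro tendsto_eventually) (simp only: eq_commute)
next
  case (Suc k)
  have "(\<lambda>n. real (M n - k) / N n) \<longlonglongrightarrow> \<rho> - 0"
  proof (rule Lim_transform_eventually)
    show "(\<lambda>n. real (M n) / N n - real k / N n) \<longlonglongrightarrow> \<rho> - 0"
      by (intro tendsto_diff assms real_tendsto_divide_at_top[OF tendsto_const volume_infinite])
    show "\<forall>\<^sub>F n in sequentially. real (M n) / N n - real k / N n = real (M n - k) / N n"
      using M_ge[OF assms, of k] by eventually_elim (simp add: of_nat_diff diff_divide_distrib)
  qed
  then have "(\<lambda>n. Q n (M n - k)) \<longlonglongrightarrow> fugacity \<rho>"
    using ratio_lim[OF assms(1), of "\<lambda>n. M n - k"] by simp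
  then have "(\<lambda>n. Q n (M n - k) * (Z n (M n - k) / Z n (M n))) \<longlonglongrightarrow> fugacity \<rho> ^ Suc k"
    unfolding power_Suc using Suc by (rule tendsto_mult)
  then show ?case
  proof (rule Lim_transform_eventually)
    show "\<forall>\<^sub>F n in sequentially. Q n (M n - k) * (Z n (M n - k) / Z n (M n)) = Z n (M n - Suc k) / Z n (M n)"
      using a_1_pos
    proof eventually_elim
      case (elim n)
      have "0 < Z n (M n - k)" using a_nonneg elim by (intro exp_coeff_pos) auto
      then show ?case by (simp add: coeff_ratio_def)
    qed
  qed
qed

end

section \<open>Spatial partitions and insertion of a part\<close>

text \<open>For the non-trivial inequality, consider a simple function below \<open>f\<close>. If its support is finite, its
  integral is a finite sum; if not, it takes some positive value infinitely often, and the sum of \<open>f\<close>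
  is infinite.\<close>

lemma infsum_eq_nn_integral_count_space:
  fixes f :: "'a \<Rightarrow> ennreal"
  shows "infsum f A = (\<integral>\<^sup>+x. f x \<partial>count_space A)"
proof (rule antisym)
  have S: "infsum f A = (SUP F\<in>{F. finite F \<and> F \<subseteq> A}. sum f F)"
    by (rule nonneg_infsum_complete) simp
  show "infsum f A \<le> (\<integral>\<^sup>+x. f x \<partial>count_space A)"
    unfolding S
  proof (rule SUP_least)
    fix F assume F: "F \<in> {F. finite F \<and> F \<subseteq> A}"
    then have "sum f F = (\<integral>\<^sup>+x. f x * indicator F x \<partial>count_space A)"
      by (subst nn_integral_count_space'[where A = F]) (auto intro!: sum.cong)
    also have "\<dots> \<le> (\<integral>\<^sup>+x. f x \<partial>count_space A)"
      by (intro nn_integral_mono) (auto split: split_indicator)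
    finally show "sum f F \<le> (\<integral>\<^sup>+x. f x \<partial>count_space A)" .
  qed
  show "(\<integral>\<^sup>+x. f x \<partial>count_space A) \<le> infsum f A"
    unfolding nn_integral_def
  proof (rule SUP_least, safe)
    fix g assume g: "simple_function (count_space A) g" "g \<le> f"
    define T where "T = {x\<in>A. g x \<noteq> 0}"
    have "integral\<^sup>S (count_space A) g = (\<integral>\<^sup>+x. g x \<partial>count_space A)"
      by (rule nn_integral_eq_simple_integral[OF g(1), symmetric])
    also have "\<dots> \<le> infsum f A"
    proof (cases "finite T")
      case True
      then have "(\<integral>\<^sup>+x. g x \<partial>count_space A) = sum g T"
        by (intro nn_integral_count_space') (auto simp: T_def)
      also have "\<dots> \<le> sum f T" using g(2) by (intro sum_mono) (auto simp: le_fun_def)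
      also have "\<dots> \<le> infsum f A"
        unfolding S using True by (intro SUP_upper) (auto simp: T_def)
      finally show ?thesis .
    next
      case False
      have "finite (g ` T)"
        using g(1) by (intro finite_subset[of "g ` T" "g ` A"]) (auto simp: T_def simple_function_def)
      then obtain y where y: "y \<in> g ` T" "infinite {x\<in>T. g x = y}"
        using inf_img_fin_dom'[of g T] False by (auto simp: vimage_def Int_def conj_commute)
      let ?U = "{x\<in>T. g x = y}"
      have "0 < y" using y by (auto simp: T_def zero_less_iff_neq_zero)
      then have "infsum f ?U = \<infinity>"
      proof (intro infsum_superconst_infinite_ennreal[where b = y])
        show "y \<le> f x" if "x \<in> ?U" for x using that le_funD[OF g(2), of x] by simp
      qed (use y in auto)
      moreover have "infsum f ?U \<le> infsum f A"
      proof -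
        have "infsum f ?U = (SUP F\<in>{F. finite F \<and> F \<subseteq> ?U}. sum f F)"
          by (rule nonneg_infsum_complete) simp
        also have "\<dots> \<le> infsum f A"
          unfolding S by (intro SUP_subset_mono) (auto simp: T_def)
        finally show ?thesis .
      qed
      ultimately show ?thesis by (simp add: top_unique)
    qed
    finally show "integral\<^sup>S (count_space A) g \<le> infsum f A" .
  qed
qed

lemma exp_neg_of_nat_mult: "exp_neg (of_nat j * v) = exp_neg v ^ j"
proof (cases "v = \<infinity>")
  case True
  then show ?thesis by (cases "j = 0") (auto simp: exp_neg_def ennreal_mult_top power_0_left)
next
  case False
  then have "of_nat j * v \<noteq> \<infinity>" by (simp add: ennreal_mult_eq_top_iff)
  moreover have "enn2real (of_nat j * v) = real j * enn2real v"
    by (simp add: enn2real_mult)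
  ultimately show ?thesis using False by (simp add: exp_neg_def exp_of_nat_mult[symmetric])
qed

lemma exp_neg_bounds: "0 \<le> exp_neg v" "exp_neg v \<le> 1"
  by (auto simp: exp_neg_def)

definition insert_part :: "int ^ 'd \<Rightarrow> nat \<Rightarrow> 'd::finite spatial_partition \<Rightarrow> 'd spatial_partition" where
  "insert_part x j lam = lam(x := add_mset j (lam x))"

definition short_mass :: "nat \<Rightarrow> 'd::finite spatial_partition \<Rightarrow> int ^ 'd \<Rightarrow> nat" where
  "short_mass M lam x = (\<Sum>j=1..M. j * part_count lam x j)"

definition occupied :: "'d::finite spatial_partition \<Rightarrow> (int ^ 'd) set" where
  "occupied lam = {x. lam x \<noteq> {#}}"

lemma part_count_insert:
  "part_count (insert_part x j lam) y i = part_count lam y i + (if y = x \<and> i = j then 1 else 0)"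
  by (auto simp: part_count_def insert_part_def)


lemma set_mset_part_count: "j \<in># lam x \<longleftrightarrow> part_count lam x j \<noteq> 0"
  by (simp add: part_count_def)

lemma site_mass_superset:
  assumes "finite J" "set_mset (lam x) \<subseteq> J"
  shows "site_mass lam x = (\<Sum>j\<in>J. j * part_count lam x j)"
  unfolding site_mass_def
  using assms by (intro sum.mono_neutral_left) (auto simp: set_mset_part_count)

lemma site_mass_insert:
  "site_mass (insert_part x j lam) y = site_mass lam y + (if y = x then j else 0)"
proof (cases "y = x")
  case True
  let ?J = "insert j (set_mset (lam x))"
  have "site_mass (insert_part x j lam) x = (\<Sum>i\<in>?J. i * part_count (insert_part x j lam) x i)"
    by (intro site_mass_superset) (auto simp: insert_part_def)
  also have "\<dots> = (\<Sum>i\<in>?J. i * part_count lam x i + (if i = j then j else 0))"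
    by (intro sum.cong) (auto simp: part_count_insert algebra_simps)
  also have "\<dots> = site_mass lam x + j"
    by (subst sum.distrib, subst site_mass_superset[of ?J lam x]) auto
  finally show ?thesis using True by simp
qed (simp add: site_mass_def insert_part_def part_count_def)

lemma short_mass_insert:
  "1 \<le> j \<Longrightarrow> short_mass M (insert_part x j lam) y = short_mass M lam y + (if y = x \<and> j \<le> M then j else 0)"
  unfolding short_mass_def part_count_insert
  by (cases "y = x") (auto simp: algebra_simps sum.distrib if_distrib[of "\<lambda>z. _ * z"] cong: if_cong)

lemma occupied_insert: "occupied (insert_part x j lam) = insert x (occupied lam)"
  by (auto simp: occupied_def insert_part_def)

lemma not_occupied: "x \<notin> occupied lam \<Longrightarrow> site_mass lam x = 0" "x \<notin> occupied lam \<Longrightarrow> part_count lam x j = 0"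
  "x \<notin> occupied lam \<Longrightarrow> short_mass M lam x = 0"
  by (auto simp: occupied_def site_mass_def part_count_def short_mass_def)

lemma spatial_partitions_iff:
  "lam \<in> spatial_partitions n \<longleftrightarrow>
     (\<forall>x. 0 \<notin># lam x) \<and> finite (occupied lam) \<and> (\<Sum>x\<in>occupied lam. site_mass lam x) = n"
  by (simp add: spatial_partitions_def occupied_def)

lemma insert_part_mem_iff:
  assumes "1 \<le> j"
  shows "insert_part x j lam \<in> spatial_partitions (n + j) \<longleftrightarrow> lam \<in> spatial_partitions n"
proof (cases "finite (occupied lam)")
  case fin: True
  let ?S = "insert x (occupied lam)"
  have "(\<Sum>y\<in>?S. site_mass (insert_part x j lam) y) = (\<Sum>y\<in>?S. site_mass lam y) + j"
    using fin by (simp add: site_mass_insert sum.distrib del: sum.insert)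
  also have "(\<Sum>y\<in>?S. site_mass lam y) = (\<Sum>y\<in>occupied lam. site_mass lam y)"
    using fin by (intro sum.mono_neutral_right) (auto simp: not_occupied)
  finally have "(\<Sum>y\<in>?S. site_mass (insert_part x j lam) y) = n + j
      \<longleftrightarrow> (\<Sum>y\<in>occupied lam. site_mass lam y) = n" by simp
  moreover have "(\<forall>y. 0 \<notin># insert_part x j lam y) \<longleftrightarrow> (\<forall>y. 0 \<notin># lam y)"
    using assms by (auto simp: insert_part_def)
  ultimately show ?thesis using fin by (simp only: spatial_partitions_iff occupied_insert finite_insert)
qed (simp add: spatial_partitions_iff occupied_insert)

lemma insert_part_bij:
  assumes "1 \<le> j"
  shows "bij_betw (insert_part x j) (spatial_partitions n)
    {lam \<in> spatial_partitions (n + j). j \<in># lam x}"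
proof (rule bij_betw_byWitness[where f' = "\<lambda>lam. lam(x := lam x - {#j#})"])
  show "insert_part x j ` spatial_partitions n \<subseteq> {lam \<in> spatial_partitions (n + j). j \<in># lam x}"
    using assms by (auto simp: insert_part_mem_iff) (simp add: insert_part_def)
  have I: "insert_part x j (lam(x := lam x - {#j#})) = lam" if "j \<in># lam x" for lam
    using that by (simp add: insert_part_def)
  then show "(\<lambda>lam. lam(x := lam x - {#j#})) ` {lam \<in> spatial_partitions (n + j). j \<in># lam x}
      \<subseteq> spatial_partitions n"
    using insert_part_mem_iff[OF assms, of x _ n] by fastforce
  show "\<forall>lam\<in>{lam \<in> spatial_partitions (n + j). j \<in># lam x}. insert_part x j (lam(x := lam x - {#j#})) = lam"
    using I by blast
qed (auto simp: insert_part_def)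

lemma part_pairs_finite:
  assumes "finite (occupied lam)"
  shows "finite {(x, j). part_count lam x j \<noteq> 0}"
proof -
  have "{(x, j). part_count lam x j \<noteq> 0} = (SIGMA x:occupied lam. set_mset (lam x))"
    by (auto simp: set_mset_part_count not_occupied occupied_def)
  then show ?thesis using assms by simp
qed

lemma spatial_partitions_part_bounds:
  assumes "lam \<in> spatial_partitions n" "part_count lam x j \<noteq> 0"
  shows "1 \<le> j" "j \<le> n"
proof -
  have "0 \<notin># lam x" "j \<in># lam x" using assms by (auto simp: spatial_partitions_iff part_count_def)
  then show "1 \<le> j" by (cases j) auto
  have "j * 1 \<le> j * part_count lam x j" using assms by (intro mult_left_mono) auto
  also have "\<dots> \<le> site_mass lam x"
    unfolding site_mass_def using \<open>j \<in># lam x\<close> by (intro member_le_sum) auto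
  also have "\<dots> \<le> (\<Sum>y\<in>occupied lam. site_mass lam y)"
    using assms by (intro member_le_sum) (auto simp: spatial_partitions_iff not_occupied(2) intro: ccontr)
  also have "\<dots> = n" using assms by (simp add: spatial_partitions_iff)
  finally show "j \<le> n" by simp
qed

lemma site_mass_eq_short_mass:
  assumes "lam \<in> spatial_partitions n"
  shows "site_mass lam x = short_mass n lam x"
  unfolding short_mass_def
proof (rule site_mass_superset)
  show "set_mset (lam x) \<subseteq> {1..n}"
    using spatial_partitions_part_bounds[OF assms] by (auto simp: set_mset_part_count Suc_le_eq)
qed simp

lemma total_count_eq:
  assumes "finite (occupied lam)"
  shows "total_count lam j = (\<Sum>x\<in>occupied lam. part_count lam x j)"
  unfolding total_count_def
  using assms by (intro sum.mono_neutral_left) (auto simp: not_occupied(2) intro: ccontr)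

lemma partition_weight_superset:
  assumes "finite S" "{(x, j). part_count lam x j \<noteq> 0} \<subseteq> S"
  shows "partition_weight \<theta> V L lam =
     (\<Prod>(x, j) \<in> S. (\<theta> j / real j * exp_neg (of_nat j * V (scaled_site L x))) ^ part_count lam x j
          / fact (part_count lam x j))"
  unfolding partition_weight_def
proof (rule prod.mono_neutral_left[OF assms(1,2)], rule ballI)
  fix p assume p: "p \<in> S - {(x, j). part_count lam x j \<noteq> 0}"
  obtain x j where xj: "p = (x, j)" by force
  then have "part_count lam x j = 0" using p by auto
  then show "(case p of (x, j) \<Rightarrow> (\<theta> j / real j * exp_neg (of_nat j * V (scaled_site L x))) ^ part_count lam x j
          / fact (part_count lam x j)) = 1"
    by (simp add: xj)
qed

text \<open>With \<open>r\<close> parts \<open>j\<close> present at \<open>x\<close>, the factor \<open>w\<^sup>r / r!\<close> becomes \<open>w\<^bsup>r+1\<^esup> / (r + 1)!\<close>.\<close>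

lemma partition_weight_insert:
  assumes "finite (occupied lam)"
  shows "real (part_count lam x j + 1) * partition_weight \<theta> V L (insert_part x j lam)
     = \<theta> j / real j * exp_neg (of_nat j * V (scaled_site L x)) * partition_weight \<theta> V L lam"
proof -
  let ?S = "insert (x, j) {(x, j). part_count lam x j \<noteq> 0}"
  define g where "g lam = (\<lambda>(x, j). (\<theta> j / real j * exp_neg (of_nat j * V (scaled_site L x))) ^ part_count lam x j
          / fact (part_count lam x j))" for lam :: "'a spatial_partition"
  have fin: "finite ?S" using part_pairs_finite[OF assms] by simp
  have 1: "partition_weight \<theta> V L lam = g lam (x, j) * prod (g lam) (?S - {(x, j)})"
    unfolding partition_weight_superset[OF fin subset_insertI] g_def[symmetric]
    by (rule prod.remove[OF fin]) simp
  have "{(y, i). part_count (insert_part x j lam) y i \<noteq> 0} \<subseteq> ?S"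
    by (auto simp: part_count_insert split: if_splits)
  note sub2 = this
  have 2: "partition_weight \<theta> V L (insert_part x j lam)
      = g (insert_part x j lam) (x, j) * prod (g (insert_part x j lam)) (?S - {(x, j)})"
    unfolding partition_weight_superset[OF fin sub2] g_def[symmetric]
    by (rule prod.remove[OF fin]) simp
  have 3: "prod (g (insert_part x j lam)) (?S - {(x, j)}) = prod (g lam) (?S - {(x, j)})"
  proof (rule prod.cong[OF refl])
    fix p assume p: "p \<in> ?S - {(x, j)}"
    obtain y i where yi: "p = (y, i)" by force
    then have "\<not> (y = x \<and> i = j)" using p by auto
    then have "part_count (insert_part x j lam) y i = part_count lam y i"
      by (simp only: part_count_insert if_False add_0_right)
    then show "g (insert_part x j lam) p = g lam p" by (simp only: g_def yi prod.case)
  qed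
  have 4: "real (part_count lam x j + 1) * g (insert_part x j lam) (x, j)
      = \<theta> j / real j * exp_neg (of_nat j * V (scaled_site L x)) * g lam (x, j)"
    unfolding g_def prod.case part_count_insert
    using power_over_fact_Suc[of "part_count lam x j" "\<theta> j / real j * exp_neg (of_nat j * V (scaled_site L x))"]
    by (simp only: simp_thms if_True Suc_eq_plus1)
  show ?thesis unfolding 1 2 3 mult.assoc[symmetric] 4 ..
qed

lemma partition_weight_nonneg:
  assumes "\<And>j. j \<ge> 1 \<Longrightarrow> \<theta> j \<ge> 0" "lam \<in> spatial_partitions n"
  shows "0 \<le> partition_weight \<theta> V L lam"
  unfolding partition_weight_def
  using assms(1) spatial_partitions_part_bounds(1)[OF assms(2)]
  by (intro prod_nonneg) (auto intro!: divide_nonneg_nonneg mult_nonneg_nonneg zero_le_power exp_neg_bounds)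

text \<open>The powers of this factor are the Boltzmann factors of all part sizes, because
  \<open>exp_neg (j v) = exp_neg v ^ j\<close> holds for all \<open>v\<close> in \<open>[0, \<infinity>]\<close>.\<close>

definition boltzmann_factor :: "(real ^ 'd \<Rightarrow> ennreal) \<Rightarrow> real \<Rightarrow> int ^ 'd::finite \<Rightarrow> real" where
  "boltzmann_factor V L x = exp_neg (V (scaled_site L x))"

definition boltzmann_sum :: "(real ^ 'd::finite \<Rightarrow> ennreal) \<Rightarrow> real \<Rightarrow> nat \<Rightarrow> real" where
  "boltzmann_sum V L j = (\<integral>x. boltzmann_factor V L x ^ j \<partial>count_space UNIV)"

definition part_activity ::
  "(nat \<Rightarrow> real) \<Rightarrow> (real ^ 'd::finite \<Rightarrow> ennreal) \<Rightarrow> real \<Rightarrow> nat \<Rightarrow> real" where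
  "part_activity \<theta> V L j = \<theta> j * boltzmann_sum V L j"

definition short_theta :: "(nat \<Rightarrow> real) \<Rightarrow> nat \<Rightarrow> nat \<Rightarrow> real" where
  "short_theta \<theta> M j = (if j \<le> M then \<theta> j else 0)"

lemma mass_eq_total_counts:
  assumes "lam \<in> spatial_partitions n"
  shows "n = (\<Sum>j=1..n. j * total_count lam j)"
proof -
  have "n = (\<Sum>x\<in>occupied lam. short_mass n lam x)"
    using assms site_mass_eq_short_mass[OF assms] by (simp add: spatial_partitions_iff)
  also have "\<dots> = (\<Sum>j=1..n. \<Sum>x\<in>occupied lam. j * part_count lam x j)"
    unfolding short_mass_def by (rule sum.swap)
  also have "\<dots> = (\<Sum>j=1..n. j * total_count lam j)"
    using assms by (intro sum.cong) (auto simp: total_count_eq spatial_partitions_iff sum_distrib_left)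
  finally show ?thesis .
qed

lemma short_mass_le_site_mass: "short_mass M lam x \<le> site_mass lam x"
proof -
  have "short_mass M lam x \<le> (\<Sum>j\<in>{1..M} \<union> set_mset (lam x). j * part_count lam x j)"
    unfolding short_mass_def by (intro sum_mono2) auto
  also have "\<dots> = site_mass lam x"
    by (intro site_mass_superset[symmetric]) auto
  finally show ?thesis .
qed

lemma site_mass_le:
  assumes "lam \<in> spatial_partitions n"
  shows "site_mass lam x \<le> n"
proof (cases "x \<in> occupied lam")
  case True
  then have "site_mass lam x \<le> (\<Sum>y\<in>occupied lam. site_mass lam y)"
    using assms by (intro member_le_sum) (auto simp: spatial_partitions_iff)
  then show ?thesis using assms by (simp add: spatial_partitions_iff)
qed (simp add: not_occupied)

lemma sum_by_value:
  fixes f :: "'a \<Rightarrow> nat"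
  assumes "finite {x. f x \<noteq> 0}"
  shows "(\<Sum>x | B < f x \<and> f x \<le> N. f x) = (\<Sum>k=B+1..N. k * card {x. f x = k})"
proof -
  let ?S = "{x. B < f x \<and> f x \<le> N}"
  have fin: "finite ?S" by (rule finite_subset[OF _ assms]) auto
  have "(\<Sum>k=B+1..N. k * card {x. f x = k}) = (\<Sum>k=B+1..N. \<Sum>x | x \<in> ?S \<and> f x = k. f x)"
  proof (rule sum.cong[OF refl])
    fix k assume "k \<in> {B+1..N}"
    then have "{x. x \<in> ?S \<and> f x = k} = {x. f x = k}" by auto
    then show "k * card {x. f x = k} = (\<Sum>x | x \<in> ?S \<and> f x = k. f x)"
      by (simp add: mult.commute)
  qed
  also have "\<dots> = (\<Sum>x\<in>?S. f x)"
    using fin by (intro sum.group) auto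
  finally show ?thesis ..
qed

definition site_count :: "nat \<Rightarrow> 'd::finite spatial_partition \<Rightarrow> nat" where
  "site_count k lam = card {x. site_mass lam x = k}"

context
  fixes lam :: "'d::finite spatial_partition" and n :: nat
  assumes lam: "lam \<in> spatial_partitions n"
begin

lemma finite_occupied: "finite (occupied lam)"
  using lam by (simp add: spatial_partitions_iff)

lemma total_site_mass: "(\<Sum>x\<in>occupied lam. site_mass lam x) = n"
  using lam by (simp add: spatial_partitions_iff)

lemma finite_site_mass: "finite {x. site_mass lam x \<noteq> 0}"
  by (rule finite_subset[OF _ finite_occupied]) (auto intro: ccontr simp: not_occupied)

lemma finite_short_mass: "finite {x. short_mass M lam x \<noteq> 0}"
  by (rule finite_subset[OF _ finite_occupied]) (auto intro: ccontr simp: not_occupied)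

lemma sum_site_mass_le:
  assumes "finite X"
  shows "(\<Sum>x\<in>X. site_mass lam x) \<le> n"
proof -
  have "(\<Sum>x\<in>X. site_mass lam x) = (\<Sum>x\<in>X \<inter> occupied lam. site_mass lam x)"
    using assms by (intro sum.mono_neutral_right) (auto simp: not_occupied)
  also have "\<dots> \<le> (\<Sum>x\<in>occupied lam. site_mass lam x)"
    using finite_occupied by (intro sum_mono2) auto
  finally show ?thesis by (simp add: total_site_mass)
qed

lemma card_heavy_sites:
  assumes "finite X" "\<And>x. x \<in> X \<Longrightarrow> K \<le> site_mass lam x"
  shows "card X * K \<le> n"
proof -
  have "card X * K = (\<Sum>x\<in>X. K)" by simp
  also have "\<dots> \<le> (\<Sum>x\<in>X. site_mass lam x)" using assms(2) by (rule sum_mono)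
  also have "\<dots> \<le> n" by (rule sum_site_mass_le[OF assms(1)])
  finally show ?thesis .
qed

lemma long_part_mass_eq:
  "long_part_mass K lam + (\<Sum>j=1..K. j * total_count lam j) = n"
proof -
  have tc: "total_count lam j = 0" if "n < j" for j
    using spatial_partitions_part_bounds(2)[OF lam, of _ j] that
    unfolding total_count_eq[OF finite_occupied] by (intro sum.neutral) (auto intro: ccontr)
  have "long_part_mass K lam = (\<Sum>j\<in>{K<..n+K}. j * total_count lam j)"
    unfolding long_part_mass_def
  proof (rule sum.mono_neutral_left)
    show "{j. K < j \<and> total_count lam j \<noteq> 0} \<subseteq> {K<..n + K}"
    proof
      fix j assume "j \<in> {j. K < j \<and> total_count lam j \<noteq> 0}"
      then have "K < j" "\<not> n < j" using tc by auto
      then show "j \<in> {K<..n + K}" by auto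
    qed
  qed auto
  then have "long_part_mass K lam + (\<Sum>j=1..K. j * total_count lam j)
      = (\<Sum>j\<in>{K<..n+K} \<union> {1..K}. j * total_count lam j)"
    by (subst sum.union_disjoint) auto
  also have "\<dots> = (\<Sum>j=1..n. j * total_count lam j)"
  proof (rule sum.mono_neutral_right)
    show "\<forall>j\<in>({K<..n+K} \<union> {1..K}) - {1..n}. j * total_count lam j = 0"
      using tc by auto
  qed auto
  also have "\<dots> = n" using mass_eq_total_counts[OF lam] by simp
  finally show ?thesis .
qed

lemma long_part_mass_eq_short_mass:
  "long_part_mass K lam + (\<Sum>x\<in>occupied lam. short_mass K lam x) = n"
proof -
  have "(\<Sum>x\<in>occupied lam. short_mass K lam x) = (\<Sum>j=1..K. \<Sum>x\<in>occupied lam. j * part_count lam x j)"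
    unfolding short_mass_def by (rule sum.swap)
  also have "\<dots> = (\<Sum>j=1..K. j * total_count lam j)"
    by (simp add: total_count_eq[OF finite_occupied] sum_distrib_left)
  finally show ?thesis using long_part_mass_eq by simp
qed

lemma short_mass_ne_site_mass:
  assumes "short_mass M lam x \<noteq> site_mass lam x"
  shows "M < site_mass lam x"
proof -
  have "\<not> set_mset (lam x) \<subseteq> {1..M}"
    using site_mass_superset[of "{1..M}" lam x] assms unfolding short_mass_def by force
  then obtain j where j: "j \<in># lam x" "j \<notin> {1..M}" by blast
  then have nz: "part_count lam x j \<noteq> 0" by (simp add: set_mset_part_count)
  then have "M < j" using j spatial_partitions_part_bounds(1)[OF lam, of x j] by auto
  also have "j * 1 \<le> j * part_count lam x j" using nz by (intro mult_left_mono) auto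
  also have "\<dots> \<le> site_mass lam x"
    unfolding site_mass_def using j by (intro member_le_sum) auto
  finally show ?thesis by simp
qed

lemma heavy_site_mass_eq:
  assumes "K \<le> n"
  shows "heavy_site_mass K lam + (\<Sum>k=1..K. k * site_count k lam) = n"
proof -
  have le: "site_mass lam x \<le> n" for x by (rule site_mass_le[OF lam])
  have "heavy_site_mass K lam = (\<Sum>k=K+1..n. k * site_count k lam)"
    unfolding heavy_site_mass_def site_count_def
    using sum_by_value[OF finite_site_mass, of K n] le by simp
  moreover have "n = (\<Sum>k=1..n. k * site_count k lam)"
  proof -
    have "(\<Sum>x | 0 < site_mass lam x \<and> site_mass lam x \<le> n. site_mass lam x) = (\<Sum>x\<in>occupied lam. site_mass lam x)"
      using le finite_occupied by (intro sum.mono_neutral_left) (auto intro: ccontr simp: not_occupied)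
    then show ?thesis
      using sum_by_value[OF finite_site_mass, of 0 n] by (simp add: total_site_mass site_count_def)
  qed
  moreover have "(\<Sum>k=1..n. k * site_count k lam) = (\<Sum>k=1..K. k * site_count k lam) + (\<Sum>k=K+1..n. k * site_count k lam)"
  proof -
    have "{1..n} = {1..K} \<union> {K+1..n}" using assms by auto
    then show ?thesis by (simp only:) (rule sum.union_disjoint, auto)
  qed
  ultimately show ?thesis by simp
qed

text \<open>A site at which the mass and the short mass differ carries a part longer than \<open>M\<close>, and there are
  at most \<open>n / (M + 1)\<close> such sites.\<close>

lemma site_count_close:
  assumes "1 \<le> k"
  shows "\<bar>real (site_count k lam) - real (card {x. short_mass M lam x = k})\<bar> \<le> real n / real (M + 1)"
proof -
  let ?A = "{x. site_mass lam x = k}" and ?B = "{x. short_mass M lam x = k}"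
  let ?D = "{x. short_mass M lam x \<noteq> site_mass lam x}"
  have D: "Suc M \<le> site_mass lam x" if "x \<in> ?D" for x
    using short_mass_ne_site_mass[of M x] that by simp
  have finD: "finite ?D"
  proof (rule finite_subset[OF _ finite_site_mass], rule subsetI)
    fix x assume "x \<in> ?D"
    then have "Suc M \<le> site_mass lam x" by (rule D)
    then show "x \<in> {x. site_mass lam x \<noteq> 0}" by simp
  qed
  have finA: "finite ?A" using assms by (intro finite_subset[OF _ finite_site_mass]) auto
  have finB: "finite ?B" using assms by (intro finite_subset[OF _ finite_short_mass[of M]]) auto
  have "card ?A \<le> card (?B \<union> ?D)" using finB finD by (intro card_mono) auto
  then have 1: "card ?A \<le> card ?B + card ?D" using card_Un_le[of ?B ?D] by linarith
  have "card ?B \<le> card (?A \<union> ?D)" using finA finD by (intro card_mono) auto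
  then have 2: "card ?B \<le> card ?A + card ?D" using card_Un_le[of ?A ?D] by linarith
  have "card ?D * Suc M \<le> n" using finD D by (rule card_heavy_sites)
  then have "real (card ?D) * real (M + 1) \<le> real n"
    unfolding of_nat_mult[symmetric] of_nat_le_iff by simp
  then have "real (card ?D) \<le> real n / real (M + 1)" by (simp add: pos_le_divide_eq)
  then show ?thesis using 1 2 unfolding site_count_def by linarith
qed

lemma finite_heavy: "finite {x. K < site_mass lam x}"
  by (rule finite_subset[OF _ finite_site_mass]) auto

lemma heavy_subset_occupied: "{x. K < site_mass lam x} \<subseteq> occupied lam"
  using not_occupied(1)[of _ lam] by force

text \<open>The parts of a light site are all short, so light sites contribute to the short mass only.\<close>

lemma long_le_heavy: "long_part_mass K lam \<le> heavy_site_mass K lam"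
proof -
  let ?H = "{x. K < site_mass lam x}"
  have "n = (\<Sum>x\<in>?H. site_mass lam x) + (\<Sum>x\<in>occupied lam - ?H. site_mass lam x)"
    using sum.subset_diff[OF heavy_subset_occupied finite_occupied, of "site_mass lam" K]
    by (simp add: total_site_mass)
  also have "(\<Sum>x\<in>occupied lam - ?H. site_mass lam x) = (\<Sum>x\<in>occupied lam - ?H. short_mass K lam x)"
    using short_mass_ne_site_mass[of K] by (intro sum.cong) (auto intro: ccontr)
  also have "\<dots> \<le> (\<Sum>x\<in>occupied lam. short_mass K lam x)"
    using finite_occupied by (intro sum_mono2) auto
  finally show ?thesis
    using long_part_mass_eq_short_mass[of K] by (simp add: heavy_site_mass_def)
qed

text \<open>On a heavy site, split off the long parts, and the short parts if their mass exceeds \<open>B\<close>. What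
  remains is at most \<open>B\<close> per heavy site, and there are at most \<open>n / K\<close> heavy sites.\<close>

lemma heavy_le_long:
  assumes "1 \<le> K"
  shows "real (heavy_site_mass K lam) \<le> real (long_part_mass M lam)
    + (\<Sum>k=B+1..n. real k * real (card {x. short_mass M lam x = k})) + real B * real n / real K"
proof -
  let ?H = "{x. K < site_mass lam x}"
  let ?T = "{x. B < short_mass M lam x \<and> short_mass M lam x \<le> n}"
  have short_le: "short_mass M lam x \<le> site_mass lam x" for x by (rule short_mass_le_site_mass)
  have le_n: "short_mass M lam x \<le> n" for x
    using order_trans[OF short_le site_mass_le[OF lam]] .
  have finT: "finite ?T" by (rule finite_subset[OF _ finite_short_mass[of M]]) auto
  have "heavy_site_mass K lam = (\<Sum>x\<in>?H. (site_mass lam x - short_mass M lam x) + short_mass M lam x)"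
    unfolding heavy_site_mass_def using short_le by (intro sum.cong) auto
  also have "\<dots> = (\<Sum>x\<in>?H. site_mass lam x - short_mass M lam x) + (\<Sum>x\<in>?H. short_mass M lam x)"
    by (rule sum.distrib)
  also have "(\<Sum>x\<in>?H. site_mass lam x - short_mass M lam x) \<le> (\<Sum>x\<in>occupied lam. site_mass lam x - short_mass M lam x)"
    using finite_occupied heavy_subset_occupied by (intro sum_mono2) auto
  also have "\<dots> = long_part_mass M lam"
  proof -
    have "(\<Sum>x\<in>occupied lam. site_mass lam x - short_mass M lam x) + (\<Sum>x\<in>occupied lam. short_mass M lam x) = n"
      using short_le by (simp add: sum.distrib[symmetric] total_site_mass)
    then show ?thesis using long_part_mass_eq_short_mass[of M] by linarith
  qed
  also have "(\<Sum>x\<in>?H. short_mass M lam x) \<le> (\<Sum>x\<in>?H. B) + (\<Sum>x\<in>?T. short_mass M lam x)"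
  proof -
    have "(\<Sum>x\<in>?H. short_mass M lam x) \<le> (\<Sum>x\<in>?H. B + (if x \<in> ?T then short_mass M lam x else 0))"
      using le_n by (intro sum_mono) auto
    also have "\<dots> = (\<Sum>x\<in>?H. B) + (\<Sum>x\<in>?H. if x \<in> ?T then short_mass M lam x else 0)"
      by (rule sum.distrib)
    also have "(\<Sum>x\<in>?H. if x \<in> ?T then short_mass M lam x else 0) = (\<Sum>x\<in>?H \<inter> ?T. short_mass M lam x)"
      by (rule sum.inter_restrict[OF finite_heavy, symmetric])
    also have "\<dots> \<le> (\<Sum>x\<in>?T. short_mass M lam x)"
      using finT by (intro sum_mono2) auto
    finally show ?thesis by simp
  qed
  also have "(\<Sum>x\<in>?T. short_mass M lam x) = (\<Sum>k=B+1..n. k * card {x. short_mass M lam x = k})"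
    by (rule sum_by_value[OF finite_short_mass])
  finally have "heavy_site_mass K lam \<le> long_part_mass M lam
      + (card ?H * B + (\<Sum>k=B+1..n. k * card {x. short_mass M lam x = k}))" by simp
  then have "real (heavy_site_mass K lam) \<le> real (long_part_mass M lam
      + (card ?H * B + (\<Sum>k=B+1..n. k * card {x. short_mass M lam x = k})))"
    by (rule of_nat_mono)
  moreover have "real (card ?H) * real B \<le> real B * real n / real K"
  proof -
    have "card ?H * K \<le> n" by (rule card_heavy_sites[OF finite_heavy]) auto
    then have "real (card ?H) * real K \<le> real n"
      unfolding of_nat_mult[symmetric] of_nat_le_iff .
    then have "real (card ?H) \<le> real n / real K" using assms by (simp add: pos_le_divide_eq)
    then have "real B * real (card ?H) \<le> real B * (real n / real K)" by (rule mult_left_mono) simp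
    then show ?thesis by (simp add: mult.commute)
  qed
  ultimately show ?thesis by simp
qed

end

section \<open>The Gibbs measure in a fixed volume\<close>

text \<open>A fixed volume. Positivity of \<open>\<theta> 1\<close> and of the Boltzmann factor at the origin makes all partition
  functions positive, and the finite sum over sites makes them finite.\<close>

locale spatial_gibbs =
  fixes \<theta> :: "nat \<Rightarrow> real" and V :: "real ^ 'd::finite \<Rightarrow> ennreal" and L :: real
  assumes theta_nonneg: "\<And>j. j \<ge> 1 \<Longrightarrow> 0 \<le> \<theta> j"
    and theta_1_pos: "0 < \<theta> 1"
    and site_sum_finite: "(\<integral>\<^sup>+x. ennreal (exp_neg (V (scaled_site L x))) \<partial>count_space UNIV) < \<infinity>"
    and V_zero: "V 0 = 0"
begin

abbreviation u :: "int ^ 'd \<Rightarrow> real" where "u \<equiv> boltzmann_factor V L"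

abbreviation site_sum :: "nat \<Rightarrow> real" where "site_sum \<equiv> boltzmann_sum V L"

abbreviation part_weight :: "nat \<Rightarrow> real" where "part_weight \<equiv> part_activity \<theta> V L"

abbreviation Z :: "nat \<Rightarrow> real" where "Z \<equiv> exp_coeff part_weight"

text \<open>The unnormalised expectation. It takes values in \<open>[0, \<infinity>]\<close> so that sums over sites and partitions
  may be exchanged freely.\<close>

definition wsum :: "nat \<Rightarrow> ('d spatial_partition \<Rightarrow> ennreal) \<Rightarrow> ennreal" where
  "wsum n F = (\<integral>\<^sup>+lam. ennreal (partition_weight \<theta> V L lam) * F lam \<partial>count_space (spatial_partitions n))"

lemma u_bounds: "0 \<le> u x" "u x \<le> 1"
  by (auto simp: boltzmann_factor_def exp_neg_bounds)

lemma u_integrable: "1 \<le> j \<Longrightarrow> integrable (count_space UNIV) (\<lambda>x. u x ^ j)"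
proof (rule Bochner_Integration.integrable_bound)
  show "integrable (count_space UNIV) u"
    using site_sum_finite u_bounds by (intro integrableI_nonneg) (auto simp: boltzmann_factor_def)
  assume "1 \<le> j"
  then have "u x ^ j \<le> u x" for x
    using power_decreasing[of 1 j "u x"] u_bounds by simp
  then show "AE x in count_space UNIV. norm (u x ^ j) \<le> norm (u x)"
    using u_bounds by (simp add: AE_count_space)
qed simp

lemma nn_site_sum: "1 \<le> j \<Longrightarrow> (\<integral>\<^sup>+x. ennreal (u x ^ j) \<partial>count_space UNIV) = ennreal (site_sum j)"
  unfolding boltzmann_sum_def using u_bounds
  by (intro nn_integral_eq_integral u_integrable) (auto simp: AE_count_space)

lemma site_sum_nonneg: "0 \<le> site_sum j"
  unfolding boltzmann_sum_def using u_bounds by (intro Bochner_Integration.integral_nonneg) auto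

lemma site_sum_antimono: "1 \<le> i \<Longrightarrow> i \<le> j \<Longrightarrow> site_sum j \<le> site_sum i"
  unfolding boltzmann_sum_def using u_bounds
  by (intro Bochner_Integration.integral_mono u_integrable power_decreasing) auto

lemma site_sum_1_pos: "0 < site_sum 1"
proof -
  have "u 0 = 1"
  proof -
    have "scaled_site L (0 :: int ^ 'd) = 0" by (simp add: scaled_site_def vec_eq_iff)
    then show ?thesis by (simp add: boltzmann_factor_def exp_neg_def V_zero)
  qed
  then have "1 \<le> (\<integral>\<^sup>+x. ennreal (u x ^ 1) \<partial>count_space UNIV)"
    using nn_integral_ge_point[of 0 UNIV "\<lambda>x. ennreal (u x ^ 1)"] by simp
  then have "ennreal 1 \<le> ennreal (site_sum 1)" by (subst (asm) nn_site_sum) auto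
  then show ?thesis using site_sum_nonneg[of 1] by (subst (asm) ennreal_le_iff) auto
qed

lemma part_weight_nonneg: "1 \<le> j \<Longrightarrow> 0 \<le> part_weight j"
  using theta_nonneg site_sum_nonneg by (simp add: part_activity_def)

lemma part_weight_1_pos: "0 < part_weight 1"
  using theta_1_pos site_sum_1_pos by (simp add: part_activity_def)

lemma Z_pos: "0 < Z n"
  using part_weight_nonneg part_weight_1_pos by (rule exp_coeff_pos)

text \<open>Inserting a part of size one shows that each single ratio is at most \<open>n / a\<^sub>1\<close>.\<close>

lemma Z_ratio_le:
  assumes "1 \<le> n" "m \<le> k" "k \<le> n" "real n \<le> C * part_weight 1" "0 \<le> C"
  shows "Z (k - m) \<le> C ^ m * Z k"
  using assms(2)
proof (induction m)
  case (Suc m)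
  have "part_weight 1 * Z (k - m - 1) \<le> real (k - m) * Z (k - m)"
    using Suc by (intro exp_coeff_step_le part_weight_nonneg) auto
  also have "\<dots> \<le> C * part_weight 1 * Z (k - m)"
    using assms Z_pos[of "k - m"] by (intro mult_right_mono) auto
  finally have "part_weight 1 * Z (k - Suc m) \<le> part_weight 1 * (C * Z (k - m))"
    by (simp add: mult_ac)
  then have "Z (k - Suc m) \<le> C * Z (k - m)" using part_weight_1_pos by simp
  also have "\<dots> \<le> C * (C ^ m * Z k)" using Suc assms by (intro mult_left_mono) auto
  finally show ?case by (simp add: mult_ac)
qed simp

lemma wsum_cong: "(\<And>lam. lam \<in> spatial_partitions n \<Longrightarrow> F lam = F' lam) \<Longrightarrow> wsum n F = wsum n F'"
  unfolding wsum_def by (intro nn_integral_cong) auto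

lemma wsum_mono: "(\<And>lam. lam \<in> spatial_partitions n \<Longrightarrow> F lam \<le> F' lam) \<Longrightarrow> wsum n F \<le> wsum n F'"
  unfolding wsum_def by (intro nn_integral_mono mult_left_mono) auto

lemma wsum_cmult: "wsum n (\<lambda>lam. c * F lam) = c * wsum n F"
  unfolding wsum_def by (subst nn_integral_cmult[symmetric]) (auto simp: mult_ac)

lemma wsum_sum: "finite I \<Longrightarrow> wsum n (\<lambda>lam. \<Sum>i\<in>I. F i lam) = (\<Sum>i\<in>I. wsum n (F i))"
  unfolding wsum_def by (subst nn_integral_sum[symmetric]) (auto simp: sum_distrib_left)

lemma wsum_zero: "(\<And>lam. lam \<in> spatial_partitions n \<Longrightarrow> F lam = 0) \<Longrightarrow> wsum n F = 0"
  unfolding wsum_def by (subst nn_integral_0_iff_AE) (auto simp: AE_count_space)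

lemma wsum_sites:
  "wsum n (\<lambda>lam. \<integral>\<^sup>+x. F x lam \<partial>count_space (UNIV :: (int ^ 'd) set)) = (\<integral>\<^sup>+x. wsum n (F x) \<partial>count_space UNIV)"
  unfolding wsum_def
  by (subst nn_integral_count_space_nn_integral[symmetric]) (auto simp: nn_integral_cmult)

text \<open>The identity on which all computations rest: marking one of the parts \<open>j\<close> at \<open>x\<close> and deleting it
  is a bijection onto the partitions of \<open>n - j\<close>, and the weights \<open>1 / r!\<close> are such that the number
  of choices cancels. In probabilistic terms it is the Mecke equation of a Poisson process.\<close>

lemma wsum_remove_part:
  assumes "1 \<le> j" "j \<le> n"
  shows "wsum n (\<lambda>lam. of_nat (part_count lam x j) * F lam)
    = ennreal (\<theta> j / real j * u x ^ j) * wsum (n - j) (\<lambda>lam. F (insert_part x j lam))"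
proof -
  let ?W = "partition_weight \<theta> V L"
  define m where "m = n - j"
  have n: "n = m + j" using assms by (simp add: m_def)
  let ?g = "\<lambda>lam. ennreal (?W lam) * (of_nat (part_count lam x j) * F lam)"
  have "wsum n (\<lambda>lam. of_nat (part_count lam x j) * F lam)
      = (\<integral>\<^sup>+lam. ?g lam \<partial>count_space {lam \<in> spatial_partitions (m + j). j \<in># lam x})"
    unfolding wsum_def n by (intro nn_integral_count_space_eq) (auto simp: set_mset_part_count)
  also have "\<dots> = (\<integral>\<^sup>+lam. ?g (insert_part x j lam) \<partial>count_space (spatial_partitions m))"
    by (rule nn_integral_bij_count_space[OF insert_part_bij[OF assms(1)], symmetric])
  also have "\<dots> = (\<integral>\<^sup>+lam. ennreal (\<theta> j / real j * u x ^ j) * (ennreal (?W lam) * F (insert_part x j lam))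
      \<partial>count_space (spatial_partitions m))"
  proof (rule nn_integral_cong)
    fix lam :: "'d spatial_partition" assume "lam \<in> space (count_space (spatial_partitions m))"
    then have lam: "lam \<in> spatial_partitions m" by simp
    have ins: "insert_part x j lam \<in> spatial_partitions (m + j)"
      using lam assms by (simp add: insert_part_mem_iff)
    have "ennreal (?W (insert_part x j lam)) * of_nat (part_count (insert_part x j lam) x j)
        = ennreal (real (part_count lam x j + 1) * ?W (insert_part x j lam))"
      using partition_weight_nonneg[OF theta_nonneg ins]
      by (simp add: part_count_insert ennreal_of_nat_eq_real_of_nat ennreal_mult mult.commute)
    also have "\<dots> = ennreal (\<theta> j / real j * u x ^ j * ?W lam)"
      using lam by (subst partition_weight_insert) (auto simp: spatial_partitions_iff exp_neg_of_nat_mult boltzmann_factor_def)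
    also have "\<dots> = ennreal (\<theta> j / real j * u x ^ j) * ennreal (?W lam)"
      using partition_weight_nonneg[OF theta_nonneg lam] by (intro ennreal_mult'') auto
    finally show "?g (insert_part x j lam)
        = ennreal (\<theta> j / real j * u x ^ j) * (ennreal (?W lam) * F (insert_part x j lam))"
      by (simp only: mult.assoc[symmetric])
  qed
  also have "\<dots> = ennreal (\<theta> j / real j * u x ^ j) * wsum m (\<lambda>lam. F (insert_part x j lam))"
    unfolding wsum_def by (rule nn_integral_cmult) simp
  finally show ?thesis by (simp add: m_def)
qed

lemma wsum_remove_part_zero:
  assumes "n < j"
  shows "wsum n (\<lambda>lam. of_nat (part_count lam x j) * F lam) = 0"
proof (rule wsum_zero)
  fix lam :: "'d spatial_partition" assume "lam \<in> spatial_partitions n"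
  then have "part_count lam x j = 0"
    using spatial_partitions_part_bounds(2)[of lam n x j] assms by linarith
  then show "of_nat (part_count lam x j) * F lam = 0" by simp
qed

lemma nn_part_count:
  assumes "lam \<in> spatial_partitions n"
  shows "(\<integral>\<^sup>+x. of_nat (part_count lam x j) \<partial>count_space UNIV) = (of_nat (total_count lam j) :: ennreal)"
proof -
  have "(\<integral>\<^sup>+x. of_nat (part_count lam x j) \<partial>count_space UNIV)
      = (\<Sum>x\<in>occupied lam. of_nat (part_count lam x j) :: ennreal)"
    using assms by (intro nn_integral_count_space') (auto simp: not_occupied spatial_partitions_iff)
  then show ?thesis using assms by (simp add: total_count_eq spatial_partitions_iff)
qed

lemma wsum_total_count:
  assumes "1 \<le> j" "j \<le> n"
  shows "wsum n (\<lambda>lam. of_nat (total_count lam j)) = ennreal (part_weight j / real j) * wsum (n - j) (\<lambda>_. 1)"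
proof -
  have "wsum n (\<lambda>lam. of_nat (total_count lam j))
      = wsum n (\<lambda>lam. \<integral>\<^sup>+x. of_nat (part_count lam x j) * 1 \<partial>count_space UNIV)"
    by (rule wsum_cong) (simp add: nn_part_count)
  also have "\<dots> = (\<integral>\<^sup>+x. ennreal (\<theta> j / real j * u x ^ j) * wsum (n - j) (\<lambda>_. 1) \<partial>count_space UNIV)"
    unfolding wsum_sites using assms by (simp only: wsum_remove_part)
  also have "\<dots> = (\<integral>\<^sup>+x. ennreal (\<theta> j / real j) * ennreal (u x ^ j) \<partial>count_space UNIV) * wsum (n - j) (\<lambda>_. 1)"
    using u_bounds theta_nonneg[OF assms(1)]
    by (subst nn_integral_multc[symmetric]) (auto simp: ennreal_mult[symmetric])
  also have "(\<integral>\<^sup>+x. ennreal (\<theta> j / real j) * ennreal (u x ^ j) \<partial>count_space UNIV) = ennreal (part_weight j / real j)"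
    using assms theta_nonneg[OF assms(1)] site_sum_nonneg
    by (subst nn_integral_cmult) (auto simp: nn_site_sum part_activity_def ennreal_mult[symmetric])
  finally show ?thesis .
qed

lemma spatial_partitions_0: "spatial_partitions 0 = {\<lambda>_ :: int ^ 'd. {#}}"
proof -
  have "lam x = {#}" if lam: "lam \<in> spatial_partitions 0" for lam :: "'d spatial_partition" and x
  proof (rule ccontr)
    assume "lam x \<noteq> {#}"
    then obtain j where "j \<in># lam x" by blast
    then show False
      using spatial_partitions_part_bounds[OF lam, of x j] by (simp add: set_mset_part_count)
  qed
  moreover have "(\<lambda>_. {#}) \<in> spatial_partitions 0"
    by (simp add: spatial_partitions_iff occupied_def)
  ultimately show ?thesis by fastforce
qed

text \<open>Taking the expectation of \<open>n = \<Sum>j. j R\<^sub>j\<close> gives the recursion of exponential coefficients.\<close>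

lemma wsum_1: "wsum n (\<lambda>_. 1) = ennreal (Z n)"
proof (induction n rule: less_induct)
  case (less n)
  show ?case
  proof (cases "n = 0")
    case True
    have "partition_weight \<theta> V L (\<lambda>_. {#}) = 1"
      by (simp add: partition_weight_def part_count_def)
    then show ?thesis using True by (simp add: wsum_def spatial_partitions_0 nn_integral_count_space_finite)
  next
    case False
    have Zn: "0 \<le> Z k" for k using Z_pos less_imp_le by blast
    have "of_nat n * wsum n (\<lambda>_. 1) = wsum n (\<lambda>lam. \<Sum>j=1..n. of_nat j * of_nat (total_count lam j))"
      unfolding wsum_cmult[symmetric]
    proof (rule wsum_cong)
      fix lam :: "'d spatial_partition" assume "lam \<in> spatial_partitions n"
      then show "of_nat n * 1 = (\<Sum>j=1..n. of_nat j * of_nat (total_count lam j) :: ennreal)"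
        using arg_cong[OF mass_eq_total_counts, of lam n "of_nat :: nat \<Rightarrow> ennreal"] by simp
    qed
    also have "\<dots> = (\<Sum>j=1..n. of_nat j * (ennreal (part_weight j / real j) * ennreal (Z (n - j))))"
      unfolding wsum_sum[OF finite_atLeastAtMost] wsum_cmult
      using less by (intro sum.cong) (auto simp: wsum_total_count)
    also have "\<dots> = (\<Sum>j=1..n. ennreal (part_weight j * Z (n - j)))"
      using part_weight_nonneg Zn
      by (intro sum.cong) (auto simp: ennreal_of_nat_eq_real_of_nat ennreal_mult[symmetric])
    also have "\<dots> = ennreal (real n * Z n)"
      using part_weight_nonneg Zn by (subst sum_ennreal) (auto simp: exp_coeff_rec)
    also have "\<dots> = of_nat n * ennreal (Z n)"
      using Zn by (simp add: ennreal_mult ennreal_of_nat_eq_real_of_nat)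
    finally show ?thesis using False by (simp add: ennreal_mult_cancel_left)
  qed
qed

end

context spatial_gibbs
begin

abbreviation h :: "nat \<Rightarrow> nat \<Rightarrow> real" where "h M \<equiv> exp_coeff (short_theta \<theta> M)"

abbreviation c :: "nat \<Rightarrow> nat \<Rightarrow> real" where "c M \<equiv> exp_coeff (\<lambda>j. - short_theta \<theta> M j)"

definition site_wsum :: "nat \<Rightarrow> int ^ 'd \<Rightarrow> nat \<Rightarrow> nat \<Rightarrow> ennreal" where
  "site_wsum M x n k = wsum n (\<lambda>lam. of_bool (short_mass M lam x = k))"

lemma short_theta_nonneg: "1 \<le> j \<Longrightarrow> 0 \<le> short_theta \<theta> M j"
  using theta_nonneg by (simp add: short_theta_def)

lemma h_nonneg: "0 \<le> h M k"
  using short_theta_nonneg by (rule exp_coeff_nonneg)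

lemma site_wsum_term:
  assumes "1 \<le> j" "k \<le> n"
  shows "of_nat j * wsum n (\<lambda>lam. of_nat (part_count lam x j) * of_bool (short_mass M lam x = k))
    = (if j \<le> M then (if j \<le> k then ennreal (\<theta> j * u x ^ j) * site_wsum M x (n - j) (k - j) else 0)
       else of_nat j * wsum n (\<lambda>lam. of_nat (part_count lam x j) * of_bool (short_mass M lam x = k)))"
proof (cases "j \<le> M")
  case jM: True
  show ?thesis
  proof (cases "j \<le> n")
    case True
    have "wsum n (\<lambda>lam. of_nat (part_count lam x j) * of_bool (short_mass M lam x = k))
      = ennreal (\<theta> j / real j * u x ^ j) * wsum (n - j) (\<lambda>lam. of_bool (short_mass M (insert_part x j lam) x = k))"
      using assms True by (intro wsum_remove_part)
    also have "\<dots> = ennreal (\<theta> j / real j * u x ^ j) * (if j \<le> k then site_wsum M x (n - j) (k - j) else 0)"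
    proof (cases "j \<le> k")
      case True
      then have "(short_mass M (insert_part x j lam) x = k) = (short_mass M lam x = k - j)" for lam
        using assms jM by (auto simp: short_mass_insert)
      then show ?thesis using True by (simp add: site_wsum_def)
    next
      case False
      then have "wsum (n - j) (\<lambda>lam. of_bool (short_mass M (insert_part x j lam) x = k)) = 0"
        using assms jM by (intro wsum_zero) (auto simp: short_mass_insert)
      then show ?thesis using False by simp
    qed
    finally have "of_nat j * wsum n (\<lambda>lam. of_nat (part_count lam x j) * of_bool (short_mass M lam x = k))
      = (of_nat j * ennreal (\<theta> j / real j * u x ^ j)) * (if j \<le> k then site_wsum M x (n - j) (k - j) else 0)"
      by (simp only: mult.assoc)
    also have "of_nat j * ennreal (\<theta> j / real j * u x ^ j) = ennreal (\<theta> j * u x ^ j)"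
      using assms theta_nonneg[OF assms(1)] u_bounds
      by (simp add: ennreal_of_nat_eq_real_of_nat ennreal_mult[symmetric])
    finally show ?thesis using jM by simp
  next
    case False
    then show ?thesis using assms by (simp add: wsum_remove_part_zero)
  qed
qed simp

lemma site_wsum_rec:
  assumes "k \<le> n"
  shows "of_nat k * site_wsum M x n k
    = (\<Sum>j=1..k. ennreal (short_theta \<theta> M j * u x ^ j) * site_wsum M x (n - j) (k - j))"
proof -
  have "of_nat k * site_wsum M x n k
      = wsum n (\<lambda>lam. \<Sum>j=1..M. of_nat j * (of_nat (part_count lam x j) * of_bool (short_mass M lam x = k)))"
    unfolding site_wsum_def wsum_cmult[symmetric]
  proof (rule wsum_cong)
    fix lam :: "'d spatial_partition"
    have "of_nat k * of_bool (short_mass M lam x = k)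
        = (of_nat (short_mass M lam x) * of_bool (short_mass M lam x = k) :: ennreal)" by auto
    also have "\<dots> = (\<Sum>j=1..M. of_nat j * (of_nat (part_count lam x j) * of_bool (short_mass M lam x = k)))"
      unfolding short_mass_def by (simp add: sum_distrib_right mult.assoc)
    finally show "of_nat k * of_bool (short_mass M lam x = k) = \<dots>" .
  qed
  also have "\<dots> = (\<Sum>j=1..M. of_nat j * wsum n (\<lambda>lam. of_nat (part_count lam x j) * of_bool (short_mass M lam x = k)))"
    by (simp only: wsum_sum[OF finite_atLeastAtMost] wsum_cmult)
  also have "\<dots> = (\<Sum>j=1..M. if j \<le> k then ennreal (\<theta> j * u x ^ j) * site_wsum M x (n - j) (k - j) else 0)"
  proof (rule sum.cong[OF refl])
    fix j assume "j \<in> {1..M}"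
    then show "of_nat j * wsum n (\<lambda>lam. of_nat (part_count lam x j) * of_bool (short_mass M lam x = k))
      = (if j \<le> k then ennreal (\<theta> j * u x ^ j) * site_wsum M x (n - j) (k - j) else 0)"
      using site_wsum_term[OF _ assms, of j x M] by simp
  qed
  also have "\<dots> = (\<Sum>j\<in>{1..M} \<inter> {1..k}. ennreal (\<theta> j * u x ^ j) * site_wsum M x (n - j) (k - j))"
    by (intro sum.mono_neutral_cong_right) auto
  also have "\<dots> = (\<Sum>j=1..k. ennreal (short_theta \<theta> M j * u x ^ j) * site_wsum M x (n - j) (k - j))"
    by (intro sum.mono_neutral_cong_left) (auto simp: short_theta_def)
  finally show ?thesis .
qed

text \<open>Short parts at \<open>x\<close> are independent of everything else, apart from the mass they use up: deleting
  them one after the other produces the coefficient of the local generating function.\<close>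

lemma site_wsum_factor:
  "k \<le> n \<Longrightarrow> site_wsum M x n k = ennreal (h M k * u x ^ k) * site_wsum M x (n - k) 0"
proof (induction k arbitrary: n rule: less_induct)
  case (less k)
  show ?case
  proof (cases "k = 0")
    case False
    have hu: "0 \<le> h M i * u x ^ i" for i using h_nonneg u_bounds by simp
    have "of_nat k * site_wsum M x n k
        = (\<Sum>j=1..k. ennreal (short_theta \<theta> M j * u x ^ j) * site_wsum M x (n - j) (k - j))"
      by (rule site_wsum_rec[OF less.prems])
    also have "\<dots> = (\<Sum>j=1..k. ennreal (short_theta \<theta> M j * u x ^ j * (h M (k - j) * u x ^ (k - j)))
        * site_wsum M x (n - k) 0)"
    proof (rule sum.cong[OF refl])
      fix j assume j: "j \<in> {1..k}"
      have "site_wsum M x (n - j) (k - j)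
          = ennreal (h M (k - j) * u x ^ (k - j)) * site_wsum M x (n - j - (k - j)) 0"
        using j less.prems by (intro less.IH) auto
      moreover have "n - j - (k - j) = n - k" using j less.prems by auto
      moreover have "ennreal (short_theta \<theta> M j * u x ^ j * (h M (k - j) * u x ^ (k - j)))
          = ennreal (short_theta \<theta> M j * u x ^ j) * ennreal (h M (k - j) * u x ^ (k - j))"
        using hu by (rule ennreal_mult'')
      ultimately show "ennreal (short_theta \<theta> M j * u x ^ j) * site_wsum M x (n - j) (k - j)
          = ennreal (short_theta \<theta> M j * u x ^ j * (h M (k - j) * u x ^ (k - j))) * site_wsum M x (n - k) 0"
        by (simp only: mult.assoc)
    qed
    also have "\<dots> = ennreal (\<Sum>j=1..k. short_theta \<theta> M j * u x ^ j * (h M (k - j) * u x ^ (k - j)))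
        * site_wsum M x (n - k) 0"
      unfolding sum_distrib_right[symmetric] using hu short_theta_nonneg u_bounds
      by (subst sum_ennreal) (auto intro!: mult_nonneg_nonneg)
    also have "(\<Sum>j=1..k. short_theta \<theta> M j * u x ^ j * (h M (k - j) * u x ^ (k - j))) = real k * (h M k * u x ^ k)"
      using exp_coeff_rec[of k "\<lambda>j. short_theta \<theta> M j * u x ^ j"] by (simp only: exp_coeff_scale)
    also have "ennreal (real k * (h M k * u x ^ k)) = of_nat k * ennreal (h M k * u x ^ k)"
      using hu by (simp add: ennreal_mult ennreal_of_nat_eq_real_of_nat)
    finally have "of_nat k * site_wsum M x n k = of_nat k * (ennreal (h M k * u x ^ k) * site_wsum M x (n - k) 0)"
      by (simp only: mult.assoc)
    then show ?thesis using False by (simp add: ennreal_mult_cancel_left)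
  qed simp
qed

text \<open>Taken as a real number, because its expansion in partition functions has signed coefficients.\<close>

definition empty_wsum :: "nat \<Rightarrow> int ^ 'd \<Rightarrow> nat \<Rightarrow> real" where
  "empty_wsum M x n = enn2real (site_wsum M x n 0)"

lemma site_wsum_le: "site_wsum M x n k \<le> ennreal (Z n)"
  unfolding site_wsum_def wsum_1[symmetric] by (rule wsum_mono) auto

lemma site_wsum_0: "site_wsum M x n 0 = ennreal (empty_wsum M x n)"
proof -
  have "site_wsum M x n 0 < \<top>"
    using le_less_trans[OF site_wsum_le ennreal_less_top] .
  then show ?thesis by (simp add: empty_wsum_def)
qed

lemma empty_wsum_bounds: "0 \<le> empty_wsum M x n" "empty_wsum M x n \<le> Z n"
proof -
  show "0 \<le> empty_wsum M x n" by (simp add: empty_wsum_def)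
  show "empty_wsum M x n \<le> Z n"
    using site_wsum_le[of M x n 0] Z_pos[of n] by (simp add: site_wsum_0)
qed

lemma Z_site_decomposition: "Z n = (\<Sum>k\<le>n. h M k * u x ^ k * empty_wsum M x (n - k))"
proof -
  have "ennreal (Z n) = wsum n (\<lambda>lam. \<Sum>k\<le>n. of_bool (short_mass M lam x = k))"
    unfolding wsum_1[symmetric]
  proof (rule wsum_cong)
    fix lam :: "'d spatial_partition" assume "lam \<in> spatial_partitions n"
    then have "short_mass M lam x \<le> n"
      using order_trans[OF short_mass_le_site_mass site_mass_le] by blast
    then show "1 = (\<Sum>k\<le>n. of_bool (short_mass M lam x = k) :: ennreal)"
      by (simp add: of_bool_def)
  qed
  also have "\<dots> = (\<Sum>k\<le>n. ennreal (h M k * u x ^ k * empty_wsum M x (n - k)))"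
    unfolding wsum_sum[OF finite_atMost]
  proof (rule sum.cong[OF refl])
    fix k assume "k \<in> {..n}"
    then have "site_wsum M x n k = ennreal (h M k * u x ^ k) * ennreal (empty_wsum M x (n - k))"
      using site_wsum_factor[of k n M x] by (simp add: site_wsum_0)
    then show "wsum n (\<lambda>lam. of_bool (short_mass M lam x = k)) = ennreal (h M k * u x ^ k * empty_wsum M x (n - k))"
      using empty_wsum_bounds by (simp add: site_wsum_def ennreal_mult'')
  qed
  also have "\<dots> = ennreal (\<Sum>k\<le>n. h M k * u x ^ k * empty_wsum M x (n - k))"
    using empty_wsum_bounds h_nonneg u_bounds by (intro sum_ennreal) simp
  finally show ?thesis
    using Z_pos[of n] empty_wsum_bounds h_nonneg u_bounds
    by (subst (asm) ennreal_inj) (auto intro!: sum_nonneg)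
qed

text \<open>The local generating function has an inverse, whose coefficients are signed. As it involves only
  finitely many part sizes, its exponent is a polynomial and the inverse is entire. Therefore this
  sum remains absolutely convergent in the limit, also at the critical fugacity, where the
  corresponding sum with all part sizes may diverge.\<close>

lemma empty_wsum_eq: "empty_wsum M x n = (\<Sum>i\<le>n. c M i * u x ^ i * Z (n - i))"
proof -
  have "empty_wsum M x n = (\<Sum>i\<le>n. exp_coeff (\<lambda>j. - (short_theta \<theta> M j * u x ^ j)) i * Z (n - i))"
    by (rule exp_coeff_deconvolution) (simp only: exp_coeff_scale, rule Z_site_decomposition)
  then show ?thesis
    using exp_coeff_scale[of "\<lambda>j. - short_theta \<theta> M j" "u x"] by simp
qed

definition short_site_count :: "nat \<Rightarrow> nat \<Rightarrow> 'd spatial_partition \<Rightarrow> nat" where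
  "short_site_count M k lam = card {x. short_mass M lam x = k}"

text \<open>The formula is used for the limit; the upper bound, which drops the condition that \<open>x\<close> contains no
  further short parts, is used to control the tail in \<open>k\<close>.\<close>

lemma wsum_short_site_count:
  fixes M k n :: nat
  assumes k: "1 \<le> k" "k \<le> n"
  defines "S \<equiv> h M k * (\<Sum>i\<le>n - k. c M i * site_sum (k + i) * Z (n - k - i))"
  shows "wsum n (\<lambda>lam. of_nat (short_site_count M k lam)) = ennreal S"
    and "0 \<le> S" "S \<le> h M k * site_sum k * Z (n - k)"
proof -
  let ?g = "\<lambda>x. h M k * u x ^ k * empty_wsum M x (n - k)"
  have g: "?g x = (\<Sum>i\<le>n - k. h M k * c M i * Z (n - k - i) * u x ^ (k + i))" for x
    by (simp add: empty_wsum_eq sum_distrib_left power_add mult_ac)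
  have int: "integrable (count_space UNIV) ?g"
    unfolding g using k by (intro Bochner_Integration.integrable_sum integrable_mult_right u_integrable) auto
  have g0: "0 \<le> ?g x" for x using h_nonneg u_bounds empty_wsum_bounds by simp
  have S: "(\<integral>x. ?g x \<partial>count_space UNIV) = S"
    unfolding g using k
    by (subst Bochner_Integration.integral_sum)
      (auto simp: S_def boltzmann_sum_def sum_distrib_left mult_ac intro!: u_integrable sum.cong)
  show "0 \<le> S" unfolding S[symmetric] using g0 by (intro Bochner_Integration.integral_nonneg)
  have "S \<le> (\<integral>x. (h M k * Z (n - k)) * u x ^ k \<partial>count_space UNIV)"
    unfolding S[symmetric]
  proof (rule Bochner_Integration.integral_mono[OF int])
    show "integrable (count_space UNIV) (\<lambda>x. (h M k * Z (n - k)) * u x ^ k)"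
      using k by (intro integrable_mult_right u_integrable)
    show "?g x \<le> (h M k * Z (n - k)) * u x ^ k" for x
      using empty_wsum_bounds(2)[of M x "n - k"] h_nonneg u_bounds
        mult_left_mono[of "empty_wsum M x (n - k)" "Z (n - k)" "h M k * u x ^ k"]
      by (simp add: mult_ac)
  qed
  then show "S \<le> h M k * site_sum k * Z (n - k)"
    by (simp add: boltzmann_sum_def mult_ac)
  have "wsum n (\<lambda>lam. of_nat (short_site_count M k lam))
      = wsum n (\<lambda>lam. \<integral>\<^sup>+x. of_bool (short_mass M lam x = k) \<partial>count_space UNIV)"
  proof (rule wsum_cong)
    fix lam :: "'d spatial_partition" assume lam: "lam \<in> spatial_partitions n"
    let ?A = "{x. short_mass M lam x = k}"
    have "?A \<subseteq> occupied lam" using k not_occupied(3)[of _ lam M] by force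
    then have fin: "finite ?A" using lam finite_subset by (auto simp: spatial_partitions_iff)
    have "(\<integral>\<^sup>+x. of_bool (short_mass M lam x = k) \<partial>count_space UNIV) = (\<Sum>x\<in>?A. of_bool (short_mass M lam x = k) :: ennreal)"
      using fin by (intro nn_integral_count_space') auto
    also have "\<dots> = of_nat (card ?A)" by simp
    finally show "of_nat (short_site_count M k lam)
        = (\<integral>\<^sup>+x. of_bool (short_mass M lam x = k) \<partial>count_space UNIV :: ennreal)"
      by (simp add: short_site_count_def)
  qed
  also have "\<dots> = (\<integral>\<^sup>+x. ennreal (?g x) \<partial>count_space UNIV)"
    unfolding wsum_sites
  proof (rule nn_integral_cong)
    fix x
    show "wsum n (\<lambda>lam. of_bool (short_mass M lam x = k)) = ennreal (?g x)"
      using site_wsum_factor[OF k(2), of M x] empty_wsum_bounds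
      by (simp add: site_wsum_0 site_wsum_def[symmetric] ennreal_mult'')
  qed
  also have "\<dots> = ennreal S"
    unfolding S[symmetric] using g0 by (intro nn_integral_eq_integral int) auto
  finally show "wsum n (\<lambda>lam. of_nat (short_site_count M k lam)) = ennreal S" .
qed

abbreviation G :: "nat \<Rightarrow> 'd spatial_partition measure" where "G n \<equiv> gibbs_measure \<theta> V L n"

lemma partition_function_eq: "partition_function \<theta> V L n = ennreal (Z n)"
  unfolding partition_function_def infsum_eq_nn_integral_count_space wsum_1[symmetric] wsum_def by simp

lemma space_G: "space (G n) = spatial_partitions n" and sets_G: "sets (G n) = Pow (spatial_partitions n)"
  by (simp_all add: gibbs_measure_def)

lemma measurable_G: "f \<in> borel_measurable (G n)"
  by (simp add: gibbs_measure_def)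

lemma nn_integral_G: "(\<integral>\<^sup>+lam. F lam \<partial>G n) = wsum n F / ennreal (Z n)"
proof -
  have "(\<integral>\<^sup>+lam. F lam \<partial>G n)
      = (\<integral>\<^sup>+lam. ennreal (partition_weight \<theta> V L lam) / ennreal (Z n) * F lam \<partial>count_space (spatial_partitions n))"
    unfolding gibbs_measure_def partition_function_eq by (rule nn_integral_density) auto
  also have "\<dots> = (\<integral>\<^sup>+lam. ennreal (partition_weight \<theta> V L lam) * F lam / ennreal (Z n) \<partial>count_space (spatial_partitions n))"
    by (intro nn_integral_cong) (simp add: divide_ennreal_def mult_ac)
  also have "\<dots> = wsum n F / ennreal (Z n)"
    unfolding wsum_def by (rule nn_integral_divide) simp
  finally show ?thesis .
qed

sublocale gibbs: prob_space "G n" for n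
proof
  have "emeasure (G n) (space (G n)) = (\<integral>\<^sup>+lam. 1 \<partial>G n)" by simp
  also have "\<dots> = 1" unfolding nn_integral_G wsum_1 using Z_pos[of n] by (simp add: divide_ennreal)
  finally show "emeasure (G n) (space (G n)) = 1" .
qed

lemma G_integrable:
  assumes "\<And>lam. lam \<in> spatial_partitions n \<Longrightarrow> \<bar>f lam\<bar> \<le> (C :: real)"
  shows "integrable (G n) f"
  by (rule gibbs.integrable_const_bound[of _ C])
    (use assms in \<open>auto intro!: AE_I2 simp: space_G measurable_G\<close>)

lemma G_integral_eq:
  assumes "wsum n (\<lambda>lam. of_nat (f lam)) = ennreal r" "0 \<le> r"
  shows "(\<integral>lam. real (f lam) \<partial>G n) = r / Z n"
proof -
  have "(\<integral>lam. real (f lam) \<partial>G n) = enn2real (\<integral>\<^sup>+lam. ennreal (real (f lam)) \<partial>G n)"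
    by (intro integral_eq_nn_integral) (auto simp: measurable_G)
  also have "(\<integral>\<^sup>+lam. ennreal (real (f lam)) \<partial>G n) = ennreal (r / Z n)"
    unfolding nn_integral_G using assms Z_pos[of n]
    by (simp add: ennreal_of_nat_eq_real_of_nat[symmetric] divide_ennreal)
  finally show ?thesis using assms Z_pos[of n] by simp
qed

end

context spatial_gibbs
begin

definition long_fraction :: "nat \<Rightarrow> nat \<Rightarrow> real" where
  "long_fraction K n = (\<integral>lam. real (long_part_mass K lam) / real n \<partial>G n)"

definition heavy_fraction :: "nat \<Rightarrow> nat \<Rightarrow> real" where
  "heavy_fraction K n = (\<integral>lam. real (heavy_site_mass K lam) / real n \<partial>G n)"

definition short_site_density :: "nat \<Rightarrow> nat \<Rightarrow> nat \<Rightarrow> real" where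
  "short_site_density M n k = (\<integral>lam. real (short_site_count M k lam) \<partial>G n) / real n"

definition site_density :: "nat \<Rightarrow> nat \<Rightarrow> real" where
  "site_density n k = (\<integral>lam. real (site_count k lam) \<partial>G n) / real n"

lemma short_site_density_eq:
  assumes "1 \<le> k" "k \<le> n"
  shows "short_site_density M n k
    = h M k * (\<Sum>i\<le>n - k. c M i * site_sum (k + i) * Z (n - k - i)) / Z n / real n"
    and "0 \<le> short_site_density M n k"
    and "short_site_density M n k \<le> h M k * site_sum k * Z (n - k) / Z n / real n"
  using G_integral_eq[OF wsum_short_site_count(1,2)[OF assms, of M]]
    wsum_short_site_count(2,3)[OF assms, of M] Z_pos[of n]
  by (simp_all add: short_site_density_def divide_right_mono)

lemma G_expectation_total_count:
  assumes "1 \<le> j" "j \<le> n"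
  shows "(\<integral>lam. real (total_count lam j) \<partial>G n) = part_weight j / real j * Z (n - j) / Z n"
proof (rule G_integral_eq)
  show "wsum n (\<lambda>lam. of_nat (total_count lam j)) = ennreal (part_weight j / real j * Z (n - j))"
    unfolding wsum_total_count[OF assms] wsum_1
    by (rule ennreal_mult''[symmetric]) (rule less_imp_le[OF Z_pos])
  show "0 \<le> part_weight j / real j * Z (n - j)"
    using Z_pos[of "n - j"] part_weight_nonneg[OF assms(1)] by simp
qed

lemma total_count_le: "lam \<in> spatial_partitions n \<Longrightarrow> 1 \<le> j \<Longrightarrow> total_count lam j \<le> n"
proof -
  assume lam: "lam \<in> spatial_partitions n" and j: "1 \<le> j"
  have "1 * total_count lam j \<le> j * total_count lam j" using j by (intro mult_right_mono) auto
  also have "\<dots> \<le> (\<Sum>i=1..j. i * total_count lam i)" using j by (intro member_le_sum) auto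
  also have "\<dots> \<le> n" using long_part_mass_eq[OF lam, of j] by linarith
  finally show ?thesis by simp
qed

lemma short_site_count_le: "lam \<in> spatial_partitions n \<Longrightarrow> 1 \<le> k \<Longrightarrow> short_site_count M k lam \<le> n"
proof -
  assume lam: "lam \<in> spatial_partitions n" and k: "1 \<le> k"
  have "finite {x. short_mass M lam x = k}"
    by (rule finite_subset[OF _ finite_short_mass[OF lam, of M]]) (use k in auto)
  then have "card {x. short_mass M lam x = k} * k \<le> n"
  proof (rule card_heavy_sites[OF lam])
    show "k \<le> site_mass lam x" if "x \<in> {x. short_mass M lam x = k}" for x
      using short_mass_le_site_mass[of M lam x] that by simp
  qed
  moreover have "short_site_count M k lam \<le> short_site_count M k lam * k"
    using k by (cases k) auto
  ultimately show ?thesis unfolding short_site_count_def by linarith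
qed

lemma site_count_le: "lam \<in> spatial_partitions n \<Longrightarrow> 1 \<le> k \<Longrightarrow> site_count k lam \<le> n"
proof -
  assume lam: "lam \<in> spatial_partitions n" and k: "1 \<le> k"
  have "finite {x. site_mass lam x = k}"
    by (rule finite_subset[OF _ finite_site_mass[OF lam]]) (use k in auto)
  then have "card {x. site_mass lam x = k} * k \<le> n"
    by (rule card_heavy_sites[OF lam]) auto
  moreover have "site_count k lam \<le> site_count k lam * k"
    using k by (cases k) auto
  ultimately show ?thesis unfolding site_count_def by linarith
qed

lemma heavy_site_mass_le: "lam \<in> spatial_partitions n \<Longrightarrow> heavy_site_mass K lam \<le> n"
  unfolding heavy_site_mass_def by (intro sum_site_mass_le finite_heavy)

lemma long_part_mass_le: "lam \<in> spatial_partitions n \<Longrightarrow> long_part_mass K lam \<le> n"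
  using long_part_mass_eq[of lam n K] by linarith

lemma count_integrable:
  "integrable (G n) (\<lambda>lam. real (long_part_mass K lam))"
  "integrable (G n) (\<lambda>lam. real (heavy_site_mass K lam))"
  "1 \<le> k \<Longrightarrow> integrable (G n) (\<lambda>lam. real (site_count k lam))"
  "1 \<le> k \<Longrightarrow> integrable (G n) (\<lambda>lam. real (short_site_count M k lam))"
  "1 \<le> k \<Longrightarrow> integrable (G n) (\<lambda>lam. real (total_count lam k))"
  by (rule G_integrable[of _ _ "real n"];
      simp add: long_part_mass_le heavy_site_mass_le site_count_le short_site_count_le total_count_le)+

lemma long_fraction_eq:
  assumes "1 \<le> n" "K \<le> n"
  shows "long_fraction K n = 1 - (\<Sum>j=1..K. part_weight j * Z (n - j) / Z n) / real n"
proof -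
  have "(\<integral>lam. real (long_part_mass K lam) \<partial>G n)
      = (\<integral>lam. real n - (\<Sum>j=1..K. real j * real (total_count lam j)) \<partial>G n)"
  proof (rule Bochner_Integration.integral_cong[OF refl])
    fix lam assume "lam \<in> space (G n)"
    then have "lam \<in> spatial_partitions n" by (simp add: space_G)
    from arg_cong[OF long_part_mass_eq[OF this, of K], of real]
    show "real (long_part_mass K lam) = real n - (\<Sum>j=1..K. real j * real (total_count lam j))" by simp
  qed
  also have "\<dots> = real n - (\<Sum>j=1..K. real j * (\<integral>lam. real (total_count lam j) \<partial>G n))"
    by (subst Bochner_Integration.integral_diff)
      (auto intro!: Bochner_Integration.integrable_sum count_integrable integrable_mult_right
        simp: Bochner_Integration.integral_sum count_integrable gibbs.prob_space)
  also have "(\<Sum>j=1..K. real j * (\<integral>lam. real (total_count lam j) \<partial>G n))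
      = (\<Sum>j=1..K. part_weight j * Z (n - j) / Z n)"
    using assms by (intro sum.cong) (auto simp: G_expectation_total_count)
  finally show ?thesis
    using assms by (simp add: long_fraction_def diff_divide_distrib)
qed

lemma heavy_fraction_eq:
  assumes "1 \<le> n" "K \<le> n"
  shows "heavy_fraction K n = 1 - (\<Sum>k=1..K. real k * site_density n k)"
proof -
  have "(\<integral>lam. real (heavy_site_mass K lam) \<partial>G n)
      = (\<integral>lam. real n - (\<Sum>k=1..K. real k * real (site_count k lam)) \<partial>G n)"
  proof (rule Bochner_Integration.integral_cong[OF refl])
    fix lam assume "lam \<in> space (G n)"
    then have "lam \<in> spatial_partitions n" by (simp add: space_G)
    from arg_cong[OF heavy_site_mass_eq[OF this assms(2)], of real]
    show "real (heavy_site_mass K lam) = real n - (\<Sum>k=1..K. real k * real (site_count k lam))" by simp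
  qed
  also have "\<dots> = real n - (\<Sum>k=1..K. real k * (\<integral>lam. real (site_count k lam) \<partial>G n))"
    by (subst Bochner_Integration.integral_diff)
      (auto intro!: Bochner_Integration.integrable_sum count_integrable integrable_mult_right
        simp: Bochner_Integration.integral_sum count_integrable gibbs.prob_space)
  finally show ?thesis
    using assms by (simp add: heavy_fraction_def site_density_def diff_divide_distrib sum_divide_distrib)
qed

lemma site_density_close:
  assumes "1 \<le> n" "1 \<le> k"
  shows "\<bar>site_density n k - short_site_density M n k\<bar> \<le> 1 / real (M + 1)"
proof -
  have "\<bar>\<integral>lam. real (site_count k lam) - real (short_site_count M k lam) \<partial>G n\<bar>
      \<le> (\<integral>lam. real n / real (M + 1) \<partial>G n)"
  proof (rule integral_abs_bound[THEN order_trans], rule Bochner_Integration.integral_mono)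
    show "integrable (G n) (\<lambda>lam. \<bar>real (site_count k lam) - real (short_site_count M k lam)\<bar>)"
      using assms by (intro integrable_abs Bochner_Integration.integrable_diff count_integrable)
    fix lam assume "lam \<in> space (G n)"
    then show "\<bar>real (site_count k lam) - real (short_site_count M k lam)\<bar> \<le> real n / real (M + 1)"
      unfolding short_site_count_def using assms by (intro site_count_close) (auto simp: space_G)
  qed simp
  also have "\<dots> = real n * (1 / real (M + 1))" by (simp add: gibbs.prob_space)
  also have "(\<integral>lam. real (site_count k lam) - real (short_site_count M k lam) \<partial>G n)
      = real n * (site_density n k - short_site_density M n k)"
    using assms by (subst Bochner_Integration.integral_diff)
      (auto intro!: count_integrable simp: site_density_def short_site_density_def field_simps)
  finally have "real n * \<bar>site_density n k - short_site_density M n k\<bar> \<le> real n * (1 / real (M + 1))"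
    by (simp add: abs_mult)
  then show ?thesis using assms by (subst (asm) mult_le_cancel_left_pos) auto
qed

lemma long_fraction_le_heavy_fraction: "long_fraction K n \<le> heavy_fraction K n"
  unfolding long_fraction_def heavy_fraction_def
proof (rule Bochner_Integration.integral_mono)
  fix lam assume "lam \<in> space (G n)"
  then show "real (long_part_mass K lam) / real n \<le> real (heavy_site_mass K lam) / real n"
    using long_le_heavy[of lam n K] by (intro divide_right_mono) (auto simp: space_G)
qed (intro integrable_divide count_integrable)+

lemma heavy_fraction_le:
  assumes "1 \<le> n" "1 \<le> K"
  shows "heavy_fraction K n \<le> long_fraction M n
    + (\<Sum>k=B+1..n. real k * short_site_density M n k) + real B / real K"
proof -
  have "(\<integral>lam. real (heavy_site_mass K lam) \<partial>G n)
      \<le> (\<integral>lam. real (long_part_mass M lam)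
        + (\<Sum>k=B+1..n. real k * real (short_site_count M k lam)) + real B * real n / real K \<partial>G n)"
  proof (rule Bochner_Integration.integral_mono)
    fix lam assume "lam \<in> space (G n)"
    then show "real (heavy_site_mass K lam) \<le> real (long_part_mass M lam)
        + (\<Sum>k=B+1..n. real k * real (short_site_count M k lam)) + real B * real n / real K"
      unfolding short_site_count_def using assms by (intro heavy_le_long) (auto simp: space_G)
  qed (auto intro!: Bochner_Integration.integrable_add Bochner_Integration.integrable_sum
      integrable_mult_right count_integrable)
  also have "\<dots> = (\<integral>lam. real (long_part_mass M lam) \<partial>G n)
      + (\<Sum>k=B+1..n. real k * (\<integral>lam. real (short_site_count M k lam) \<partial>G n)) + real B * real n / real K"
    by (subst Bochner_Integration.integral_add,
        auto intro!: Bochner_Integration.integrable_add Bochner_Integration.integrable_sum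
          integrable_mult_right count_integrable simp: gibbs.prob_space,
        subst Bochner_Integration.integral_add,
        auto intro!: Bochner_Integration.integrable_sum integrable_mult_right count_integrable
          simp: Bochner_Integration.integral_sum count_integrable)
  finally have "(\<integral>lam. real (heavy_site_mass K lam) \<partial>G n) / real n
      \<le> ((\<integral>lam. real (long_part_mass M lam) \<partial>G n)
      + (\<Sum>k=B+1..n. real k * (\<integral>lam. real (short_site_count M k lam) \<partial>G n)) + real B * real n / real K) / real n"
    by (rule divide_right_mono) simp
  then show ?thesis
    using assms
    by (simp add: heavy_fraction_def long_fraction_def short_site_density_def add_divide_distrib sum_divide_distrib)
qed

end

section \<open>Condensation\<close>

lemma boltzmann_sum_nonneg: "0 \<le> boltzmann_sum V L j"
  unfolding boltzmann_sum_def boltzmann_factor_def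
  by (intro Bochner_Integration.integral_nonneg zero_le_power exp_neg_bounds)

text \<open>Continuity of \<open>V\<close> at its zero makes the integrals decay more slowly than any exponential: restrict
  the integral to a ball on which \<open>V < \<epsilon>\<close>. Otherwise a single site near the origin could hold a
  macroscopic mass that the density series does not see.\<close>

lemma boltzmann_integral_lower_bound:
  fixes V :: "real ^ 'd::finite \<Rightarrow> ennreal"
  assumes int: "\<And>j. j \<ge> 1 \<Longrightarrow> integrable lebesgue (\<lambda>x. exp_neg (of_nat j * V x))"
    and V: "isCont V 0" "V 0 = 0" and "0 < \<epsilon>"
  obtains \<kappa> where "0 < \<kappa>" "\<And>j. j \<ge> 1 \<Longrightarrow> \<kappa> * exp (- \<epsilon>) ^ j \<le> boltzmann_integral V j"
proof -
  have "\<forall>\<^sub>F x in nhds 0. V x < ennreal \<epsilon>"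
  proof (rule order_tendstoD(2))
    show "(V \<longlongrightarrow> V 0) (nhds 0)"
      using V(1) by (simp only: isCont_def tendsto_at_iff_tendsto_nhds)
    show "V 0 < ennreal \<epsilon>" using V(2) \<open>0 < \<epsilon>\<close> by simp
  qed
  then obtain \<delta> where \<delta>: "0 < \<delta>" "\<And>x. dist x 0 < \<delta> \<Longrightarrow> V x < ennreal \<epsilon>"
    unfolding eventually_nhds_metric by blast
  show thesis
  proof (rule that)
    show "0 < measure lebesgue (ball (0 :: real ^ 'd) \<delta>)" using content_ball_pos[OF \<delta>(1), of 0] by simp
    fix j :: nat assume j: "j \<ge> 1"
    have "(\<integral>x. exp (- \<epsilon>) ^ j * indicator (ball (0 :: real ^ 'd) \<delta>) x \<partial>lebesgue) \<le> boltzmann_integral V j"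
      unfolding boltzmann_integral_def
    proof (rule Bochner_Integration.integral_mono[OF _ int[OF j]])
      show "integrable lebesgue (\<lambda>x. exp (- \<epsilon>) ^ j * indicator (ball (0 :: real ^ 'd) \<delta>) x)"
        by (intro integrable_mult_right integrable_real_indicator)
          (use emeasure_lborel_ball_finite[of "0 :: real ^ 'd" \<delta>] in auto)
      fix x :: "real ^ 'd"
      show "exp (- \<epsilon>) ^ j * indicator (ball 0 \<delta>) x \<le> exp_neg (of_nat j * V x)"
      proof (cases "x \<in> ball 0 \<delta>")
        case True
        then have "V x < ennreal \<epsilon>" using \<delta>(2)[of x] by (simp add: dist_commute)
        then have "V x \<noteq> \<infinity>" "enn2real (V x) \<le> \<epsilon>"
          using \<open>0 < \<epsilon>\<close> by (auto intro: enn2real_leI)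
        then have "exp (- \<epsilon>) \<le> exp_neg (V x)" by (simp add: exp_neg_def)
        then show ?thesis using True by (simp add: exp_neg_of_nat_mult power_mono)
      qed (simp add: exp_neg_bounds)
    qed
    then show "measure lebesgue (ball (0 :: real ^ 'd) \<delta>) * exp (- \<epsilon>) ^ j \<le> boltzmann_integral V j"
      by (simp add: mult.commute)
  qed
qed

locale spatial_condensation =
  fixes \<theta> :: "nat \<Rightarrow> real"
    and V :: "real ^ 'd::finite \<Rightarrow> ennreal"
    and \<rho> :: real
    and L :: "nat \<Rightarrow> real"
  assumes theta_nonneg: "\<And>j. j \<ge> 1 \<Longrightarrow> \<theta> j \<ge> 0"
    and rho_pos: "\<rho> > 0"
    and L_nonneg: "\<And>n. L n \<ge> 0"
    and L_def: "\<And>n. \<rho> * L n ^ CARD('d) = real n"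
    and Z_1_pos: "partition_function \<theta> V (L 1) 1 > 0"
    and integrable: "\<And>j. j \<ge> 1 \<Longrightarrow> integrable lebesgue (\<lambda>x. exp_neg (of_nat j * V x))"
    and zc_pos: "critical_fugacity \<theta> V > 0"
    and V_cont: "isCont V 0"
    and V_zero: "V 0 = 0"
    and riemann: "\<And>j. j \<ge> 1 \<Longrightarrow>
      ((\<lambda>l::real. (\<Sum>\<^sub>\<infinity>x\<in>UNIV. ennreal (exp_neg (of_nat j * V (scaled_site l x)))) / ennreal (l ^ CARD('d)))
        \<longlongrightarrow> ennreal (boltzmann_integral V j)) at_top"
begin

definition N :: "nat \<Rightarrow> real" where "N n = L n ^ CARD('d)"

definition \<alpha> :: "nat \<Rightarrow> real" where "\<alpha> j = \<theta> j * boltzmann_integral V j"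

lemma N_eq: "N n = real n / \<rho>"
  using L_def[of n] rho_pos by (simp add: N_def field_simps)

lemma N_infinite: "filterlim N at_top sequentially"
proof -
  have "filterlim (\<lambda>n. 1 / \<rho> * real n) at_top sequentially"
    using rho_pos by (intro filterlim_tendsto_pos_mult_at_top[OF tendsto_const _ filterlim_real_sequentially]) simp
  then show ?thesis by (simp add: N_eq[abs_def])
qed

lemma L_infinite: "filterlim L at_top sequentially"
  unfolding filterlim_at_top
proof
  fix C :: real
  have "\<forall>\<^sub>F n in sequentially. (max C 0) ^ CARD('d) < N n"
    using N_infinite by (simp add: filterlim_at_top_dense)
  then show "\<forall>\<^sub>F n in sequentially. C \<le> L n"
  proof eventually_elim
    case (elim n)
    then have "max C 0 < L n"
      unfolding N_def by (rule power_less_imp_less_base) (rule L_nonneg)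
    then show ?case by simp
  qed
qed

lemma N_pos: "1 \<le> n \<Longrightarrow> 0 < N n"
  using rho_pos by (simp add: N_eq)

text \<open>A partition of \<open>1\<close> consists of a single part of size one.\<close>

lemma theta_1_pos: "0 < \<theta> 1"
proof (rule ccontr)
  assume "\<not> 0 < \<theta> 1"
  then have \<theta>: "\<theta> 1 = 0" using theta_nonneg[of 1] by simp
  have "partition_weight \<theta> V (L 1) lam = 0" if lam: "lam \<in> spatial_partitions 1" for lam :: "'d spatial_partition"
  proof -
    have "total_count lam 1 \<noteq> 0" using mass_eq_total_counts[OF lam] by simp
    then obtain x where x: "part_count lam x 1 \<noteq> 0"
      unfolding total_count_def by (meson sum.neutral)
    have "finite {(x, j). part_count lam x j \<noteq> 0}"
      using lam by (intro part_pairs_finite) (simp add: spatial_partitions_iff)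
    then show ?thesis
      unfolding partition_weight_def using x \<theta>
      by (subst prod_zero_iff) (auto intro!: bexI[of _ "(x, 1)"])
  qed
  then have "partition_function \<theta> V (L 1) 1 = 0"
    unfolding partition_function_def by (intro infsum_0) simp
  then show False using Z_1_pos by simp
qed

lemma riemann_along_L:
  assumes "1 \<le> j"
  shows "(\<lambda>n. (\<integral>\<^sup>+x. ennreal (boltzmann_factor V (L n) x ^ j) \<partial>count_space UNIV) / ennreal (N n))
    \<longlonglongrightarrow> ennreal (boltzmann_integral V j)"
  using filterlim_compose[OF riemann[OF assms] L_infinite]
  by (simp add: infsum_eq_nn_integral_count_space exp_neg_of_nat_mult boltzmann_factor_def N_def)

text \<open>A finite limit of the Riemann sums for \<open>j = 1\<close> makes these sums finite from some volume on.\<close>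

lemma eventually_gibbs: "\<forall>\<^sub>F n in sequentially. spatial_gibbs \<theta> V (L n)"
proof -
  have "\<forall>\<^sub>F n in sequentially.
      (\<integral>\<^sup>+x. ennreal (boltzmann_factor V (L n) x ^ 1) \<partial>count_space UNIV) / ennreal (N n) < \<infinity>"
    by (rule order_tendstoD(2)[OF riemann_along_L]) auto
  then show ?thesis using eventually_ge_at_top[of 1]
  proof eventually_elim
    case (elim n)
    have "(\<integral>\<^sup>+x. ennreal (boltzmann_factor V (L n) x ^ 1) \<partial>count_space UNIV) \<noteq> \<top>"
    proof
      assume "(\<integral>\<^sup>+x. ennreal (boltzmann_factor V (L n) x ^ 1) \<partial>count_space UNIV) = \<top>"
      then show False using elim(1) by (simp add: ennreal_top_divide)
    qed
    then have "(\<integral>\<^sup>+x. ennreal (boltzmann_factor V (L n) x ^ 1) \<partial>count_space UNIV) < \<infinity>"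
      by (simp add: less_top)
    then show ?case
      by unfold_locales (use theta_nonneg theta_1_pos V_zero in \<open>auto simp: boltzmann_factor_def\<close>)
  qed
qed

lemma boltzmann_integral_nonneg: "0 \<le> boltzmann_integral V j"
  unfolding boltzmann_integral_def by (intro Bochner_Integration.integral_nonneg exp_neg_bounds)

lemma boltzmann_integral_pos: "1 \<le> j \<Longrightarrow> 0 < boltzmann_integral V j"
proof -
  assume j: "1 \<le> j"
  obtain \<kappa> where "0 < \<kappa>" "\<And>j. j \<ge> 1 \<Longrightarrow> \<kappa> * exp (- 1) ^ j \<le> boltzmann_integral V j"
    using boltzmann_integral_lower_bound[OF integrable V_cont V_zero, of 1] by auto
  then show ?thesis using j by (metis exp_gt_zero mult_pos_pos less_le_trans zero_less_power)
qed

lemma boltzmann_sum_lim: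
  assumes "1 \<le> j"
  shows "(\<lambda>n. boltzmann_sum V (L n) j / N n) \<longlonglongrightarrow> boltzmann_integral V j"
proof -
  have "(\<lambda>n. ennreal (boltzmann_sum V (L n) j / N n)) \<longlonglongrightarrow> ennreal (boltzmann_integral V j)"
  proof (rule Lim_transform_eventually[OF riemann_along_L[OF assms]])
    show "\<forall>\<^sub>F n in sequentially.
      (\<integral>\<^sup>+x. ennreal (boltzmann_factor V (L n) x ^ j) \<partial>count_space UNIV) / ennreal (N n)
      = ennreal (boltzmann_sum V (L n) j / N n)"
      using eventually_gibbs eventually_ge_at_top[of 1]
    proof eventually_elim
      case (elim n)
      then show ?case using assms N_pos[of n]
        by (simp add: spatial_gibbs.nn_site_sum boltzmann_sum_nonneg divide_ennreal)
    qed
  qed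
  moreover have "\<forall>\<^sub>F n in sequentially. 0 \<le> boltzmann_sum V (L n) j / N n"
    using eventually_ge_at_top[of 1]
    by eventually_elim (intro divide_nonneg_pos boltzmann_sum_nonneg N_pos)
  ultimately show ?thesis using boltzmann_integral_nonneg by (intro tendsto_ennrealD) auto
qed

text \<open>A bound for all sums over sites per volume, since these decrease in \<open>j\<close>.\<close>

definition sum_bound :: real where "sum_bound = boltzmann_integral V 1 + 1"

lemma sum_bound_pos: "0 < sum_bound"
  using boltzmann_integral_nonneg[of 1] by (simp add: sum_bound_def)

lemma boltzmann_sum_dominated: "\<forall>\<^sub>F n in sequentially. \<forall>j\<ge>1. boltzmann_sum V (L n) j \<le> sum_bound * N n"
proof -
  have "\<forall>\<^sub>F n in sequentially. boltzmann_sum V (L n) 1 / N n < sum_bound"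
    by (rule order_tendstoD(2)[OF boltzmann_sum_lim]) (auto simp: sum_bound_def)
  then show ?thesis using eventually_gibbs eventually_ge_at_top[of 1]
  proof eventually_elim
    case (elim n)
    show ?case
    proof (intro allI impI)
      fix j :: nat assume "1 \<le> j"
      then have "boltzmann_sum V (L n) j \<le> boltzmann_sum V (L n) 1"
        using elim by (intro spatial_gibbs.site_sum_antimono) auto
      also have "\<dots> \<le> sum_bound * N n" using elim N_pos[of n] by (simp add: field_simps)
      finally show "boltzmann_sum V (L n) j \<le> sum_bound * N n" .
    qed
  qed
qed

abbreviation zc :: ereal where "zc \<equiv> critical_fugacity \<theta> V"

lemma alpha_summable_below_zc:
  assumes "0 \<le> z" "ereal z < zc"
  shows "summable (\<lambda>j. if j = 0 then 0 else \<alpha> j * z ^ j)"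
proof -
  have "summable (\<lambda>j. (if j = 0 then 0 else \<theta> j * boltzmann_integral V j) * z ^ j)"
    using assms by (intro summable_in_conv_radius) (simp add: critical_fugacity_def)
  then show ?thesis by (rule summable_cong[THEN iffD1, rotated]) (auto simp: \<alpha>_def)
qed

text \<open>The critical fugacity is defined by \<open>\<theta>\<^sub>j\<close> times the integrals, but domination uniform in the volume
  needs the series of the \<open>\<theta>\<^sub>j\<close> alone. Both have the same radius, because the integrals decay
  subexponentially.\<close>

lemma theta_summable_below_zc:
  assumes z: "0 \<le> z" "ereal z < zc"
  shows "summable (\<lambda>j. \<theta> (Suc j) * sum_bound * z ^ Suc j)"
proof (cases "z = 0")
  case False
  then have z0: "0 < z" using z by simp
  obtain y where y: "z < y" "ereal y < zc"
    using ereal_dense2[OF z(2)] unfolding less_ereal.simps by blast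
  have y0: "0 < y" using z0 y by simp
  \<comment> \<open>Half of the exponential gap between \<open>z\<close> and \<open>y\<close> is spent on the decay of the integrals; the other
    half remains as the geometric factor \<open>q\<close>.\<close>
  define \<epsilon> where "\<epsilon> = ln (y / z) / 2"
  have \<epsilon>: "0 < \<epsilon>" using z0 y by (simp add: \<epsilon>_def)
  define q where "q = exp \<epsilon> * z / y"
  have q: "0 < q" "q < 1"
  proof -
    show "0 < q" using z0 y0 by (simp add: q_def)
    have "exp \<epsilon> < exp (ln (y / z))" using \<epsilon> by (simp add: \<epsilon>_def)
    also have "\<dots> = y / z" using z0 y0 by simp
    finally show "q < 1" using z0 y0 by (simp add: q_def field_simps)
  qed
  obtain \<kappa> where \<kappa>: "0 < \<kappa>" "\<And>j. j \<ge> 1 \<Longrightarrow> \<kappa> * exp (- \<epsilon>) ^ j \<le> boltzmann_integral V j"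
    using boltzmann_integral_lower_bound[OF integrable V_cont V_zero \<epsilon>] by blast
  have "Bseq (\<lambda>j. if j = 0 then 0 else \<alpha> j * y ^ j)"
    using y0 y(2) by (intro convergent_imp_Bseq convergentI[of _ 0] summable_LIMSEQ_zero alpha_summable_below_zc) auto
  then obtain C where C: "\<And>j. j \<ge> 1 \<Longrightarrow> \<alpha> j * y ^ j \<le> C"
    unfolding Bseq_def by (metis abs_le_D1 not_one_le_zero real_norm_def)
  show ?thesis
  proof (rule summable_comparison_test')
    show "summable (\<lambda>j. sum_bound * C / \<kappa> * q ^ Suc j)"
      using q by (intro summable_mult summable_ignore_initial_segment[of _ 1, simplified] summable_geometric) auto
    fix j
    let ?j = "Suc j"
    have "\<theta> ?j * (\<kappa> * exp (- \<epsilon>) ^ ?j) * y ^ ?j \<le> \<alpha> ?j * y ^ ?j"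
      unfolding \<alpha>_def using \<kappa>(2)[of ?j] theta_nonneg[of ?j] y0
      by (intro mult_right_mono mult_left_mono) auto
    also have "\<dots> \<le> C" by (rule C) simp
    finally have "\<theta> ?j * (\<kappa> * exp (- \<epsilon>) ^ ?j) * y ^ ?j * q ^ ?j \<le> C * q ^ ?j"
      using q by (intro mult_right_mono) auto
    also have "\<theta> ?j * (\<kappa> * exp (- \<epsilon>) ^ ?j) * y ^ ?j * q ^ ?j = \<kappa> * (\<theta> ?j * (exp (- \<epsilon>) * y * q) ^ ?j)"
      by (simp only: power_mult_distrib mult_ac)
    also have "exp (- \<epsilon>) * y * q = z" using y0 by (simp add: q_def exp_minus)
    finally have "\<theta> ?j * z ^ ?j \<le> C / \<kappa> * q ^ ?j"
      using \<kappa>(1) by (simp add: field_simps)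
    then have "sum_bound * (\<theta> ?j * z ^ ?j) \<le> sum_bound * (C / \<kappa> * q ^ ?j)"
      using sum_bound_pos by (intro mult_left_mono) auto
    moreover have "0 \<le> \<theta> ?j * sum_bound * z ^ ?j" using theta_nonneg[of ?j] sum_bound_pos z by simp
    ultimately show "norm (\<theta> ?j * sum_bound * z ^ ?j) \<le> sum_bound * C / \<kappa> * q ^ ?j"
      by (simp add: mult_ac)
  qed
qed simp

lemma alpha_nonneg: "1 \<le> j \<Longrightarrow> 0 \<le> \<alpha> j"
  using theta_nonneg boltzmann_integral_nonneg by (simp add: \<alpha>_def)

lemma alpha_unbounded_above_zc:
  assumes "zc < ereal z"
  shows "\<exists>j\<ge>1. C < \<alpha> j * z ^ j"
proof (rule ccontr)
  assume "\<not> (\<exists>j\<ge>1. C < \<alpha> j * z ^ j)"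
  then have C: "\<alpha> j * z ^ j \<le> C" if "j \<ge> 1" for j using that by force
  obtain w where w: "zc < ereal w" "w < z"
    using ereal_dense2[OF assms] unfolding less_ereal.simps by blast
  have w0: "0 < w" using less_trans[OF zc_pos w(1)] by simp
  then have q: "0 < w / z" "w / z < 1" using w by auto
  have "summable (\<lambda>j. (if j = 0 then 0 else \<theta> j * boltzmann_integral V j) * w ^ j)"
  proof (rule summable_comparison_test')
    show "summable (\<lambda>j. max C 0 * (w / z) ^ j)"
      using q by (intro summable_mult summable_geometric) auto
    fix j
    show "norm ((if j = 0 then 0 else \<theta> j * boltzmann_integral V j) * w ^ j) \<le> max C 0 * (w / z) ^ j"
    proof (cases "j = 0")
      case False
      have "\<alpha> j * w ^ j = \<alpha> j * z ^ j * (w / z) ^ j"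
        using w0 w by (simp add: power_divide)
      also have "\<dots> \<le> max C 0 * (w / z) ^ j"
        using C[of j] False q by (intro mult_right_mono) auto
      finally show ?thesis using False alpha_nonneg[of j] w0 by (simp add: \<alpha>_def)
    qed simp
  qed
  then have "ereal (norm w) \<le> zc" unfolding critical_fugacity_def by (rule conv_radius_geI)
  then show False using w w0 by simp
qed

sublocale T: thermodynamic_limit "\<lambda>n. part_activity \<theta> V (L n)" N \<alpha> "\<lambda>j. \<theta> j * sum_bound" zc
proof
  show "0 \<le> part_activity \<theta> V (L n) j" if "1 \<le> j" for n j
    unfolding part_activity_def by (intro mult_nonneg_nonneg theta_nonneg that boltzmann_sum_nonneg)
  show "(\<lambda>n. part_activity \<theta> V (L n) j / N n) \<longlonglongrightarrow> \<alpha> j" if "1 \<le> j" for j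
    using tendsto_mult_left[OF boltzmann_sum_lim[OF that], of "\<theta> j"]
    by (simp add: part_activity_def \<alpha>_def)
  show "\<forall>\<^sub>F n in sequentially. \<forall>j\<ge>1. part_activity \<theta> V (L n) j \<le> N n * (\<theta> j * sum_bound)"
    using boltzmann_sum_dominated
  proof eventually_elim
    case (elim n)
    show ?case
    proof (intro allI impI)
      fix j :: nat assume j: "1 \<le> j"
      then have "\<theta> j * boltzmann_sum V (L n) j \<le> \<theta> j * (sum_bound * N n)"
        using elim theta_nonneg by (intro mult_left_mono) auto
      then show "part_activity \<theta> V (L n) j \<le> N n * (\<theta> j * sum_bound)"
        by (simp add: part_activity_def mult_ac)
    qed
  qed
  show "0 < \<alpha> 1" using theta_1_pos boltzmann_integral_pos[of 1] by (simp add: \<alpha>_def)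
qed (rule N_infinite theta_summable_below_zc alpha_unbounded_above_zc zc_pos; assumption?)+

abbreviation zs :: real where "zs \<equiv> T.fugacity \<rho>"

lemma zs_nonneg: "0 \<le> zs"
  by (rule T.fugacity_nonneg[OF rho_pos])

lemma n_over_N_lim: "(\<lambda>n. real n / N n) \<longlonglongrightarrow> \<rho>"
proof (rule tendsto_eventually)
  show "\<forall>\<^sub>F n in sequentially. real n / N n = \<rho>"
    using eventually_ge_at_top[of 1] by eventually_elim (simp add: N_eq)
qed

lemma Z_ratio_lim:
  "(\<lambda>n. exp_coeff (part_activity \<theta> V (L n)) (n - k) / exp_coeff (part_activity \<theta> V (L n)) n) \<longlonglongrightarrow> zs ^ k"
  by (rule T.shifted_ratio_lim[OF rho_pos n_over_N_lim])

lemma over_n: "x / real n = x / N n / \<rho>"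
  using rho_pos by (simp add: N_eq)

definition long_limit :: "nat \<Rightarrow> real" where
  "long_limit K = 1 - (\<Sum>j=1..K. \<alpha> j * zs ^ j) / \<rho>"

lemma long_fraction_lim:
  "(\<lambda>n. \<integral>lam. real (long_part_mass K lam) / real n \<partial>gibbs_measure \<theta> V (L n) n) \<longlonglongrightarrow> long_limit K"
proof (rule Lim_transform_eventually)
  let ?Z = "\<lambda>n. exp_coeff (part_activity \<theta> V (L n))"
  show "(\<lambda>n. 1 - (\<Sum>j=1..K. part_activity \<theta> V (L n) j / N n * (?Z n (n - j) / ?Z n n)) / \<rho>) \<longlonglongrightarrow> long_limit K"
    unfolding long_limit_def using rho_pos by (intro tendsto_intros T.a_lim Z_ratio_lim) auto
  show "\<forall>\<^sub>F n in sequentially. 1 - (\<Sum>j=1..K. part_activity \<theta> V (L n) j / N n * (?Z n (n - j) / ?Z n n)) / \<rho>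
      = (\<integral>lam. real (long_part_mass K lam) / real n \<partial>gibbs_measure \<theta> V (L n) n)"
    using eventually_gibbs eventually_ge_at_top[of 1] eventually_ge_at_top[of K]
  proof eventually_elim
    case (elim n)
    have "(\<Sum>j=1..K. part_activity \<theta> V (L n) j / N n * (?Z n (n - j) / ?Z n n))
        = (\<Sum>j=1..K. part_activity \<theta> V (L n) j * ?Z n (n - j) / ?Z n n) / N n"
      by (simp add: sum_divide_distrib mult.commute)
    then show ?case
      using spatial_gibbs.long_fraction_eq[OF elim] over_n[of _ n]
      by (simp only: spatial_gibbs.long_fraction_def[OF elim(1)])
  qed
qed

lemma long_limit_lim: "long_limit \<longlonglongrightarrow> 1 - T.dens zs / \<rho>"
  unfolding long_limit_def[abs_def]
  using rho_pos by (intro tendsto_intros T.partial_density_lim T.fugacity_summable) auto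

lemma long_limit_ge: "1 - T.dens zs / \<rho> \<le> long_limit K"
  using T.partial_density_le_dens[OF zs_nonneg T.fugacity_summable[OF rho_pos], of K] rho_pos
  by (simp add: long_limit_def divide_right_mono)

abbreviation h :: "nat \<Rightarrow> nat \<Rightarrow> real" where "h M \<equiv> exp_coeff (short_theta \<theta> M)"

abbreviation c :: "nat \<Rightarrow> nat \<Rightarrow> real" where "c M \<equiv> exp_coeff (\<lambda>j. - short_theta \<theta> M j)"

lemma short_theta_nonneg: "1 \<le> j \<Longrightarrow> 0 \<le> short_theta \<theta> M j"
  using theta_nonneg by (simp add: short_theta_def)

lemma h_nonneg: "0 \<le> h M i"
  using short_theta_nonneg by (rule exp_coeff_nonneg)

text \<open>The exponent is a polynomial, so its sum is finite at \<open>2 C\<close> as well; there the terms have a maximum,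
  which leaves a geometric factor \<open>2\<^sup>-\<^sup>i\<close> at \<open>C\<close>.\<close>

lemma h_summable:
  assumes "0 \<le> C"
  shows "summable (\<lambda>i. h M i * C ^ i)"
proof -
  have le: "(\<Sum>j=1..m. short_theta \<theta> M j * (2 * C) ^ j) \<le> (\<Sum>j=1..M. \<theta> j * (2 * C) ^ j)" for m
  proof -
    have "(\<Sum>j=1..m. short_theta \<theta> M j * (2 * C) ^ j) = (\<Sum>j\<in>{1..m} \<inter> {1..M}. \<theta> j * (2 * C) ^ j)"
      by (intro sum.mono_neutral_cong_right) (auto simp: short_theta_def)
    also have "\<dots> \<le> (\<Sum>j=1..M. \<theta> j * (2 * C) ^ j)"
      using assms theta_nonneg by (intro sum_mono2) auto
    finally show ?thesis .
  qed
  obtain m0 where m0: "\<And>m. h M m * (2 * C) ^ m \<le> h M m0 * (2 * C) ^ m0"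
    by (rule exp_coeff_maximizer[of "short_theta \<theta> M" "2 * C" "\<Sum>j=1..M. \<theta> j * (2 * C) ^ j"])
      (use assms short_theta_nonneg le in auto)
  show ?thesis
  proof (rule summable_comparison_test')
    show "summable (\<lambda>i. h M m0 * (2 * C) ^ m0 * (1 / 2 :: real) ^ i)"
      by (intro summable_mult summable_geometric) auto
    fix i
    have "h M i * (2 * C) ^ i * (1 / 2) ^ i \<le> h M m0 * (2 * C) ^ m0 * (1 / 2) ^ i"
      by (intro mult_right_mono m0) auto
    moreover have "(2 * C) ^ i * (1 / 2) ^ i = C ^ i"
      unfolding power_mult_distrib[symmetric] by simp
    ultimately have "h M i * C ^ i \<le> h M m0 * (2 * C) ^ m0 * (1 / 2) ^ i"
      by (simp only: mult.assoc)
    moreover have "0 \<le> h M i * C ^ i" using h_nonneg assms by simp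
    ultimately show "norm (h M i * C ^ i) \<le> h M m0 * (2 * C) ^ m0 * (1 / 2) ^ i"
      by (simp only: real_norm_def abs_of_nonneg)
  qed
qed

text \<open>A bound for all ratios of consecutive partition functions up to mass \<open>n\<close>: they are at most
  \<open>n / a\<^sub>1\<close>, and \<open>a\<^sub>1 \<ge> \<alpha>\<^sub>1 L\<^sup>d / 2\<close> eventually.\<close>

definition ratio_bound :: real where "ratio_bound = 2 * \<rho> / \<alpha> 1"

lemma ratio_bound_pos: "0 < ratio_bound"
  using rho_pos T.alpha_1_pos by (simp add: ratio_bound_def)

lemma Z_ratio_bounds:
  "\<forall>\<^sub>F n in sequentially. \<forall>m\<le>n. 0 \<le> exp_coeff (part_activity \<theta> V (L n)) (n - m) / exp_coeff (part_activity \<theta> V (L n)) n \<and>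
     exp_coeff (part_activity \<theta> V (L n)) (n - m) / exp_coeff (part_activity \<theta> V (L n)) n \<le> ratio_bound ^ m"
  using eventually_gibbs eventually_ge_at_top[of 1] T.a_1_over_volume
proof eventually_elim
  case (elim n)
  let ?Z = "exp_coeff (part_activity \<theta> V (L n))"
  have Z: "0 < ?Z k" for k by (rule spatial_gibbs.Z_pos[OF elim(1)])
  have "real n = ratio_bound * (\<alpha> 1 / 2 * N n)"
    using rho_pos T.alpha_1_pos by (simp add: ratio_bound_def N_eq)
  also have "\<dots> \<le> ratio_bound * part_activity \<theta> V (L n) 1"
    using elim ratio_bound_pos by (intro mult_left_mono) auto
  finally have "?Z (n - m) \<le> ratio_bound ^ m * ?Z n" if "m \<le> n" for m
    using that elim ratio_bound_pos by (intro spatial_gibbs.Z_ratio_le[OF elim(1), of n]) auto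
  then show ?case using Z by (auto simp: pos_divide_le_eq less_imp_le)
qed

text \<open>In the exact formula every term converges by the ratio limit, and the terms are dominated by those
  of an entire function, evaluated at \<open>ratio_bound\<close>.\<close>

lemma short_site_density_lim:
  assumes "1 \<le> k"
  obtains l where "(\<lambda>n. spatial_gibbs.short_site_density \<theta> V (L n) M n k) \<longlonglongrightarrow> l"
proof -
  let ?Z = "\<lambda>n. exp_coeff (part_activity \<theta> V (L n))"
  let ?t = "\<lambda>i n. if i \<le> n - k then c M i * (boltzmann_sum V (L n) (k + i) / N n) * (?Z n (n - (k + i)) / ?Z n n) else 0"
  have lim: "(\<lambda>n. ?t i n) \<longlonglongrightarrow> c M i * boltzmann_integral V (k + i) * zs ^ (k + i)" for i
  proof (rule Lim_transform_eventually)
    show "(\<lambda>n. c M i * (boltzmann_sum V (L n) (k + i) / N n) * (?Z n (n - (k + i)) / ?Z n n))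
        \<longlonglongrightarrow> c M i * boltzmann_integral V (k + i) * zs ^ (k + i)"
      using assms by (intro tendsto_intros boltzmann_sum_lim Z_ratio_lim) auto
    show "\<forall>\<^sub>F n in sequentially.
      c M i * (boltzmann_sum V (L n) (k + i) / N n) * (?Z n (n - (k + i)) / ?Z n n) = ?t i n"
      using eventually_ge_at_top[of "k + i"] by eventually_elim auto
  qed
  have bound: "\<forall>\<^sub>F n in sequentially. \<forall>i. norm (?t i n) \<le> sum_bound * ratio_bound ^ k * (h M i * ratio_bound ^ i)"
    using boltzmann_sum_dominated Z_ratio_bounds eventually_ge_at_top[of "max 1 k"]
  proof eventually_elim
    case (elim n)
    show ?case
    proof
      fix i
      have R0: "0 \<le> sum_bound * ratio_bound ^ k * (h M i * ratio_bound ^ i)" using sum_bound_pos ratio_bound_pos h_nonneg by simp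
      show "norm (?t i n) \<le> sum_bound * ratio_bound ^ k * (h M i * ratio_bound ^ i)"
      proof (cases "i \<le> n - k")
        case True
        have "\<bar>c M i\<bar> \<le> h M i"
          using short_theta_nonneg[of _ M] by (intro exp_coeff_abs_le) simp
        moreover have A: "0 \<le> boltzmann_sum V (L n) (k + i) / N n" "boltzmann_sum V (L n) (k + i) / N n \<le> sum_bound"
          using elim assms N_pos[of n] boltzmann_sum_nonneg[of V "L n" "k + i"]
          by (auto simp: pos_divide_le_eq)
        moreover have "k \<le> n" using elim(3) by simp
        then have "k + i \<le> n" using True by linarith
        then have Q: "0 \<le> ?Z n (n - (k + i)) / ?Z n n" "?Z n (n - (k + i)) / ?Z n n \<le> ratio_bound ^ (k + i)"
          using elim(2)[rule_format, of "k + i"] by blast+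
        ultimately have "\<bar>c M i\<bar> * (boltzmann_sum V (L n) (k + i) / N n) * (?Z n (n - (k + i)) / ?Z n n)
            \<le> h M i * sum_bound * ratio_bound ^ (k + i)"
          using h_nonneg sum_bound_pos by (intro mult_mono mult_nonneg_nonneg) (simp_all only: abs_ge_zero less_imp_le)
        moreover have "norm (?t i n) = \<bar>c M i\<bar> * (boltzmann_sum V (L n) (k + i) / N n) * (?Z n (n - (k + i)) / ?Z n n)"
          unfolding if_P[OF True] real_norm_def abs_mult abs_of_nonneg[OF A(1)] abs_of_nonneg[OF Q(1)] ..
        ultimately show ?thesis by (simp add: power_add mult_ac)
      qed (use R0 in simp)
    qed
  qed
  then have bound': "\<forall>\<^sub>F (i, n) in at_top \<times>\<^sub>F sequentially. norm (?t i n) \<le> sum_bound * ratio_bound ^ k * (h M i * ratio_bound ^ i)"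
    unfolding eventually_prod_filter
    by (intro exI[of _ "\<lambda>_. True"] exI[of _ "\<lambda>n. \<forall>i. norm (?t i n) \<le> sum_bound * ratio_bound ^ k * (h M i * ratio_bound ^ i)"]) auto
  have "summable (\<lambda>i. sum_bound * ratio_bound ^ k * (h M i * ratio_bound ^ i))"
    using ratio_bound_pos by (intro summable_mult h_summable) simp
  from tannerys_theorem[OF lim bound' this]
  have "(\<lambda>n. \<Sum>i. ?t i n) \<longlonglongrightarrow> (\<Sum>i. c M i * boltzmann_integral V (k + i) * zs ^ (k + i))" by simp
  then have "(\<lambda>n. h M k * (\<Sum>i. ?t i n) / \<rho>)
      \<longlonglongrightarrow> h M k * (\<Sum>i. c M i * boltzmann_integral V (k + i) * zs ^ (k + i)) / \<rho>"
    using rho_pos by (intro tendsto_intros) auto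
  moreover have "\<forall>\<^sub>F n in sequentially. h M k * (\<Sum>i. ?t i n) / \<rho>
      = spatial_gibbs.short_site_density \<theta> V (L n) M n k"
    using eventually_gibbs eventually_ge_at_top[of k]
  proof eventually_elim
    case (elim n)
    have "(\<Sum>i. ?t i n) = (\<Sum>i\<le>n - k. ?t i n)"
      by (rule suminf_finite) auto
    also have "\<dots> = (\<Sum>i\<le>n - k. c M i * boltzmann_sum V (L n) (k + i) * ?Z n (n - k - i)) / ?Z n n / N n"
      by (simp add: sum_divide_distrib diff_diff_left mult_ac)
    finally show ?case
      unfolding spatial_gibbs.short_site_density_eq(1)[OF elim(1) assms elim(2)] over_n[of _ n]
      by simp
  qed
  ultimately show thesis by (intro that) (rule Lim_transform_eventually)
qed

text \<open>The density is approximated within \<open>1 / (M + 1)\<close>, uniformly in the volume, by sequences that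
  converge; hence it is a Cauchy sequence.\<close>

lemma site_density_convergent:
  assumes "1 \<le> k"
  shows "convergent (\<lambda>n. spatial_gibbs.site_density \<theta> V (L n) n k)"
proof -
  let ?s = "\<lambda>n. spatial_gibbs.site_density \<theta> V (L n) n k"
  let ?t = "\<lambda>M n. spatial_gibbs.short_site_density \<theta> V (L n) M n k"
  have "Cauchy ?s"
  proof (rule metric_CauchyI)
    fix e :: real assume e: "0 < e"
    obtain M where M: "1 / real (M + 1) < e / 4"
      using reals_Archimedean[of "e / 4"] e by (auto simp: inverse_eq_divide)
    have "\<forall>\<^sub>F n in sequentially. \<bar>?s n - ?t M n\<bar> \<le> 1 / real (M + 1)"
      using eventually_gibbs eventually_ge_at_top[of 1]
      by eventually_elim (rule spatial_gibbs.site_density_close, use assms in auto)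
    then obtain n1 where n1: "\<And>n. n \<ge> n1 \<Longrightarrow> \<bar>?s n - ?t M n\<bar> \<le> 1 / real (M + 1)"
      unfolding eventually_sequentially by blast
    obtain l where "(\<lambda>n. ?t M n) \<longlonglongrightarrow> l"
      using short_site_density_lim[OF assms] by blast
    then have "Cauchy (\<lambda>n. ?t M n)" by (rule LIMSEQ_imp_Cauchy)
    then obtain n2 where n2: "\<And>m n. m \<ge> n2 \<Longrightarrow> n \<ge> n2 \<Longrightarrow> dist (?t M m) (?t M n) < e / 4"
      using metric_CauchyD[of "\<lambda>n. ?t M n" "e / 4"] e by auto
    have "dist (?s m) (?s n) < e" if "m \<ge> max n1 n2" "n \<ge> max n1 n2" for m n
    proof -
      have "\<bar>?s m - ?t M m\<bar> < e / 4" "\<bar>?s n - ?t M n\<bar> < e / 4"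
        using n1[of m] n1[of n] that M by auto
      moreover have "\<bar>?t M m - ?t M n\<bar> < e / 4"
        using n2[of m n] that by (simp add: dist_real_def)
      ultimately show ?thesis unfolding dist_real_def by linarith
    qed
    then show "\<exists>M. \<forall>m\<ge>M. \<forall>n\<ge>M. dist (?s m) (?s n) < e" by blast
  qed
  then show ?thesis by (rule Cauchy_convergent)
qed

abbreviation heavy :: "nat \<Rightarrow> nat \<Rightarrow> real" where
  "heavy K n \<equiv> (\<integral>lam. real (heavy_site_mass K lam) / real n \<partial>gibbs_measure \<theta> V (L n) n)"

lemma heavy_fraction_convergent: "convergent (heavy K)"
proof -
  define l where "l k = lim (\<lambda>n. spatial_gibbs.site_density \<theta> V (L n) n k)" for k
  have l: "(\<lambda>n. spatial_gibbs.site_density \<theta> V (L n) n k) \<longlonglongrightarrow> l k" if "1 \<le> k" for k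
    unfolding l_def using site_density_convergent[OF that] by (rule convergent_LIMSEQ_iff[THEN iffD1])
  have "(\<lambda>n. 1 - (\<Sum>k=1..K. real k * spatial_gibbs.site_density \<theta> V (L n) n k)) \<longlonglongrightarrow> 1 - (\<Sum>k=1..K. real k * l k)"
    by (intro tendsto_intros l) auto
  moreover have "\<forall>\<^sub>F n in sequentially. 1 - (\<Sum>k=1..K. real k * spatial_gibbs.site_density \<theta> V (L n) n k) = heavy K n"
    using eventually_gibbs eventually_ge_at_top[of 1] eventually_ge_at_top[of K]
    by eventually_elim (simp only: spatial_gibbs.heavy_fraction_eq[symmetric] spatial_gibbs.heavy_fraction_def)
  ultimately have "heavy K \<longlonglongrightarrow> 1 - (\<Sum>k=1..K. real k * l k)"
    by (rule Lim_transform_eventually)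
  then show ?thesis by (rule convergentI)
qed

definition heavy_limit :: "nat \<Rightarrow> real" where "heavy_limit K = lim (heavy K)"

lemma heavy_fraction_lim: "heavy K \<longlonglongrightarrow> heavy_limit K"
  unfolding heavy_limit_def using heavy_fraction_convergent by (rule convergent_LIMSEQ_iff[THEN iffD1])

lemma long_limit_le_heavy_limit: "long_limit K \<le> heavy_limit K"
proof (rule tendsto_le[OF _ heavy_fraction_lim long_fraction_lim])
  show "\<forall>\<^sub>F n in sequentially.
      (\<integral>lam. real (long_part_mass K lam) / real n \<partial>gibbs_measure \<theta> V (L n) n) \<le> heavy K n"
    using eventually_gibbs
  proof eventually_elim
    case (elim n)
    show ?case
      using spatial_gibbs.long_fraction_le_heavy_fraction[OF elim, of K n]
      by (simp only: spatial_gibbs.long_fraction_def[OF elim] spatial_gibbs.heavy_fraction_def[OF elim])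
  qed
qed simp

text \<open>Bounds the mass fraction of the short parts at sites with short mass above \<open>B\<close>. The factor \<open>2\<close> makes
  up for the weight \<open>k \<le> 2\<^sup>k\<close> of a site with short mass \<open>k\<close>.\<close>

definition short_site_tail :: "nat \<Rightarrow> nat \<Rightarrow> real" where
  "short_site_tail M B = sum_bound / \<rho> * ((\<Sum>k. h M k * (2 * ratio_bound) ^ k) - (\<Sum>k\<le>B. h M k * (2 * ratio_bound) ^ k))"

lemma short_site_tail_lim: "short_site_tail M \<longlonglongrightarrow> 0"
proof -
  have "(\<lambda>B. \<Sum>k\<le>B. h M k * (2 * ratio_bound) ^ k) \<longlonglongrightarrow> (\<Sum>k. h M k * (2 * ratio_bound) ^ k)"
    using ratio_bound_pos by (intro summable_LIMSEQ' h_summable) simp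
  then have "short_site_tail M \<longlonglongrightarrow> sum_bound / \<rho> * ((\<Sum>k. h M k * (2 * ratio_bound) ^ k) - (\<Sum>k. h M k * (2 * ratio_bound) ^ k))"
    unfolding short_site_tail_def[abs_def] by (intro tendsto_intros)
  then show ?thesis by simp
qed

lemma heavy_limit_le:
  assumes "1 \<le> K"
  shows "heavy_limit K \<le> long_limit M + short_site_tail M B + real B / real K"
proof (rule tendsto_le[OF _ _ heavy_fraction_lim])
  show "(\<lambda>n. (\<integral>lam. real (long_part_mass M lam) / real n \<partial>gibbs_measure \<theta> V (L n) n) + short_site_tail M B + real B / real K)
      \<longlonglongrightarrow> long_limit M + short_site_tail M B + real B / real K"
    by (intro tendsto_intros long_fraction_lim)
  show "\<forall>\<^sub>F n in sequentially. heavy K n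
      \<le> (\<integral>lam. real (long_part_mass M lam) / real n \<partial>gibbs_measure \<theta> V (L n) n) + short_site_tail M B + real B / real K"
    using eventually_gibbs eventually_ge_at_top[of 1] boltzmann_sum_dominated Z_ratio_bounds eventually_ge_at_top[of B]
  proof eventually_elim
    case (elim n)
    let ?Z = "exp_coeff (part_activity \<theta> V (L n))"
    have C2: "0 \<le> h M k * (2 * ratio_bound) ^ k" for k using h_nonneg ratio_bound_pos by simp
    have "real k * spatial_gibbs.short_site_density \<theta> V (L n) M n k \<le> sum_bound / \<rho> * (h M k * (2 * ratio_bound) ^ k)"
      if k: "k \<in> {B+1..n}" for k
    proof -
      have k1: "1 \<le> k" "k \<le> n" using k by auto
      have "spatial_gibbs.short_site_density \<theta> V (L n) M n k
          \<le> h M k * boltzmann_sum V (L n) k * ?Z (n - k) / ?Z n / real n"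
        by (rule spatial_gibbs.short_site_density_eq(3)[OF elim(1) k1])
      also have "\<dots> = h M k * (boltzmann_sum V (L n) k / N n) * (?Z (n - k) / ?Z n) / \<rho>"
        unfolding over_n by simp
      also have "\<dots> \<le> h M k * sum_bound * ratio_bound ^ k / \<rho>"
      proof (intro divide_right_mono mult_mono mult_nonneg_nonneg h_nonneg order_refl)
        show "boltzmann_sum V (L n) k / N n \<le> sum_bound" using elim k1 N_pos[of n] by (auto simp: pos_divide_le_eq)
        show "?Z (n - k) / ?Z n \<le> ratio_bound ^ k" "0 \<le> ?Z (n - k) / ?Z n" using elim(4) k1 by blast+
        show "0 \<le> boltzmann_sum V (L n) k / N n"
          using boltzmann_sum_nonneg N_pos[of n] elim(2) by (intro divide_nonneg_pos) auto
      qed (use sum_bound_pos rho_pos in auto)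
      finally have "real k * spatial_gibbs.short_site_density \<theta> V (L n) M n k \<le> real k * (h M k * sum_bound * ratio_bound ^ k / \<rho>)"
        by (rule mult_left_mono) simp
      also have "\<dots> \<le> 2 ^ k * (h M k * sum_bound * ratio_bound ^ k / \<rho>)"
      proof (rule mult_right_mono)
        show "real k \<le> 2 ^ k" using of_nat_less_two_power[of k, where 'a = real] by simp
        show "0 \<le> h M k * sum_bound * ratio_bound ^ k / \<rho>" using h_nonneg sum_bound_pos ratio_bound_pos rho_pos by simp
      qed
      also have "\<dots> = sum_bound / \<rho> * (h M k * (2 * ratio_bound) ^ k)" by (simp add: power_mult_distrib mult_ac)
      finally show ?thesis .
    qed
    then have "(\<Sum>k=B+1..n. real k * spatial_gibbs.short_site_density \<theta> V (L n) M n k)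
        \<le> (\<Sum>k=B+1..n. sum_bound / \<rho> * (h M k * (2 * ratio_bound) ^ k))"
      by (rule sum_mono)
    also have "\<dots> = sum_bound / \<rho> * ((\<Sum>k\<le>n. h M k * (2 * ratio_bound) ^ k) - (\<Sum>k\<le>B. h M k * (2 * ratio_bound) ^ k))"
    proof -
      have "{..n} = {..B} \<union> {B+1..n}" using elim(5) by auto
      then have "(\<Sum>k\<le>n. h M k * (2 * ratio_bound) ^ k) = (\<Sum>k\<le>B. h M k * (2 * ratio_bound) ^ k) + (\<Sum>k=B+1..n. h M k * (2 * ratio_bound) ^ k)"
        by (simp only:) (rule sum.union_disjoint, auto)
      then show ?thesis by (simp add: sum_distrib_left)
    qed
    also have "\<dots> \<le> short_site_tail M B"
      unfolding short_site_tail_def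
    proof (intro mult_left_mono diff_right_mono)
      show "(\<Sum>k\<le>n. h M k * (2 * ratio_bound) ^ k) \<le> (\<Sum>k. h M k * (2 * ratio_bound) ^ k)"
        using C2 ratio_bound_pos by (intro sum_le_suminf h_summable) auto
    qed (use sum_bound_pos rho_pos in auto)
    finally show ?case
      using spatial_gibbs.heavy_fraction_le[OF elim(1,2) assms, of M B]
      by (simp only: spatial_gibbs.long_fraction_def[OF elim(1)] spatial_gibbs.heavy_fraction_def[OF elim(1)])
  qed
qed simp

text \<open>Given \<open>M\<close>, choose \<open>B\<close> so large that the tail is small, and then \<open>K\<close> much larger than \<open>B\<close>.\<close>

lemma heavy_limit_lim: "heavy_limit \<longlonglongrightarrow> 1 - T.dens zs / \<rho>"
proof (rule order_tendstoI)
  fix y assume "y < 1 - T.dens zs / \<rho>"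
  then have "y < heavy_limit K" for K
    using long_limit_ge[of K] long_limit_le_heavy_limit[of K] by linarith
  then show "\<forall>\<^sub>F K in sequentially. y < heavy_limit K" by simp
next
  fix y assume "1 - T.dens zs / \<rho> < y"
  then have "\<forall>\<^sub>F M in sequentially. long_limit M < y"
    by (rule order_tendstoD(2)[OF long_limit_lim])
  then obtain M where M: "long_limit M < y"
    using eventually_happens'[OF sequentially_bot] by blast
  then have "\<forall>\<^sub>F B in sequentially. short_site_tail M B < y - long_limit M"
    by (intro order_tendstoD(2)[OF short_site_tail_lim]) simp
  then obtain B where B: "short_site_tail M B < y - long_limit M"
    using eventually_happens'[OF sequentially_bot] by blast
  have "(\<lambda>K. real B / real K) \<longlonglongrightarrow> 0"
    by (rule real_tendsto_divide_at_top[OF tendsto_const filterlim_real_sequentially])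
  then have "\<forall>\<^sub>F K in sequentially. real B / real K < y - long_limit M - short_site_tail M B"
    using B by (intro order_tendstoD(2)) auto
  then show "\<forall>\<^sub>F K in sequentially. heavy_limit K < y"
    using eventually_ge_at_top[of 1]
  proof eventually_elim
    case (elim K)
    then show ?case using heavy_limit_le[of K M B] by linarith
  qed
qed

lemma density_series_ennreal:
  assumes "0 \<le> z" "summable (\<lambda>j. \<alpha> (Suc j) * z ^ Suc j)"
  shows "density_series \<theta> V (ennreal z) = ennreal (T.dens z)"
proof -
  have "density_series \<theta> V (ennreal z) = (\<Sum>j. ennreal (\<alpha> (Suc j) * z ^ Suc j))"
    unfolding density_series_def
  proof (rule suminf_cong)
    fix j
    show "ennreal (\<theta> (Suc j)) * ennreal z ^ Suc j * ennreal (boltzmann_integral V (Suc j))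
        = ennreal (\<alpha> (Suc j) * z ^ Suc j)"
      using assms(1) theta_nonneg[of "Suc j"] boltzmann_integral_nonneg[of "Suc j"]
      by (simp only: ennreal_power ennreal_mult[symmetric] \<alpha>_def mult_nonneg_nonneg zero_le_power mult_ac
          le_add2 Suc_eq_plus1)
  qed
  also have "\<dots> = ennreal (T.dens z)"
    unfolding T.dens_def using assms alpha_nonneg by (intro suminf_ennreal2) auto
  finally show ?thesis .
qed

lemma density_series_mono: "z \<le> z' \<Longrightarrow> density_series \<theta> V z \<le> density_series \<theta> V z'"
  unfolding density_series_def
  by (intro suminf_le mult_right_mono mult_left_mono power_mono) auto

text \<open>If the fugacity is \<open>zc\<close>, its density is \<open>\<rho>\<^sub>c \<le> \<rho>\<close>. If it is smaller, its density is \<open>\<rho>\<close>, which is at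
  most \<open>\<rho>\<^sub>c\<close> by monotonicity; then both sides vanish.\<close>

lemma condensate_fraction_eq:
  "max 0 (1 - enn2ereal (transition_density \<theta> V) / ereal \<rho>) = ereal (1 - T.dens zs / \<rho>)"
proof (cases "zc = ereal zs")
  case True
  have d: "0 \<le> T.dens zs"
    using T.partial_density_le_dens[OF zs_nonneg T.fugacity_summable[OF rho_pos], of 0] by simp
  have "transition_density \<theta> V = ennreal (T.dens zs)"
    unfolding transition_density_def True
    by (simp only: e2ennreal_ereal density_series_ennreal[OF zs_nonneg T.fugacity_summable[OF rho_pos]])
  then have "1 - enn2ereal (transition_density \<theta> V) / ereal \<rho> = ereal (1 - T.dens zs / \<rho>)"
    using d rho_pos by (simp add: enn2ereal_ennreal one_ereal_def)
  moreover have "0 \<le> 1 - T.dens zs / \<rho>" using T.dens_fugacity_le[OF rho_pos] rho_pos by simp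
  ultimately show ?thesis by (simp add: max_def zero_ereal_def)
next
  case False
  then have less: "ereal zs < zc" using T.fugacity_le_zc[OF rho_pos] by simp
  then have d: "T.dens zs = \<rho>" by (rule T.dens_fugacity_eq[OF rho_pos])
  have "ennreal \<rho> = density_series \<theta> V (ennreal zs)"
    by (simp only: density_series_ennreal[OF zs_nonneg T.fugacity_summable[OF rho_pos]] d)
  also have "\<dots> \<le> transition_density \<theta> V"
    unfolding transition_density_def
  proof (rule density_series_mono)
    have "e2ennreal (ereal zs) \<le> e2ennreal zc" using less by (intro e2ennreal_mono) simp
    then show "ennreal zs \<le> e2ennreal zc" by (simp add: e2ennreal_ereal)
  qed
  finally have "enn2ereal (ennreal \<rho>) \<le> enn2ereal (transition_density \<theta> V)"
    by (simp add: less_eq_ennreal.rep_eq)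
  then have "ereal \<rho> \<le> enn2ereal (transition_density \<theta> V)"
    using rho_pos by (simp add: enn2ereal_ennreal)
  then have "1 \<le> enn2ereal (transition_density \<theta> V) / ereal \<rho>"
    using rho_pos by (subst ereal_le_divide_pos) auto
  then have "1 - enn2ereal (transition_density \<theta> V) / ereal \<rho> \<le> 0"
    by (cases "enn2ereal (transition_density \<theta> V) / ereal \<rho>") (auto simp: one_ereal_def zero_ereal_def)
  then show ?thesis using d rho_pos by (simp add: max_def zero_ereal_def)
qed

lemma condensation:
  "has_iterated_limit
      (\<lambda>K n. \<integral>lam. real (long_part_mass K lam) / real n \<partial>gibbs_measure \<theta> V (L n) n)
      (max 0 (1 - enn2ereal (transition_density \<theta> V) / ereal \<rho>))"
  "has_iterated_limit
      (\<lambda>K n. \<integral>lam. real (heavy_site_mass K lam) / real n \<partial>gibbs_measure \<theta> V (L n) n)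
      (max 0 (1 - enn2ereal (transition_density \<theta> V) / ereal \<rho>))"
  unfolding has_iterated_limit_def condensate_fraction_eq
  using long_fraction_lim long_limit_lim heavy_fraction_lim heavy_limit_lim by auto

end

theorem theorem5p1:
  fixes \<theta> :: "nat \<Rightarrow> real"
    and V :: "real ^ 'd::finite \<Rightarrow> ennreal"
    and \<rho> :: real
    and L :: "nat \<Rightarrow> real"
  assumes theta_nonneg: "\<And>j. j \<ge> 1 \<Longrightarrow> \<theta> j \<ge> 0"
    and rho_pos: "\<rho> > 0"
    and L_nonneg: "\<And>n. L n \<ge> 0"
    and L_def: "\<And>n. \<rho> * L n ^ CARD('d) = real n"
    and Z_pos: "\<And>n. n \<ge> 1 \<Longrightarrow> partition_function \<theta> V (L n) n > 0"
    and Z_finite: "\<And>n. n \<ge> 1 \<Longrightarrow> partition_function \<theta> V (L n) n < \<infinity>"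
    and integrable: "\<And>j. j \<ge> 1 \<Longrightarrow> integrable lebesgue (\<lambda>x. exp_neg (of_nat j * V x))"
    and zc_pos: "critical_fugacity \<theta> V > 0"
    and V_cont: "isCont V 0"
    and V_zero: "V 0 = 0"
    and riemann: "\<And>j. j \<ge> 1 \<Longrightarrow>
      ((\<lambda>l::real. (\<Sum>\<^sub>\<infinity>x\<in>UNIV. ennreal (exp_neg (of_nat j * V (scaled_site l x)))) / ennreal (l ^ CARD('d)))
        \<longlongrightarrow> ennreal (boltzmann_integral V j)) at_top"
  shows "has_iterated_limit
      (\<lambda>K n. \<integral>lam. real (long_part_mass K lam) / real n \<partial>gibbs_measure \<theta> V (L n) n)
      (max 0 (1 - enn2ereal (transition_density \<theta> V) / ereal \<rho>))
    \<and> has_iterated_limit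
      (\<lambda>K n. \<integral>lam. real (heavy_site_mass K lam) / real n \<partial>gibbs_measure \<theta> V (L n) n)
      (max 0 (1 - enn2ereal (transition_density \<theta> V) / ereal \<rho>))"
proof -
  interpret spatial_condensation \<theta> V \<rho> L
    by (rule spatial_condensation.intro) (fact assms | rule Z_pos, simp)+
  show ?thesis using condensation by (rule conjI)
qed

end
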